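(* Let $m>0$, let $H=\sqrt{-\Delta+m^2}$ on $\mathcal{H}=L^2(\mathbb{R}^n)$, and let $A=-\tfrac{\mathrm{i}}{2}(x\cdot\nabla+\nabla\cdot x)$ be the (self-adjoint) generator of dilations. For $t\in\mathbb{R}$ put $u_1(t)=\cos(tH)$ and $u_2(t)=\frac{\sin(tH)}{H}$, and for $f,g\in\mathcal{H}$ put $\psi_{f,g}(t)=\langle f,u_1(t)f\rangle+\langle f,u_2(t)g\rangle$. Let $\mathcal{E}=\{h\in\mathcal{H}\mid [h]_H<\infty\}$, where $[h]_H=\|\langle h,\mathrm{e}^{\mathrm{i}tH}h\rangle\|_{L^2_t(\mathbb{R})}^{1/2}$. Then for all $f,g\in D(A)\cap\mathcal{E}$ such that $Af,Ag\in\mathcal{E}$ there is a constant $C_{f,g}$ such that $|\psi_{f,g}(t)|\le C_{f,g}\langle t\rangle^{-1/2}$ for all $t\in\mathbb{R}$.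
   Context: Notation: $\langle t\rangle=(1+t^2)^{1/2}$. The operator $A$ is the closure of the indicated differential operator, which is essentially self-adjoint on the Schwartz space $\mathcal{S}(\mathbb{R}^n)$. The function $u(t)=u_1(t)f+u_2(t)g$ solves the Klein-Gordon equation $\partial_{tt}u+H^2u=0$, $u(0)=f$, $\partial_tu(0)=g$. *)

theory Defs
  imports "HOL-Analysis.Analysis"
begin

text \<open>
  Elements of \<open>L\<^sup>2(\<real>\<^sup>n)\<close> are represented by Borel functions, identified up to almost everywhere
  equality. The operators (as graphs) and norms below are invariant under changing representatives on null sets.
\<close>

definition enn_sqrt :: "ennreal \<Rightarrow> ennreal" where
  "enn_sqrt a = (if a = \<infinity> then \<infinity> else ennreal (sqrt (enn2real a)))"

definition L2_norm :: "('a::euclidean_space \<Rightarrow> complex) \<Rightarrow> ennreal" where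
  "L2_norm f = enn_sqrt (\<integral>\<^sup>+ x. ennreal ((norm (f x))\<^sup>2) \<partial>lborel)"

definition L2 :: "('a::euclidean_space \<Rightarrow> complex) set" where
  "L2 = {f \<in> borel_measurable lborel. L2_norm f < \<infinity>}"

definition L2_inner :: "('a::euclidean_space \<Rightarrow> complex) \<Rightarrow> ('a \<Rightarrow> complex) \<Rightarrow> complex" where
  "L2_inner f g = (LINT x|lborel. cnj (f x) * g x)"

definition L2_lim :: "(nat \<Rightarrow> 'a::euclidean_space \<Rightarrow> complex) \<Rightarrow> ('a \<Rightarrow> complex) \<Rightarrow> bool" where
  "L2_lim \<phi> f \<longleftrightarrow> (\<lambda>k. L2_norm (\<lambda>x. \<phi> k x - f x)) \<longlonglongrightarrow> 0"

text \<open>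
  A (possibly unbounded) operator on \<open>L\<^sup>2\<close> is given by its graph; its domain is \<^const>\<open>Domain\<close>.
  The value \<open>op_app T f\<close> is some representative of the class \<open>T f\<close>, meaningful for \<open>f\<close> in the domain.
\<close>

type_synonym 'n L2_op = "((real^'n \<Rightarrow> complex) \<times> (real^'n \<Rightarrow> complex)) set"

definition op_app :: "'n::finite L2_op \<Rightarrow> (real^'n \<Rightarrow> complex) \<Rightarrow> (real^'n \<Rightarrow> complex)" where
  "op_app T f = (SOME h. (f, h) \<in> T)"

definition fourier_integral :: "(real^'n::finite \<Rightarrow> complex) \<Rightarrow> real^'n \<Rightarrow> complex" where
  "fourier_integral f \<xi> =
     complex_of_real ((2 * pi) powr (- real CARD('n) / 2)) *
     (LINT x|lborel. cis (- (\<xi> \<bullet> x)) * f x)"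

text \<open>
  The unitary Fourier transform on \<open>L\<^sup>2\<close> as a graph, with \<open>F = l.i.m. \<integral>\<^bsub>|x| \<le> k\<^esub>\<close>: square-integrable
  functions are integrable on balls, so the integrals exist, and they converge in \<open>L\<^sup>2\<close> by Plancherel.
\<close>

definition fourier_L2 :: "'n::finite L2_op" where
  "fourier_L2 = {(f, F). f \<in> L2 \<and> F \<in> L2 \<and>
     L2_lim (\<lambda>k. fourier_integral (\<lambda>x. indicator (cball 0 (real k)) x * f x)) F}"

text \<open>
  The Borel functional calculus of the self-adjoint operator \<open>- \<Delta>\<close>: the Fourier transform
  diagonalises \<open>- \<Delta>\<close> as multiplication by \<open>|\<xi>|\<^sup>2\<close>, and \<open>p(- \<Delta>)\<close> is multiplication by \<open>p(|\<xi>|\<^sup>2)\<close>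
  on its maximal domain, conjugated by the Fourier transform. In particular
  \<open>neg_laplacian_fun complex_of_real\<close> is \<open>- \<Delta>\<close> with domain the Sobolev space of order 2.
\<close>

definition neg_laplacian_fun :: "(real \<Rightarrow> complex) \<Rightarrow> 'n::finite L2_op" where
  "neg_laplacian_fun p = {(f, h). \<exists>F G. (f, F) \<in> fourier_L2 \<and> (h, G) \<in> fourier_L2 \<and>
     (AE \<xi> in lborel. G \<xi> = p ((norm \<xi>)\<^sup>2) * F \<xi>)}"

text \<open>\<open>H_fun m p\<close> is \<open>p(H)\<close> for \<open>H = \<surd>(- \<Delta> + m\<^sup>2)\<close>; \<open>H\<close> itself is \<open>H_fun m complex_of_real\<close>.\<close>

definition H_fun :: "real \<Rightarrow> (real \<Rightarrow> complex) \<Rightarrow> 'n::finite L2_op" where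
  "H_fun m p = neg_laplacian_fun (\<lambda>s. p (sqrt (s + m\<^sup>2)))"

definition exp_itH :: "real \<Rightarrow> real \<Rightarrow> 'n::finite L2_op" where
  "exp_itH m t = H_fun m (\<lambda>s. exp (\<i> * complex_of_real (t * s)))"

definition u1 :: "real \<Rightarrow> real \<Rightarrow> 'n::finite L2_op" where
  "u1 m t = H_fun m (\<lambda>s. complex_of_real (cos (t * s)))"

definition u2 :: "real \<Rightarrow> real \<Rightarrow> 'n::finite L2_op" where
  "u2 m t = H_fun m (\<lambda>s. complex_of_real (sin (t * s) / s))"

definition psi :: "real \<Rightarrow> (real^'n::finite \<Rightarrow> complex) \<Rightarrow> (real^'n \<Rightarrow> complex) \<Rightarrow> real \<Rightarrow> complex" where
  "psi m f g t = L2_inner f (op_app (u1 m t) f) + L2_inner f (op_app (u2 m t) g)"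

definition H_bracket :: "real \<Rightarrow> (real^'n::finite \<Rightarrow> complex) \<Rightarrow> ennreal" where
  "H_bracket m h = enn_sqrt (L2_norm (\<lambda>t::real. L2_inner h (op_app (exp_itH m t) h)))"

definition E_space :: "real \<Rightarrow> (real^'n::finite \<Rightarrow> complex) set" where
  "E_space m = {h \<in> L2. H_bracket m h < \<infinity>}"

definition partial :: "'n::finite \<Rightarrow> (real^'n \<Rightarrow> complex) \<Rightarrow> real^'n \<Rightarrow> complex" where
  "partial i f x = frechet_derivative f (at x) (axis i 1)"

text \<open>
  Here \<open>foldr partial is f\<close> is the iterated partial derivative of \<open>f\<close> along the list \<open>is\<close>; that all of
  these are (Frechet) differentiable amounts to \<open>f\<close> being smooth.
\<close>

definition schwartz :: "(real^'n::finite \<Rightarrow> complex) set" where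
  "schwartz = {f. \<forall>is. foldr partial is f differentiable_on UNIV \<and>
     (\<forall>k::nat. bounded (range (\<lambda>x. (norm x) ^ k *\<^sub>R foldr partial is f x)))}"

definition dilation_core :: "(real^'n::finite \<Rightarrow> complex) \<Rightarrow> real^'n \<Rightarrow> complex" where
  "dilation_core f x = - (\<i> / 2) *
     ((\<Sum>j\<in>UNIV. complex_of_real (x $ j) * partial j f x) +
      (\<Sum>j\<in>UNIV. partial j (\<lambda>y. complex_of_real (y $ j) * f y) x))"

text \<open>The generator of dilations \<open>A\<close>: the closure in \<open>L\<^sup>2 \<times> L\<^sup>2\<close> of the graph on Schwartz functions.\<close>

definition dilation_gen :: "'n::finite L2_op" where
  "dilation_gen = {(f, h). f \<in> L2 \<and> h \<in> L2 \<and>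
     (\<exists>\<phi>. (\<forall>k. \<phi> k \<in> schwartz) \<and> L2_lim \<phi> f \<and> L2_lim (\<lambda>k. dilation_core (\<phi> k)) h)}"

definition japanese_bracket :: "real \<Rightarrow> real" where
  "japanese_bracket t = (1 + t\<^sup>2) powr (1 / 2)"

end

theory Submission
  imports Defs "HOL-Probability.Characteristic_Functions" "HOL-Probability.Sinc_Integral"
begin

text \<open>
  On the Fourier side the matrix element \<open>\<eta>(t) = \<langle>f, b(H) e\<^sup>i\<^sup>t\<^sup>(\<^sup>H\<^sup>-\<^sup>m\<^sup>) g\<rangle>\<close> is the Fourier
  transform of a density on \<open>[m, \<infinity>)\<close>. It is square-integrable in \<open>t\<close> whenever the brackets of \<open>f\<close>
  and \<open>g\<close> are finite: damped by a Gaussian, \<open>\<integral> |\<eta>|\<^sup>2\<close> is a double integral against a positive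
  kernel, which is dominated by the kernels belonging to the pairs \<open>(f, f)\<close> and \<open>(g, g)\<close>, and
  the damping can be removed.
  The commutator with \<open>A\<close>, tested on bounded functions of \<open>H\<close>, expresses \<open>t \<eta>'(t)\<close> through
  matrix elements of the same kind formed from \<open>f\<close>, \<open>g\<close>, \<open>A f\<close>, \<open>A g\<close>; hence \<open>t \<eta>'\<close> is
  square-integrable too. Since \<open>f\<close> need not lie in the form domain of \<open>H\<close>, this is used in the integrated
  form \<open>\<eta>(r) - \<eta>(t) = \<integral>\<^bsub>t\<^esub>\<^bsup>r\<^esup> (s \<eta>'(s)) ds/s\<close>. For \<open>r \<in> [t, 2t]\<close> the right hand side is
  \<open>O(t\<^sup>-\<^sup>1\<^sup>/\<^sup>2)\<close>, and so is the mean of \<open>|\<eta>(r)|\<close> over this interval; therefore \<open>\<eta>(t)\<close> is.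
  The shift of \<open>H\<close> by \<open>m\<close> absorbs the vanishing of \<open>i[H, A] = H - m\<^sup>2/H\<close> at the bottom
  of the spectrum.
\<close>


section \<open>Square-integrable functions\<close>

text \<open>The multiplier of \<open>e^(itH)\<close> has unbounded derivative along dilation orbits,
  so the commutator is tested on \<open>\<gamma>(l)\<close> times \<open>phase_avg\<close>, the
  integral of \<open>e^(is(l-m)) / s\<close> over \<open>s\<close> in \<open>[t, r]\<close>. Its
  dilation derivative contains \<open>\<gamma>(l) * ((l^2 - m^2) / l) / (l - m)\<close> times the
  difference of the phases at \<open>r\<close> and \<open>t\<close>. The quotient is
  \<open>(l + m) / l\<close>, without zero at \<open>l = m\<close>; unshifted phases would give
  \<open>(l^2 - m^2) / l^2\<close>, and no bounded \<open>\<gamma>\<close> could then produce the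
  weight 1. A wanted weight \<open>\<beta>\<close> forces
  \<open>\<gamma> = \<beta> * l / (l + m)\<close>: \<open>l / (l + m)\<close> for the cosine and
  \<open>1 / (l + m)\<close> for \<open>sin(tH)/H\<close>.

  The commutator identity comes from difference quotients of the unitary dilation group on Schwartz
  functions. For multipliers bounded together with their dilation derivative, both sides are
  continuous in \<open>f\<close>, \<open>g\<close>, \<open>A f\<close>, \<open>A g\<close> and pass
  to the closure that defines \<open>A\<close>.

  Only the power of \<open>t\<close> matters, so time integrals are estimated by
  \<open>x y \<le> x^2 + y^2\<close> in place of the Cauchy-Schwarz inequality; hence the summands 1
  in the bounds.\<close>

definition L2sq :: "('a::euclidean_space \<Rightarrow> complex) \<Rightarrow> real" where
  "L2sq f = (LINT x|lborel. (norm (f x))\<^sup>2)"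

text \<open>Squares stay in the reals and expand algebraically; the price is the factor 2 in
  \<open>L2sq_add_le\<close> and \<open>L2sq_diff_le\<close>. A Bochner integral that does not exist
  is 0, so this convergence says something only when the differences lie in
  \<open>L2\<close>.\<close>

abbreviation L2_tendsto :: "(nat \<Rightarrow> 'a::euclidean_space \<Rightarrow> complex) \<Rightarrow> ('a \<Rightarrow> complex) \<Rightarrow> bool" where
  "L2_tendsto \<phi> f \<equiv> (\<lambda>k. L2sq (\<lambda>x. \<phi> k x - f x)) \<longlonglongrightarrow> 0"

lemma L2sq_nonneg [simp]: "0 \<le> L2sq f"
  unfolding L2sq_def by simp

lemma enn_sqrt_less_top_iff [simp]: "enn_sqrt a < \<infinity> \<longleftrightarrow> a < \<infinity>"
  unfolding enn_sqrt_def by (auto simp: less_top)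

lemma L2_iff:
  "f \<in> L2 \<longleftrightarrow> f \<in> borel_measurable lborel \<and> integrable lborel (\<lambda>x. (norm (f x))\<^sup>2)"
proof -
  have "L2_norm f < \<infinity> \<longleftrightarrow> integrable lborel (\<lambda>x. (norm (f x))\<^sup>2)" if "f \<in> borel_measurable lborel"
    using that unfolding L2_norm_def enn_sqrt_less_top_iff
    by (subst integrable_iff_bounded) auto
  then show ?thesis
    unfolding L2_def by auto
qed

lemma L2_measurable [measurable_dest]: "f \<in> L2 \<Longrightarrow> f \<in> borel_measurable borel"
  by (simp add: L2_iff)

lemma L2_integrable: "f \<in> L2 \<Longrightarrow> integrable lborel (\<lambda>x. (norm (f x))\<^sup>2)"
  by (simp add: L2_iff)

lemma L2_I:
  assumes "f \<in> borel_measurable borel" "integrable lborel (\<lambda>x. (norm (f x))\<^sup>2)"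
  shows "f \<in> L2"
  using assms by (simp add: L2_iff)

lemma nn_integral_L2sq:
  assumes "f \<in> L2"
  shows "(\<integral>\<^sup>+ x. ennreal ((norm (f x))\<^sup>2) \<partial>lborel) = ennreal (L2sq f)"
  unfolding L2sq_def by (rule nn_integral_eq_integral[OF L2_integrable[OF assms]]) simp

lemma L2_norm_eq:
  assumes "f \<in> L2"
  shows "L2_norm f = ennreal (sqrt (L2sq f))"
  unfolding L2_norm_def enn_sqrt_def nn_integral_L2sq[OF assms] by (simp add: enn2real_ennreal)

lemma norm_mult_le_sum_squares:
  fixes x y :: "'a::real_normed_div_algebra"
  shows "norm (x * y) \<le> (norm x)\<^sup>2 + (norm y)\<^sup>2"
proof -
  have "norm x * norm y \<le> ((norm x)\<^sup>2 + (norm y)\<^sup>2) / 2"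
    using sum_squares_bound[of "norm x" "norm y"] by simp
  also have "\<dots> \<le> (norm x)\<^sup>2 + (norm y)\<^sup>2"
    by simp
  finally show ?thesis by (simp add: norm_mult)
qed

lemma norm_add_square_le:
  fixes x y :: "'a::real_normed_vector"
  shows "(norm (x + y))\<^sup>2 \<le> 2 * (norm x)\<^sup>2 + 2 * (norm y)\<^sup>2"
proof -
  have "(norm (x + y))\<^sup>2 \<le> (norm x + norm y)\<^sup>2"
    by (intro power_mono norm_triangle_ineq) simp
  also have "\<dots> \<le> 2 * (norm x)\<^sup>2 + 2 * (norm y)\<^sup>2"
    using sum_squares_bound[of "norm x" "norm y"] by (simp add: power2_sum)
  finally show ?thesis .
qed

lemma L2_add:
  assumes f: "f \<in> L2" and g: "g \<in> L2"
  shows "(\<lambda>x. f x + g x) \<in> L2"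
proof (rule L2_I)
  show "(\<lambda>x. f x + g x) \<in> borel_measurable borel"
    using f g by measurable
  show "integrable lborel (\<lambda>x. (norm (f x + g x))\<^sup>2)"
  proof (rule Bochner_Integration.integrable_bound)
    show "integrable lborel (\<lambda>x. 2 * (norm (f x))\<^sup>2 + 2 * (norm (g x))\<^sup>2)"
      using f g by (intro Bochner_Integration.integrable_add integrable_mult_right L2_integrable)
    show "(\<lambda>x. (norm (f x + g x))\<^sup>2) \<in> borel_measurable lborel"
      using f g by measurable
    show "AE x in lborel. norm ((norm (f x + g x))\<^sup>2) \<le> norm (2 * (norm (f x))\<^sup>2 + 2 * (norm (g x))\<^sup>2)"
      by (simp add: norm_add_square_le)
  qed
qed

lemma L2_mult_bounded:
  assumes f: "f \<in> L2" and b: "b \<in> borel_measurable borel" "\<And>x. norm (b x) \<le> B"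
  shows "(\<lambda>x. b x * f x) \<in> L2"
proof (rule L2_I)
  show "(\<lambda>x. b x * f x) \<in> borel_measurable borel"
    using f b by measurable
  show "integrable lborel (\<lambda>x. (norm (b x * f x))\<^sup>2)"
  proof (rule Bochner_Integration.integrable_bound)
    show "integrable lborel (\<lambda>x. B\<^sup>2 * (norm (f x))\<^sup>2)"
      using f by (intro integrable_mult_right L2_integrable)
    show "(\<lambda>x. (norm (b x * f x))\<^sup>2) \<in> borel_measurable lborel"
      using f b by measurable
    show "AE x in lborel. norm ((norm (b x * f x))\<^sup>2) \<le> norm (B\<^sup>2 * (norm (f x))\<^sup>2)"
      using b(2) by (auto simp: norm_mult power_mult_distrib intro!: mult_right_mono power_mono)
  qed
qed

lemma L2_cmult: "f \<in> L2 \<Longrightarrow> (\<lambda>x. c * f x) \<in> L2"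
  by (rule L2_mult_bounded[where B = "norm c"]) auto

lemma L2_diff: "f \<in> L2 \<Longrightarrow> g \<in> L2 \<Longrightarrow> (\<lambda>x. f x - g x) \<in> L2"
  using L2_add[of f "\<lambda>x. -1 * g x"] L2_cmult[of g "-1"] by simp

lemma cnj_measurable [measurable]: "f \<in> borel_measurable M \<Longrightarrow> (\<lambda>x. cnj (f x)) \<in> borel_measurable M"
  by (rule borel_measurable_continuous_on) (auto intro!: continuous_intros)

lemma L2_cnj: "f \<in> L2 \<Longrightarrow> (\<lambda>x. cnj (f x)) \<in> L2"
  by (rule L2_I) (simp_all add: L2_integrable)

lemma L2_inner_integrable:
  assumes f: "f \<in> L2" and g: "g \<in> L2"
  shows "integrable lborel (\<lambda>x. cnj (f x) * g x)"
proof (rule Bochner_Integration.integrable_bound)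
  show "integrable lborel (\<lambda>x. (norm (f x))\<^sup>2 + (norm (g x))\<^sup>2)"
    using f g by (intro Bochner_Integration.integrable_add L2_integrable)
  show "(\<lambda>x. cnj (f x) * g x) \<in> borel_measurable lborel"
    using f g by measurable
  show "AE x in lborel. norm (cnj (f x) * g x) \<le> norm ((norm (f x))\<^sup>2 + (norm (g x))\<^sup>2)"
    using norm_mult_le_sum_squares[of "cnj (f _)" "g _"] by (auto simp: norm_mult)
qed

lemma L2_inner_add_right:
  assumes "f \<in> L2" "g \<in> L2" "h \<in> L2"
  shows "L2_inner f (\<lambda>x. g x + h x) = L2_inner f g + L2_inner f h"
  unfolding L2_inner_def using assms by (simp add: distrib_left L2_inner_integrable)

lemma L2_inner_diff_right:
  assumes "f \<in> L2" "g \<in> L2" "h \<in> L2"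
  shows "L2_inner f (\<lambda>x. g x - h x) = L2_inner f g - L2_inner f h"
  unfolding L2_inner_def using assms by (simp add: right_diff_distrib L2_inner_integrable)

lemma L2_inner_diff_left:
  assumes "f \<in> L2" "g \<in> L2" "h \<in> L2"
  shows "L2_inner (\<lambda>x. f x - g x) h = L2_inner f h - L2_inner g h"
  unfolding L2_inner_def using assms by (simp add: left_diff_distrib L2_inner_integrable)

lemma L2_inner_cmult_right: "L2_inner f (\<lambda>x. c * g x) = c * L2_inner f g"
  unfolding L2_inner_def by (simp add: mult.left_commute)

lemma L2_inner_cmult_left: "L2_inner (\<lambda>x. c * f x) g = cnj c * L2_inner f g"
  unfolding L2_inner_def by (simp add: mult.assoc)

lemma L2_inner_commute: "L2_inner g f = cnj (L2_inner f g)"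
  unfolding L2_inner_def by (subst Bochner_Integration.integral_cnj[symmetric]) (simp add: mult.commute)

lemma L2_inner_self: "L2_inner f f = complex_of_real (L2sq f)"
proof -
  have "cnj (f x) * f x = complex_of_real ((norm (f x))\<^sup>2)" for x
    by (simp only: complex_norm_square mult.commute)
  then show ?thesis
    unfolding L2_inner_def L2sq_def by (simp only: integral_complex_of_real)
qed

lemma L2sq_cmult: "L2sq (\<lambda>x. c * f x) = (norm c)\<^sup>2 * L2sq f"
  unfolding L2sq_def by (simp add: norm_mult power_mult_distrib)

lemma L2sq_diff_commute: "L2sq (\<lambda>x. f x - g x) = L2sq (\<lambda>x. g x - f x)"
  unfolding L2sq_def by (simp add: norm_minus_commute)

lemma L2sq_add_le:
  assumes "f \<in> L2" "g \<in> L2"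
  shows "L2sq (\<lambda>x. f x + g x) \<le> 2 * L2sq f + 2 * L2sq g"
proof -
  have "L2sq (\<lambda>x. f x + g x) \<le> (LINT x|lborel. 2 * (norm (f x))\<^sup>2 + 2 * (norm (g x))\<^sup>2)"
    unfolding L2sq_def using assms
    by (intro integral_mono Bochner_Integration.integrable_add integrable_mult_right L2_integrable L2_add
        norm_add_square_le)
  also have "\<dots> = 2 * L2sq f + 2 * L2sq g"
    unfolding L2sq_def using assms by (simp add: L2_integrable)
  finally show ?thesis .
qed

lemma L2sq_diff_le:
  assumes "f \<in> L2" "g \<in> L2" "h \<in> L2"
  shows "L2sq (\<lambda>x. f x - h x) \<le> 2 * L2sq (\<lambda>x. f x - g x) + 2 * L2sq (\<lambda>x. g x - h x)"
  using L2sq_add_le[of "\<lambda>x. f x - g x" "\<lambda>x. g x - h x"] assms by (simp add: L2_diff)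

lemma L2sq_diff_expand:
  assumes "f \<in> L2" "g \<in> L2"
  shows "L2sq (\<lambda>x. f x - g x) = L2sq f - 2 * Re (L2_inner f g) + L2sq g"
proof -
  have "complex_of_real (L2sq (\<lambda>x. f x - g x))
      = L2_inner f f - L2_inner f g - (L2_inner g f - L2_inner g g)"
    using assms by (simp add: L2_inner_self[symmetric] L2_inner_diff_left L2_inner_diff_right L2_diff)
  also have "\<dots> = complex_of_real (L2sq f) - (L2_inner f g + cnj (L2_inner f g)) + complex_of_real (L2sq g)"
    by (simp add: L2_inner_self L2_inner_commute[of g f])
  also have "\<dots> = complex_of_real (L2sq f - 2 * Re (L2_inner f g) + L2sq g)"
    by (simp add: complex_add_cnj)
  finally show ?thesis
    using of_real_eq_iff by blast
qed

lemma L2sq_cong_AE: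
  assumes "f \<in> L2" "g \<in> L2" "AE x in lborel. f x = g x"
  shows "L2sq f = L2sq g"
  unfolding L2sq_def using assms by (intro integral_cong_AE) auto

lemma L2_inner_cong_AE:
  assumes "f \<in> L2" "g \<in> L2" "f' \<in> L2" "g' \<in> L2"
    and "AE x in lborel. f x = f' x" "AE x in lborel. g x = g' x"
  shows "L2_inner f g = L2_inner f' g'"
  unfolding L2_inner_def using assms by (intro integral_cong_AE) auto

lemma L2sq_eq_0_imp_AE:
  assumes "f \<in> L2" "L2sq f = 0"
  shows "AE x in lborel. f x = 0"
  using assms integral_nonneg_eq_0_iff_AE[OF L2_integrable[OF assms(1)]] unfolding L2sq_def by auto

lemma L2sq_diff_eq_0_imp_AE:
  assumes "f \<in> L2" "g \<in> L2" "L2sq (\<lambda>x. f x - g x) = 0"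
  shows "AE x in lborel. f x = g x"
  using L2sq_eq_0_imp_AE[OF L2_diff assms(3)] assms by simp

lemma L2_Cauchy_Schwarz:
  assumes f: "f \<in> L2" and g: "g \<in> L2"
  shows "norm (L2_inner f g) \<le> sqrt (L2sq f) * sqrt (L2sq g)"
proof -
  define c where "c = L2_inner g f"
  \<comment> \<open>A quadratic in \<open>r\<close> that is never negative. The choice
    \<open>r = 1 / L2sq g\<close> gives the claim; if \<open>L2sq g = 0\<close>, the
    \<open>r\<close> chosen below would give it the value -1.\<close>
  have key: "0 \<le> L2sq f - 2 * r * (norm c)\<^sup>2 + r\<^sup>2 * (norm c)\<^sup>2 * L2sq g" for r :: real
  proof -
    have "L2sq (\<lambda>x. f x - (complex_of_real r * c) * g x)
        = L2sq f - 2 * Re (complex_of_real r * (c * cnj c)) + (norm (complex_of_real r * c))\<^sup>2 * L2sq g"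
      using f g by (simp add: L2sq_diff_expand L2_cmult L2_inner_cmult_right L2sq_cmult c_def
          L2_inner_commute[of f g] mult.assoc norm_mult power_mult_distrib)
    also have "\<dots> = L2sq f - 2 * r * (norm c)\<^sup>2 + r\<^sup>2 * (norm c)\<^sup>2 * L2sq g"
      by (simp add: complex_norm_square[symmetric] norm_mult power_mult_distrib)
    finally show ?thesis
      using L2sq_nonneg by metis
  qed
  have "(norm c)\<^sup>2 \<le> L2sq f * L2sq g"
  proof (cases "L2sq g = 0")
    case True
    have "(norm c)\<^sup>2 = 0"
    proof (rule ccontr)
      assume "(norm c)\<^sup>2 \<noteq> 0"
      then have "2 * ((L2sq f + 1) / (2 * (norm c)\<^sup>2)) * (norm c)\<^sup>2 = L2sq f + 1"
        by simp
      then show False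
        using key[of "(L2sq f + 1) / (2 * (norm c)\<^sup>2)"] True by simp
    qed
    then show ?thesis using True by simp
  next
    case False
    then have pos: "L2sq g > 0" using L2sq_nonneg[of g] by linarith
    have "0 \<le> L2sq f - (norm c)\<^sup>2 / L2sq g"
      using key[of "1 / L2sq g"] pos by (simp add: field_simps power2_eq_square)
    then show ?thesis using pos by (simp add: field_simps)
  qed
  then have "(norm (L2_inner f g))\<^sup>2 \<le> L2sq f * L2sq g"
    unfolding c_def by (simp add: L2_inner_commute[of g f])
  then have "norm (L2_inner f g) \<le> sqrt (L2sq f * L2sq g)"
    by (rule real_le_rsqrt)
  then show ?thesis by (simp add: real_sqrt_mult)
qed

section \<open>Convergence, completeness and density in L2\<close>

lemma L2_inner_tendsto:
  assumes L2: "\<And>k. \<phi> k \<in> L2" "\<And>k. \<gamma> k \<in> L2" "f \<in> L2" "g \<in> L2"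
    and f: "L2_tendsto \<phi> f"
    and g: "L2_tendsto \<gamma> g"
  shows "(\<lambda>k. L2_inner (\<phi> k) (\<gamma> k)) \<longlonglongrightarrow> L2_inner f g"
proof -
  define a where "a = (\<lambda>k. sqrt (L2sq (\<lambda>x. \<phi> k x - f x)))"
  define b where "b = (\<lambda>k. sqrt (L2sq (\<lambda>x. \<gamma> k x - g x)))"
  have a: "a \<longlonglongrightarrow> 0" and b: "b \<longlonglongrightarrow> 0"
    unfolding a_def b_def using tendsto_real_sqrt[OF f] tendsto_real_sqrt[OF g] by simp_all
  have le: "norm (L2_inner (\<phi> k) (\<gamma> k) - L2_inner f g)
      \<le> a k * b k + a k * sqrt (L2sq g) + sqrt (L2sq f) * b k" for k
  proof -
    have "L2_inner (\<phi> k) (\<gamma> k) - L2_inner f g = L2_inner (\<lambda>x. \<phi> k x - f x) (\<lambda>x. \<gamma> k x - g x)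
        + L2_inner (\<lambda>x. \<phi> k x - f x) g + L2_inner f (\<lambda>x. \<gamma> k x - g x)"
      using L2 by (simp add: L2_inner_diff_left L2_inner_diff_right L2_diff)
    also have "norm \<dots> \<le> a k * b k + a k * sqrt (L2sq g) + sqrt (L2sq f) * b k"
      unfolding a_def b_def using L2
      by (intro norm_triangle_le add_mono L2_Cauchy_Schwarz L2_diff)
    finally show ?thesis .
  qed
  have lim: "(\<lambda>k. a k * b k + a k * sqrt (L2sq g) + sqrt (L2sq f) * b k) \<longlonglongrightarrow> 0 * 0 + 0 * sqrt (L2sq g) + sqrt (L2sq f) * 0"
    by (intro tendsto_intros a b)
  have "(\<lambda>k. L2_inner (\<phi> k) (\<gamma> k) - L2_inner f g) \<longlonglongrightarrow> 0"
    by (rule Lim_null_comparison[OF always_eventually[OF allI[OF le]]]) (use lim in simp)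
  then show ?thesis
    by (rule LIM_zero_cancel)
qed

lemma L2sq_tendsto:
  assumes "\<And>k. \<phi> k \<in> L2" "f \<in> L2" "L2_tendsto \<phi> f"
  shows "(\<lambda>k. L2sq (\<phi> k)) \<longlonglongrightarrow> L2sq f"
  using tendsto_Re[OF L2_inner_tendsto[OF assms(1,1,2,2,3,3)]] by (simp add: L2_inner_self)

lemma L2sq_squeeze:
  assumes "\<forall>k. L2sq (h k) \<le> b k" "b \<longlonglongrightarrow> c" "c = 0"
  shows "(\<lambda>k. L2sq (h k)) \<longlonglongrightarrow> 0"
  by (rule tendsto_sandwich[OF _ _ tendsto_const assms(2)[unfolded assms(3)]])
     (use assms(1) in auto)

lemma L2_lim_iff:
  assumes "\<And>k. \<phi> k \<in> L2" "f \<in> L2"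
  shows "L2_lim \<phi> f \<longleftrightarrow> L2_tendsto \<phi> f"
proof -
  have "L2_lim \<phi> f \<longleftrightarrow> (\<lambda>k. ennreal (sqrt (L2sq (\<lambda>x. \<phi> k x - f x)))) \<longlonglongrightarrow> ennreal 0"
    unfolding L2_lim_def using assms by (simp add: L2_norm_eq L2_diff)
  also have "\<dots> \<longleftrightarrow> (\<lambda>k. sqrt (L2sq (\<lambda>x. \<phi> k x - f x))) \<longlonglongrightarrow> 0"
    by (subst tendsto_ennreal_iff) auto
  also have "\<dots> \<longleftrightarrow> L2_tendsto \<phi> f"
  proof
    assume "(\<lambda>k. sqrt (L2sq (\<lambda>x. \<phi> k x - f x))) \<longlonglongrightarrow> 0"
    from tendsto_power[OF this, of 2] show "L2_tendsto \<phi> f"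
      by simp
  qed (use tendsto_real_sqrt in fastforce)
  finally show ?thesis .
qed

lemma L2_dominated_convergence:
  fixes \<phi> :: "nat \<Rightarrow> 'a::euclidean_space \<Rightarrow> complex"
  assumes meas: "\<And>k. \<phi> k \<in> borel_measurable borel" "f \<in> borel_measurable borel"
    and lim: "AE x in lborel. (\<lambda>k. \<phi> k x) \<longlonglongrightarrow> f x"
    and bound: "\<And>k. AE x in lborel. (norm (\<phi> k x - f x))\<^sup>2 \<le> w x"
    and w: "integrable lborel w"
  shows "L2_tendsto \<phi> f"
proof -
  have "(\<lambda>k. LINT x|lborel. (norm (\<phi> k x - f x))\<^sup>2) \<longlonglongrightarrow> (LINT x|(lborel::'a measure). 0::real)"
  proof (rule integral_dominated_convergence[OF _ _ w])
    show "AE x in lborel. (\<lambda>k. (norm (\<phi> k x - f x))\<^sup>2) \<longlonglongrightarrow> 0"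
      using lim
    proof eventually_elim
      case (elim x)
      then have "(\<lambda>k. norm (\<phi> k x - f x)) \<longlonglongrightarrow> 0"
        by (simp add: LIM_zero_iff tendsto_norm_zero_iff)
      from tendsto_power[OF this, of 2] show ?case by simp
    qed
    show "AE x in lborel. norm ((norm (\<phi> k x - f x))\<^sup>2) \<le> w x" for k
      using bound[of k] by simp
  qed (use meas in measurable)
  then show ?thesis
    unfolding L2sq_def by simp
qed

text \<open>Riesz-Fischer. The increments \<open>d k\<close> of a fast subsequence satisfy
  \<open>L2sq (d k) \<le> (1/4)^k\<close>, so even with weights \<open>2^k\<close> the integrals sum
  to a finite value. Hence \<open>2^k * (norm (d k x))^2\<close> is summable almost everywhere,
  which forces absolute convergence of the telescoping sum. Fatou's lemma then upgrades the
  pointwise limit to an L2 limit of the whole sequence.\<close>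

lemma L2_complete:
  fixes \<phi> :: "nat \<Rightarrow> 'a::euclidean_space \<Rightarrow> complex"
  assumes L2: "\<And>k. \<phi> k \<in> L2"
    and Cauchy: "\<And>e. e > 0 \<Longrightarrow> \<exists>N. \<forall>i\<ge>N. \<forall>j\<ge>N. L2sq (\<lambda>x. \<phi> i x - \<phi> j x) < e"
  shows "\<exists>f\<in>L2. L2_tendsto \<phi> f"
proof -
  have "\<exists>N. \<forall>i\<ge>N. \<forall>j\<ge>N. L2sq (\<lambda>x. \<phi> i x - \<phi> j x) < (1/4)^k" for k :: nat
    using Cauchy[of "(1/4)^k"] by simp
  then obtain N where N: "\<And>k i j. i \<ge> N k \<Longrightarrow> j \<ge> N k \<Longrightarrow> L2sq (\<lambda>x. \<phi> i x - \<phi> j x) < (1/4)^k"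
    by metis
  \<comment> \<open>Adding all earlier \<open>N i\<close> makes \<open>r\<close> monotone and bounds
    it below by \<open>k\<close> and by \<open>N k\<close> at once.\<close>
  define r where "r k = k + (\<Sum>i\<le>k. N i)" for k
  have rN: "N k \<le> r k" and r_ge: "k \<le> r k" and r_mono: "r k \<le> r (Suc k)" for k
    unfolding r_def using member_le_sum[of k "{..k}" N] by auto
  define d where "d k x = \<phi> (r (Suc k)) x - \<phi> (r k) x" for k x
  have d_L2: "d k \<in> L2" for k
    unfolding d_def by (intro L2_diff L2)
  have d_le: "L2sq (d k) \<le> (1/4)^k" for k
    unfolding d_def using N[of k "r (Suc k)" "r k"] rN[of k] r_mono[of k] by simp
  have "(\<integral>\<^sup>+ x. (\<Sum>k. ennreal (2^k * (norm (d k x))\<^sup>2)) \<partial>lborel)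
      = (\<Sum>k. \<integral>\<^sup>+ x. ennreal (2^k * (norm (d k x))\<^sup>2) \<partial>lborel)"
    using d_L2 by (intro nn_integral_suminf) simp
  also have "\<dots> = (\<Sum>k. ennreal (2^k * L2sq (d k)))"
    using d_L2 by (intro suminf_cong)
      (simp add: ennreal_mult' nn_integral_cmult nn_integral_L2sq)
  also have "\<dots> \<le> (\<Sum>k. ennreal ((1/2)^k))"
  proof (intro suminf_le allI)
    fix k
    have "2^k * L2sq (d k) \<le> 2^k * (1/4)^k"
      using d_le[of k] by simp
    also have "\<dots> = (1/2)^k"
      by (simp add: power_mult_distrib[symmetric])
    finally show "ennreal (2^k * L2sq (d k)) \<le> ennreal ((1/2)^k)"
      by (rule ennreal_leI)
  qed auto
  also have "\<dots> = ennreal (\<Sum>k. (1/2)^k)"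
    by (intro suminf_ennreal2) (auto intro: summable_geometric)
  also have "\<dots> < \<infinity>" by simp
  finally have "AE x in lborel. (\<Sum>k. ennreal (2^k * (norm (d k x))\<^sup>2)) \<noteq> \<infinity>"
    using d_L2 by (intro nn_integral_noteq_infinite) auto
  then have conv: "AE x in lborel. convergent (\<lambda>k. \<phi> (r k) x)"
  proof eventually_elim
    case (elim x)
    have sm: "summable (\<lambda>k. 2^k * (norm (d k x))\<^sup>2)"
      by (rule summable_suminf_not_top) (use elim in auto)
    have "summable (\<lambda>k. norm (d k x))"
    proof (rule summable_comparison_test'[where N = 0])
      show "summable (\<lambda>k. 2^k * (norm (d k x))\<^sup>2 + (1/2)^k)"
        by (intro summable_add sm summable_geometric) auto
      fix k :: nat
      \<comment> \<open>With \<open>sqrt 2 ^ k\<close> split off, the squares of the two factors are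
        the weighted term and a geometric term.\<close>
      have "norm (d k x) = (sqrt 2 ^ k * norm (d k x)) * (1 / sqrt 2 ^ k)" by simp
      also have "\<dots> \<le> (sqrt 2 ^ k * norm (d k x))\<^sup>2 + (1 / sqrt 2 ^ k)\<^sup>2"
        using norm_mult_le_sum_squares[of "sqrt 2 ^ k * norm (d k x)" "1 / sqrt 2 ^ k"]
        by (simp add: abs_mult power_abs)
      also have "\<dots> = 2^k * (norm (d k x))\<^sup>2 + (1/2)^k"
        by (simp add: power_mult_distrib power_divide power_mult[symmetric] mult.commute[of k])
           (simp add: power_mult)
      finally show "norm (norm (d k x)) \<le> 2^k * (norm (d k x))\<^sup>2 + (1/2)^k" by simp
    qed
    then have "summable (\<lambda>k. d k x)"
      by (rule summable_norm_cancel)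
    then have "convergent (\<lambda>n. \<phi> (r 0) x + (\<Sum>k<n. d k x))"
      by (intro convergent_add convergent_const) (simp add: summable_iff_convergent)
    moreover have "\<phi> (r 0) x + (\<Sum>k<n. d k x) = \<phi> (r n) x" for n
      using sum_lessThan_telescope[of "\<lambda>k. \<phi> (r k) x" n] by (simp add: d_def)
    ultimately show ?case by simp
  qed
  define f where "f x = lim (\<lambda>k. \<phi> (r k) x)" for x
  have f_meas: "f \<in> borel_measurable borel"
    unfolding f_def using L2 by measurable
  have lim: "AE x in lborel. (\<lambda>k. \<phi> (r k) x) \<longlonglongrightarrow> f x"
    using conv by eventually_elim (simp add: f_def convergent_LIMSEQ_iff)
  have close: "(\<integral>\<^sup>+ x. ennreal ((norm (\<phi> i x - f x))\<^sup>2) \<partial>lborel) \<le> ennreal ((1/4)^k)" if i: "i \<ge> N k" for i k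
  proof -
    have "(\<integral>\<^sup>+ x. ennreal ((norm (\<phi> i x - f x))\<^sup>2) \<partial>lborel)
        = (\<integral>\<^sup>+ x. liminf (\<lambda>j. ennreal ((norm (\<phi> i x - \<phi> (r j) x))\<^sup>2)) \<partial>lborel)"
    proof (rule nn_integral_cong_AE, use lim in eventually_elim)
      case (elim x)
      then have "(\<lambda>j. ennreal ((norm (\<phi> i x - \<phi> (r j) x))\<^sup>2)) \<longlonglongrightarrow> ennreal ((norm (\<phi> i x - f x))\<^sup>2)"
        by (intro tendsto_intros tendsto_ennrealI)
      from lim_imp_Liminf[OF trivial_limit_sequentially this] show ?case
        by (rule sym)
    qed
    also have "\<dots> \<le> liminf (\<lambda>j. \<integral>\<^sup>+ x. ennreal ((norm (\<phi> i x - \<phi> (r j) x))\<^sup>2) \<partial>lborel)"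
      using L2 by (intro nn_integral_liminf) simp
    also have "\<dots> = liminf (\<lambda>j. ennreal (L2sq (\<lambda>x. \<phi> i x - \<phi> (r j) x)))"
      using L2 by (simp add: nn_integral_L2sq L2_diff)
    also have "\<dots> \<le> limsup (\<lambda>j. ennreal (L2sq (\<lambda>x. \<phi> i x - \<phi> (r j) x)))"
      by (rule Liminf_le_Limsup) simp
    also have "\<dots> \<le> ennreal ((1/4)^k)"
    proof (rule Limsup_bounded)
      show "\<forall>\<^sub>F j in sequentially. ennreal (L2sq (\<lambda>x. \<phi> i x - \<phi> (r j) x)) \<le> ennreal ((1/4)^k)"
        using eventually_ge_at_top[of "N k"]
      proof eventually_elim
        case (elim j)
        then show ?case
          using N[of k i "r j"] i r_ge[of j] by (intro ennreal_leI) simp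
      qed
    qed
    finally show ?thesis .
  qed
  have diff_L2: "(\<lambda>x. \<phi> i x - f x) \<in> L2" if "i \<ge> N k" for i k
  proof (rule L2_I)
    show "integrable lborel (\<lambda>x. (norm (\<phi> i x - f x))\<^sup>2)"
      using close[OF that] L2[of i] f_meas
      by (intro integrableI_bounded) (auto intro: le_less_trans)
  qed (use L2[of i] f_meas in measurable)
  have f_L2: "f \<in> L2"
    using L2_diff[OF L2[of "N 0"] diff_L2[OF order.refl, of 0]] by simp
  have "L2_tendsto \<phi> f"
  proof (rule LIMSEQ_I)
    fix e :: real assume "e > 0"
    then obtain k where k: "(1/4::real)^k < e"
      using real_arch_pow_inv[of e "1/4"] by auto
    have "norm (L2sq (\<lambda>x. \<phi> i x - f x) - 0) < e" if "i \<ge> N k" for i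
      using close[OF that] k nn_integral_L2sq[OF diff_L2[OF that]] by (simp add: ennreal_le_iff)
    then show "\<exists>no. \<forall>n\<ge>no. norm (L2sq (\<lambda>x. \<phi> n x - f x) - 0) < e" by blast
  qed
  with f_L2 show ?thesis by blast
qed

text \<open>The truncation used in \<open>fourier_L2\<close>; it turns square-integrable functions
  into integrable ones.\<close>

definition ball_trunc :: "nat \<Rightarrow> ('a::euclidean_space \<Rightarrow> complex) \<Rightarrow> 'a \<Rightarrow> complex" where
  "ball_trunc k f = (\<lambda>x. indicator (cball 0 (real k)) x * f x)"

lemma ball_trunc_L2: "f \<in> L2 \<Longrightarrow> ball_trunc k f \<in> L2"
  unfolding ball_trunc_def by (rule L2_mult_bounded[where B = 1]) (auto simp: indicator_def)

lemma emeasure_lborel_cball_lt_top: "emeasure lborel (cball a r :: 'a::euclidean_space set) < top"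
  using emeasure_bounded_finite[OF bounded_cball, of a r] by simp

lemma ball_trunc_integrable:
  assumes f: "f \<in> L2"
  shows "integrable lborel (ball_trunc k f)"
proof (rule Bochner_Integration.integrable_bound)
  show "integrable lborel (\<lambda>x. indicator (cball 0 (real k)) x + (norm (f x))\<^sup>2)"
    using f by (intro Bochner_Integration.integrable_add L2_integrable integrable_real_indicator)
       (auto simp: emeasure_lborel_cball_lt_top)
  show "ball_trunc k f \<in> borel_measurable lborel"
    using ball_trunc_L2[OF f] by simp
  show "AE x in lborel. norm (ball_trunc k f x) \<le> norm (indicator (cball 0 (real k)) x + (norm (f x))\<^sup>2)"
  proof (rule AE_I2)
    fix x
    have "norm (f x) \<le> 1 + (norm (f x))\<^sup>2"
      using norm_mult_le_sum_squares[of "1::complex" "f x"] by simp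
    then show "norm (ball_trunc k f x) \<le> norm (indicator (cball 0 (real k)) x + (norm (f x))\<^sup>2)"
      by (simp add: ball_trunc_def indicator_def)
  qed
qed

lemma ball_trunc_tendsto:
  assumes f: "f \<in> L2"
  shows "L2_tendsto (\<lambda>k. ball_trunc k f) f"
proof (rule L2_dominated_convergence[OF _ _ _ _ L2_integrable[OF f]])
  show "ball_trunc k f \<in> borel_measurable borel" for k
    using ball_trunc_L2[OF f] by simp
  show "AE x in lborel. (\<lambda>k. ball_trunc k f x) \<longlonglongrightarrow> f x"
  proof (rule AE_I2, rule tendsto_eventually)
    fix x :: 'a
    show "\<forall>\<^sub>F k in sequentially. ball_trunc k f x = f x"
      using eventually_ge_at_top[of "nat \<lceil>norm x\<rceil>"]
      by eventually_elim (auto simp: ball_trunc_def indicator_def)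
  qed
  show "AE x in lborel. (norm (ball_trunc k f x - f x))\<^sup>2 \<le> (norm (f x))\<^sup>2" for k
    by (auto simp: ball_trunc_def indicator_def)
qed (use f in simp)

text \<open>Three reductions: cut to a ball, clamp the values to a disc, replace by a continuous
  function. The continuous approximants converge only almost everywhere, so they are cut and clamped
  again to obtain a dominating function. The shares \<open>e / 8\<close>, \<open>e / 16\<close> and
  \<open>e / 16\<close> absorb the factors 2 of \<open>L2sq_diff_le\<close> and leave a total below
  \<open>3 * e / 4\<close>.\<close>

lemma L2_approx_continuous:
  fixes f :: "'a::euclidean_space \<Rightarrow> complex"
  assumes f: "f \<in> L2" and "e > 0"
  shows "\<exists>g. g \<in> L2 \<and> integrable lborel g \<and> continuous_on UNIV g \<and> bounded (range g)
    \<and> L2sq (\<lambda>x. g x - f x) < e"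
proof -
  \<comment> \<open>The radial retraction of the complex plane onto the disc of radius
    \<open>M\<close>, continuous for \<open>M > 0\<close>.\<close>
  define clamp where "clamp M z = complex_of_real (M / max M (norm z)) * z" for M z
  have clamp_norm: "norm (clamp M z) \<le> M" if "M > 0" for M z
    using that by (auto simp: clamp_def norm_mult norm_divide max_def field_simps)
  have clamp_eq: "clamp M z = z" if "norm z \<le> M" "M > 0" for M z
    using that by (simp add: clamp_def max_def)
  have clamp_le: "norm (clamp M z - z) \<le> norm z" if "M > 0" for M z
  proof -
    have "norm (clamp M z - z) = norm (complex_of_real (M / max M (norm z) - 1) * z)"
      by (simp add: clamp_def algebra_simps)
    also have "\<dots> = \<bar>M / max M (norm z) - 1\<bar> * norm z"
      unfolding norm_mult norm_of_real ..
    also have "\<dots> \<le> 1 * norm z"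
    proof (rule mult_right_mono)
      have "0 < max M (norm z)" "M \<le> max M (norm z)"
        using that by auto
      then have "0 \<le> M / max M (norm z)" "M / max M (norm z) \<le> 1"
        using that by (auto simp del: max_less_iff_conj simp: divide_le_eq_1)
      then show "\<bar>M / max M (norm z) - 1\<bar> \<le> 1" by linarith
    qed simp
    finally show ?thesis by simp
  qed
  have clamp_cont: "continuous_on UNIV (clamp M)" if "M > 0" for M
    unfolding clamp_def using that by (intro continuous_intros) (auto simp: max_def)
  have clamp_meas: "clamp M \<in> borel_measurable borel" if "M > 0" for M
    using clamp_cont[OF that] by (rule borel_measurable_continuous_onI)
  obtain M :: nat where M: "L2sq (\<lambda>x. ball_trunc M f x - f x) < e / 8"
    using order_tendstoD(2)[OF ball_trunc_tendsto[OF f], of "e / 8"] \<open>e > 0\<close>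
    by (auto simp: eventually_sequentially)
  define f1 where "f1 = ball_trunc M f"
  have f1: "f1 \<in> L2" unfolding f1_def by (rule ball_trunc_L2[OF f])
  have "(\<lambda>k. L2sq (\<lambda>x. clamp (real (Suc k)) (f1 x) - f1 x)) \<longlonglongrightarrow> 0"
  proof (rule L2_dominated_convergence[OF _ _ _ _ L2_integrable[OF f1]])
    show "(\<lambda>x. clamp (real (Suc k)) (f1 x)) \<in> borel_measurable borel" for k
      using clamp_meas[of "real (Suc k)"] f1 by simp
    show "AE x in lborel. (\<lambda>k. clamp (real (Suc k)) (f1 x)) \<longlonglongrightarrow> f1 x"
    proof (rule AE_I2, rule tendsto_eventually)
      fix x
      show "\<forall>\<^sub>F k in sequentially. clamp (real (Suc k)) (f1 x) = f1 x"
        using eventually_ge_at_top[of "nat \<lceil>norm (f1 x)\<rceil>"]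
        by eventually_elim (intro clamp_eq; linarith)
    qed
    show "AE x in lborel. (norm (clamp (real (Suc k)) (f1 x) - f1 x))\<^sup>2 \<le> (norm (f1 x))\<^sup>2" for k
      by (intro AE_I2 power_mono clamp_le) auto
  qed (use f1 in simp)
  from order_tendstoD(2)[OF this, of "e / 16"] \<open>e > 0\<close>
  obtain K where K: "L2sq (\<lambda>x. clamp (real (Suc K)) (f1 x) - f1 x) < e / 16"
    by (auto simp: eventually_sequentially)
  define R where "R = real (Suc K)"
  have R: "R > 0" by (simp add: R_def)
  define f2 where "f2 x = clamp R (f1 x)" for x
  have f2_meas: "f2 \<in> borel_measurable borel"
    unfolding f2_def using clamp_meas[OF R] f1 by simp
  have f2_bound: "norm (f2 x) \<le> R * indicator (cball 0 (real M + 1)) x" for x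
    using clamp_norm[OF R, of "f1 x"] by (auto simp: f2_def f1_def ball_trunc_def indicator_def clamp_def)
  have supp_int: "integrable lborel (\<lambda>x::'a. c * indicator (cball 0 (real M + 1)) x :: real)" for c
    by (intro integrable_mult_right integrable_real_indicator) (auto simp: emeasure_lborel_cball_lt_top)
  have sq_indicator: "(c * indicator (cball 0 (real M + 1)) x)\<^sup>2 = c\<^sup>2 * indicator (cball 0 (real M + 1)) x"
    for c :: real and x :: 'a
    by (simp add: indicator_def)
  have nice: "h \<in> L2 \<and> integrable lborel h"
    if "h \<in> borel_measurable borel" and b: "\<And>x. norm (h x) \<le> R * indicator (cball 0 (real M + 1)) x"
    for h :: "'a \<Rightarrow> complex"
  proof
    show "integrable lborel h"
      by (rule Bochner_Integration.integrable_bound[OF supp_int[of R]]) (use that R in auto)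
    have "(norm (h x))\<^sup>2 \<le> R\<^sup>2 * indicator (cball 0 (real M + 1)) x" for x
      using power_mono[OF b[of x], of 2] unfolding sq_indicator by simp
    then show "h \<in> L2"
      by (intro L2_I Bochner_Integration.integrable_bound[OF supp_int[of "R\<^sup>2"]]) (use that in auto)
  qed
  have "f2 measurable_on UNIV"
    using f2_meas by (intro lebesgue_measurable_imp_measurable_on) (simp_all add: measurable_completion)
  then obtain Nn g where neg: "negligible Nn" and gc: "\<And>n. continuous_on UNIV (g n)"
    and gl: "\<And>x. x \<notin> Nn \<Longrightarrow> (\<lambda>n. g n x) \<longlonglongrightarrow> f2 x"
    unfolding measurable_on_def by auto
  \<comment> \<open>A continuous cutoff, equal to 1 on the ball of radius \<open>M\<close>, outside
    of which \<open>f2\<close> vanishes, and to 0 beyond radius \<open>M + 1\<close>; so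
    \<open>cut * f2\<close> is \<open>f2\<close> again.\<close>
  define cut where "cut x = complex_of_real (max 0 (min 1 (real M + 1 - norm x)))" for x :: 'a
  define h where "h n x = cut x * clamp R (g n x)" for n x
  have cut_bound: "norm (cut x) \<le> indicator (cball 0 (real M + 1)) x" for x
    by (auto simp: cut_def indicator_def)
  have cut_f2: "cut x * f2 x = f2 x" for x
    using clamp_eq[OF _ R, of 0] R
    by (auto simp: cut_def f2_def f1_def ball_trunc_def indicator_def clamp_def)
  have h_cont: "continuous_on UNIV (h n)" for n
    unfolding h_def cut_def
    by (intro continuous_intros continuous_on_compose2[OF clamp_cont[OF R] gc]) auto
  have h_bound: "norm (h n x) \<le> R * indicator (cball 0 (real M + 1)) x" for n x
    using mult_mono[OF cut_bound[of x] clamp_norm[OF R, of "g n x"]] by (simp add: h_def norm_mult mult.commute)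
  have "(\<lambda>n. L2sq (\<lambda>x. h n x - f2 x)) \<longlonglongrightarrow> 0"
  proof (rule L2_dominated_convergence[OF _ f2_meas _ _ supp_int[of "(2 * R)\<^sup>2"]])
    show "h n \<in> borel_measurable borel" for n
      by (rule borel_measurable_continuous_onI[OF h_cont])
    have "AE x in lebesgue. x \<notin> Nn"
      using neg by (simp add: negligible_iff_null_sets AE_not_in)
    then have "AE x in lborel. x \<notin> Nn"
      by (simp add: AE_completion_iff)
    then show "AE x in lborel. (\<lambda>n. h n x) \<longlonglongrightarrow> f2 x"
    proof eventually_elim
      case (elim x)
      have "(\<lambda>n. clamp R (g n x)) \<longlonglongrightarrow> clamp R (f2 x)"
        using continuous_on_tendsto_compose[OF clamp_cont[OF R] gl[OF elim]] by simp
      then have "(\<lambda>n. h n x) \<longlonglongrightarrow> cut x * clamp R (f2 x)"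
        unfolding h_def by (intro tendsto_intros)
      moreover have "clamp R (f2 x) = f2 x"
        using clamp_norm[OF R, of "f1 x"] by (intro clamp_eq R) (simp add: f2_def)
      ultimately show ?case by (simp add: cut_f2)
    qed
    show "AE x in lborel. (norm (h n x - f2 x))\<^sup>2 \<le> (2 * R)\<^sup>2 * indicator (cball 0 (real M + 1)) x" for n
    proof (rule AE_I2)
      fix x
      have "norm (h n x - f2 x) \<le> 2 * R * indicator (cball 0 (real M + 1)) x"
        using norm_triangle_ineq4[of "h n x" "f2 x"] h_bound[of n x] f2_bound[of x] by simp
      from power_mono[OF this, of 2]
      show "(norm (h n x - f2 x))\<^sup>2 \<le> (2 * R)\<^sup>2 * indicator (cball 0 (real M + 1)) x"
        unfolding sq_indicator by simp
    qed
  qed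
  from order_tendstoD(2)[OF this, of "e / 16"] \<open>e > 0\<close>
  obtain n where n: "L2sq (\<lambda>x. h n x - f2 x) < e / 16"
    by (auto simp: eventually_sequentially)
  have hn: "h n \<in> L2" "integrable lborel (h n)"
    using nice[OF borel_measurable_continuous_onI[OF h_cont] h_bound] by auto
  have f2: "f2 \<in> L2"
    using nice[OF f2_meas f2_bound] by auto
  have "L2sq (\<lambda>x. h n x - f1 x) \<le> 2 * L2sq (\<lambda>x. h n x - f2 x) + 2 * L2sq (\<lambda>x. f2 x - f1 x)"
    by (intro L2sq_diff_le hn f2 f1)
  also have "\<dots> < e / 4"
    using n K unfolding f2_def R_def by simp
  finally have "L2sq (\<lambda>x. h n x - f1 x) < e / 4" .
  moreover have "L2sq (\<lambda>x. h n x - f x) \<le> 2 * L2sq (\<lambda>x. h n x - f1 x) + 2 * L2sq (\<lambda>x. f1 x - f x)"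
    by (intro L2sq_diff_le hn f f1)
  ultimately have "L2sq (\<lambda>x. h n x - f x) < e"
    using M \<open>e > 0\<close> unfolding f1_def by linarith
  moreover have "bounded (range (h n))"
  proof (rule boundedI)
    fix z assume "z \<in> range (h n)"
    then obtain x where "z = h n x" by auto
    then show "norm z \<le> R"
      using h_bound[of n x] R by (cases "norm x \<le> real M + 1") auto
  qed
  ultimately show ?thesis
    using hn h_cont by blast
qed

section \<open>Gaussian damping of oscillating integrals\<close>

lemma cis_measurable [measurable]: "f \<in> borel_measurable M \<Longrightarrow> (\<lambda>x. cis (f x)) \<in> borel_measurable M"
  by (rule borel_measurable_continuous_on) (auto intro!: continuous_intros)

text \<open>Lebesgue measure is the image of the product of one-dimensional copies, so that
  Gaussians, and later rational weights, reduce to integrals over the line.\<close>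

lemma
  fixes h :: "'a::euclidean_space \<Rightarrow> real \<Rightarrow> 'b::{real_normed_field,banach,second_countable_topology}"
  assumes h: "\<And>b. b \<in> Basis \<Longrightarrow> integrable lborel (h b)"
  shows integrable_lborel_prod: "integrable lborel (\<lambda>x::'a. \<Prod>b\<in>Basis. h b (x \<bullet> b))"
    and integral_lborel_prod: "(LINT x|lborel. (\<Prod>b\<in>Basis. h b ((x::'a) \<bullet> b))) = (\<Prod>b\<in>Basis. (LINT s|lborel. h b s))"
proof -
  interpret product_sigma_finite "\<lambda>_::'a. lborel :: real measure"
    by standard
  let ?T = "\<lambda>f. (\<Sum>b\<in>Basis. f b *\<^sub>R b) :: 'a"
  let ?P = "\<Pi>\<^sub>M b\<in>(Basis::'a set). (lborel :: real measure)"
  have T: "?T \<in> measurable ?P borel"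
    by (intro borel_measurable_sum borel_measurable_scaleR borel_measurable_const)
       (use measurable_component_singleton[of _ Basis "\<lambda>_. lborel :: real measure"] in simp)
  have meas: "(\<lambda>x::'a. \<Prod>b\<in>Basis. h b (x \<bullet> b)) \<in> borel_measurable borel"
  proof (rule borel_measurable_prod)
    fix b :: 'a assume "b \<in> Basis"
    then have hb: "h b \<in> borel_measurable borel"
      using borel_measurable_integrable[OF h] by simp
    have "(\<lambda>x::'a. x \<bullet> b) \<in> borel_measurable borel" by simp
    from measurable_compose[OF this hb] show "(\<lambda>x::'a. h b (x \<bullet> b)) \<in> borel_measurable borel" .
  qed
  have eq: "(\<Prod>b\<in>Basis. h b (?T f \<bullet> b)) = (\<Prod>b\<in>Basis. h b (f b))" for f
    by (intro prod.cong) auto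
  have "integrable ?P (\<lambda>f. \<Prod>b\<in>Basis. h b (f b))"
    using h by (intro product_integrable_prod) auto
  then have "integrable (distr ?P borel ?T) (\<lambda>x::'a. \<Prod>b\<in>Basis. h b (x \<bullet> b))"
    by (subst integrable_distr_eq[OF T meas]) (simp only: eq)
  then show "integrable lborel (\<lambda>x::'a. \<Prod>b\<in>Basis. h b (x \<bullet> b))"
    by (simp only: lborel_eq[symmetric])
  have "(LINT x|lborel. (\<Prod>b\<in>Basis. h b ((x::'a) \<bullet> b))) = (LINT f|?P. (\<Prod>b\<in>Basis. h b (?T f \<bullet> b)))"
    by (subst lborel_eq, subst integral_distr[OF T meas]) simp
  also have "\<dots> = (LINT f|?P. (\<Prod>b\<in>Basis. h b (f b)))"
    by (simp only: eq)
  also have "\<dots> = (\<Prod>b\<in>Basis. (LINT s|lborel. h b s))"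
    using h by (intro product_integral_prod) auto
  finally show "(LINT x|lborel. (\<Prod>b\<in>Basis. h b ((x::'a) \<bullet> b))) = (\<Prod>b\<in>Basis. (LINT s|lborel. h b s))" .
qed

definition gaussian :: "real \<Rightarrow> 'a::euclidean_space \<Rightarrow> real" where
  "gaussian e x = exp (- (e * (norm x)\<^sup>2 / 2))"

text \<open>The unnormalised Fourier transform of \<open>gaussian e\<close>: a Gaussian of variance
  \<open>e\<close> and total mass \<open>(2 * pi) ^ n\<close>. What matters about it is that it is
  nonnegative.\<close>

definition heat_kernel :: "real \<Rightarrow> 'a::euclidean_space \<Rightarrow> real" where
  "heat_kernel e x = (2 * pi / e) powr (real DIM('a) / 2) * exp (- ((norm x)\<^sup>2 / (2 * e)))"

lemma gaussian_nonneg [simp]: "0 \<le> gaussian e x"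
  by (simp add: gaussian_def)

lemma gaussian_le_1: "0 \<le> e \<Longrightarrow> gaussian e x \<le> 1"
  by (simp add: gaussian_def)

lemma heat_kernel_nonneg [simp]: "0 \<le> heat_kernel e x"
  by (simp add: heat_kernel_def)

lemma gaussian_measurable [measurable]: "gaussian e \<in> borel_measurable borel"
  unfolding gaussian_def by measurable

lemma heat_kernel_measurable [measurable]: "heat_kernel e \<in> borel_measurable borel"
  unfolding heat_kernel_def by measurable

lemma gaussian_prod: "gaussian e (x::'a::euclidean_space) = (\<Prod>b\<in>Basis. exp (- (e * (x \<bullet> b)\<^sup>2 / 2)))"
proof -
  have "(norm x)\<^sup>2 = (\<Sum>b\<in>Basis. (x \<bullet> b)\<^sup>2)"
    by (simp add: norm_eq_sqrt_inner euclidean_inner[of x x] power2_eq_square sum_nonneg)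
  then show ?thesis
    by (simp add: gaussian_def exp_sum[symmetric] sum_distrib_left sum_divide_distrib sum_negf)
qed

text \<open>A rescaling of the characteristic function of the standard normal distribution:
  substituting \<open>sqrt e * s\<close> for the variable turns the frequency
  \<open>y = z / sqrt e\<close> into \<open>z\<close>.\<close>

lemma gaussian_integral_real:
  fixes e z :: real
  assumes "e > 0"
  shows "integrable lborel (\<lambda>s. exp (- (e * s\<^sup>2 / 2)))"
    and "(LINT s|lborel. complex_of_real (exp (- (e * s\<^sup>2 / 2))) * cis (s * z))
      = complex_of_real ((2 * pi / e) powr (1 / 2) * exp (- (z\<^sup>2 / (2 * e))))"
proof -
  have c: "sqrt e \<noteq> 0" using assms by simp
  have "integrable lborel std_normal_density"
    by (rule integrable_normal_density) simp
  then have "integrable lborel (\<lambda>s. sqrt (2 * pi) * std_normal_density s)"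
    by (rule integrable_mult_right)
  then have "integrable lborel (\<lambda>s. exp (- (s\<^sup>2 / 2)) :: real)"
    by (simp add: std_normal_density_def)
  from lborel_integrable_real_affine[OF this c, of 0]
  show "integrable lborel (\<lambda>s. exp (- (e * s\<^sup>2 / 2)))"
    using assms by (simp add: power_mult_distrib)
  define y where "y = z / sqrt e"
  let ?L = "LINT s|lborel. complex_of_real (exp (- (s\<^sup>2 / 2))) * cis (y * s)"
    and ?R = "LINT s|lborel. complex_of_real (exp (- (e * s\<^sup>2 / 2))) * cis (s * z)"
    and ?N = "LINT s|lborel. complex_of_real (std_normal_density s) * cis (y * s)"
  have "char std_normal_distribution y = ?N"
    unfolding char_def by (subst integral_density) (auto simp: scaleR_conv_of_real cis_conv_exp)
  then have 1: "?N
      = complex_of_real (exp (- (y\<^sup>2 / 2)))"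
    by (simp add: char_std_normal_distribution)
  have 2: "complex_of_real (exp (- (s\<^sup>2 / 2))) * cis (y * s)
      = complex_of_real (sqrt (2 * pi)) * (complex_of_real (std_normal_density s) * cis (y * s))" for s
    by (simp add: std_normal_density_def)
  have 3: "?L
      = complex_of_real (sqrt (2 * pi)) * complex_of_real (exp (- (y\<^sup>2 / 2)))"
    unfolding 2 integral_mult_right_zero 1 ..
  have "?L
      = \<bar>sqrt e\<bar> *\<^sub>R (LINT s|lborel. complex_of_real (exp (- ((0 + sqrt e * s)\<^sup>2 / 2))) * cis (y * (0 + sqrt e * s)))"
    by (rule lborel_integral_real_affine[OF c])
  also have "\<dots> = complex_of_real (sqrt e) * ?R"
    using assms by (simp add: y_def power_mult_distrib scaleR_conv_of_real mult.commute)
  finally have "?R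
      = complex_of_real (sqrt (2 * pi) / sqrt e * exp (- (y\<^sup>2 / 2)))"
    unfolding 3 using assms by (simp add: field_simps)
  moreover have "sqrt (2 * pi) / sqrt e = (2 * pi / e) powr (1 / 2)"
    using assms by (simp add: powr_half_sqrt real_sqrt_divide)
  moreover have "y\<^sup>2 / 2 = z\<^sup>2 / (2 * e)"
    using assms by (simp add: y_def power_divide)
  ultimately show "?R
      = complex_of_real ((2 * pi / e) powr (1 / 2) * exp (- (z\<^sup>2 / (2 * e))))"
    by simp
qed

lemma integrable_gaussian:
  assumes "e > 0"
  shows "integrable lborel (gaussian e :: 'a::euclidean_space \<Rightarrow> real)"
  unfolding gaussian_prod[abs_def]
  by (rule integrable_lborel_prod) (rule gaussian_integral_real(1)[OF assms])

lemma cis_sum: "finite A \<Longrightarrow> cis (sum f A) = (\<Prod>a\<in>A. cis (f a))"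
  by (induction A rule: finite_induct) (simp_all flip: cis_mult)

lemma gaussian_fourier:
  fixes z :: "'a::euclidean_space"
  assumes "e > 0"
  shows "(LINT s|lborel. complex_of_real (gaussian e s) * cis (s \<bullet> z)) = complex_of_real (heat_kernel e z)"
proof -
  have "complex_of_real (gaussian e s) * cis (s \<bullet> z)
      = (\<Prod>b\<in>Basis. complex_of_real (exp (- (e * (s \<bullet> b)\<^sup>2 / 2))) * cis ((s \<bullet> b) * (z \<bullet> b)))" for s
    by (subst euclidean_inner) (simp add: gaussian_prod cis_sum prod.distrib)
  then have "(LINT s|lborel. complex_of_real (gaussian e s) * cis (s \<bullet> z))
      = (LINT s|lborel. (\<Prod>b\<in>Basis. complex_of_real (exp (- (e * (s \<bullet> b)\<^sup>2 / 2))) * cis ((s \<bullet> b) * (z \<bullet> b))))"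
    by simp
  also have "\<dots> = (\<Prod>b\<in>Basis. (LINT s|lborel. complex_of_real (exp (- (e * s\<^sup>2 / 2))) * cis (s * (z \<bullet> b))))"
  proof (rule integral_lborel_prod)
    fix b :: 'a
    show "integrable lborel (\<lambda>s. complex_of_real (exp (- (e * s\<^sup>2 / 2))) * cis (s * (z \<bullet> b)))"
      by (rule Bochner_Integration.integrable_bound[OF gaussian_integral_real(1)[OF assms]])
         (auto simp: norm_mult)
  qed
  also have "\<dots> = (\<Prod>b\<in>(Basis::'a set). complex_of_real ((2 * pi / e) powr (1 / 2) * exp (- ((z \<bullet> b)\<^sup>2 / (2 * e)))))"
    by (simp only: gaussian_integral_real(2)[OF assms])
  also have "\<dots> = complex_of_real (((2 * pi / e) powr (1 / 2)) ^ DIM('a) * gaussian (1 / e) z)"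
    unfolding gaussian_prod by (simp add: prod.distrib mult.commute)
  also have "((2 * pi / e) powr (1 / 2)) ^ DIM('a) = (2 * pi / e) powr (real DIM('a) / 2)"
    using assms by (subst powr_realpow[symmetric]) (simp_all add: powr_powr)
  finally show ?thesis
    by (simp add: heat_kernel_def gaussian_def)
qed

lemma heat_kernel_eq_gaussian:
  "heat_kernel e (x::'a::euclidean_space) = (2 * pi / e) powr (real DIM('a) / 2) * gaussian (1 / e) x"
  by (simp add: heat_kernel_def gaussian_def)

lemma
  assumes "e > 0"
  shows integrable_heat_kernel: "integrable lborel (heat_kernel e :: 'a::euclidean_space \<Rightarrow> real)"
    and integral_heat_kernel: "(LINT x|lborel. heat_kernel e (x::'a)) = (2 * pi) ^ DIM('a)"
proof -
  have e: "1 / e > 0" using assms by simp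
  show "integrable lborel (heat_kernel e :: 'a \<Rightarrow> real)"
    unfolding heat_kernel_eq_gaussian[abs_def]
    by (intro integrable_mult_right integrable_gaussian e)
  have "complex_of_real (LINT x|lborel. gaussian (1 / e) (x::'a)) = complex_of_real (heat_kernel (1 / e) (0::'a))"
    using gaussian_fourier[OF e, of "0::'a"] by (simp flip: integral_complex_of_real)
  then have "(LINT x|lborel. gaussian (1 / e) (x::'a)) = (2 * pi * e) powr (real DIM('a) / 2)"
    by (simp add: heat_kernel_def)
  then have "(LINT x|lborel. heat_kernel e (x::'a))
      = (2 * pi / e) powr (real DIM('a) / 2) * (2 * pi * e) powr (real DIM('a) / 2)"
    by (simp add: heat_kernel_eq_gaussian)
  also have "\<dots> = ((2 * pi)\<^sup>2) powr (real DIM('a) / 2)"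
    using assms by (subst powr_mult[symmetric]) (simp_all add: power2_eq_square)
  also have "\<dots> = (2 * pi) powr (real DIM('a))"
    using powr_powr[of "2 * pi" 2 "real DIM('a) / 2"] by simp
  also have "\<dots> = (2 * pi) ^ DIM('a)"
    by (simp add: powr_realpow)
  finally show "(LINT x|lborel. heat_kernel e (x::'a)) = (2 * pi) ^ DIM('a)" .
qed

lemma integrable_pair_mult:
  fixes f :: "'a \<Rightarrow> 'c::{real_normed_field,banach,second_countable_topology}" and g :: "'b \<Rightarrow> 'c"
  assumes "sigma_finite_measure M" "sigma_finite_measure N" "integrable M f" "integrable N g"
  shows "integrable (M \<Otimes>\<^sub>M N) (\<lambda>(x, y). f x * g y)"
proof -
  interpret M: sigma_finite_measure M by fact
  interpret N: sigma_finite_measure N by fact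
  interpret pair_sigma_finite M N ..
  have [measurable]: "f \<in> borel_measurable M" "g \<in> borel_measurable N"
    using assms by auto
  show ?thesis
  proof (rule Fubini_integrable)
    show "(\<lambda>(x, y). f x * g y) \<in> borel_measurable (M \<Otimes>\<^sub>M N)" by measurable
    show "integrable M (\<lambda>x. LINT y|N. norm (case (x, y) of (x, y) \<Rightarrow> f x * g y))"
      using assms by (simp add: norm_mult)
    show "AE x in M. integrable N (\<lambda>y. case (x, y) of (x, y) \<Rightarrow> f x * g y)"
      using assms by simp
  qed
qed

lemma integral_pair_mult:
  fixes f :: "'a \<Rightarrow> 'c::{real_normed_field,banach,second_countable_topology}" and g :: "'b \<Rightarrow> 'c"
  assumes "sigma_finite_measure M" "sigma_finite_measure N" "integrable M f" "integrable N g"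
  shows "(LINT p|(M \<Otimes>\<^sub>M N). f (fst p) * g (snd p)) = (LINT x|M. f x) * (LINT y|N. g y)"
proof -
  interpret M: sigma_finite_measure M by fact
  interpret N: sigma_finite_measure N by fact
  interpret pair_sigma_finite M N ..
  from integral_fst[of "\<lambda>x y. f x * g y", OF integrable_pair_mult[OF assms]]
  show ?thesis by (simp add: case_prod_beta')
qed

text \<open>Damping by a Gaussian makes Fubini applicable to the square of an oscillating integral; the
  positivity of the resulting kernel is what the two applications (Plancherel, and the
  square-integrability in time of matrix elements) rest on.\<close>

lemma damped_oscillating_integral:
  fixes w :: "'m \<Rightarrow> 'a::euclidean_space" and u v :: "'m \<Rightarrow> complex"
  assumes M: "sigma_finite_measure M" and u: "integrable M u" and v: "integrable M v"
    and w[measurable]: "w \<in> borel_measurable M" and e: "e > 0"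
  shows "(LINT s|lborel. complex_of_real (gaussian e s)
        * ((LINT x|M. u x * cis (s \<bullet> w x)) * cnj (LINT x|M. v x * cis (s \<bullet> w x))))
      = (LINT p|(M \<Otimes>\<^sub>M M). u (fst p) * cnj (v (snd p)) * heat_kernel e (w (fst p) - w (snd p)))"
proof -
  interpret M: sigma_finite_measure M by fact
  interpret MM: pair_sigma_finite M M ..
  interpret P: pair_sigma_finite "lborel :: 'a measure" "M \<Otimes>\<^sub>M M" ..
  have [measurable]: "u \<in> borel_measurable M" "v \<in> borel_measurable M"
    using u v by auto
  define I where "I s p = complex_of_real (gaussian e s)
    * (u (fst p) * cis (s \<bullet> w (fst p)) * cnj (v (snd p) * cis (s \<bullet> w (snd p))))" for s p
  have int_u: "integrable M (\<lambda>x. u x * cis (s \<bullet> w x))" for s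
    by (rule Bochner_Integration.integrable_bound[OF u]) (auto simp: norm_mult)
  have int_v: "integrable M (\<lambda>x. cnj (v x * cis (s \<bullet> w x)))" for s
    by (rule Bochner_Integration.integrable_bound[OF v]) (auto simp: norm_mult)
  have int_uv: "integrable (M \<Otimes>\<^sub>M M) (\<lambda>(x, y). u x * v y)"
    by (rule integrable_pair_mult[OF M M u v])
  have int_g: "integrable (lborel \<Otimes>\<^sub>M (M \<Otimes>\<^sub>M M))
      (\<lambda>(s, p). complex_of_real (gaussian e s) * (case p of (x, y) \<Rightarrow> u x * v y))"
    by (rule integrable_pair_mult[OF _ _ _ int_uv])
       (auto intro: lborel.sigma_finite_measure_axioms MM.sigma_finite_measure_axioms integrable_gaussian e)
  have int_I: "integrable (lborel \<Otimes>\<^sub>M (M \<Otimes>\<^sub>M M)) (case_prod I)"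
  proof (rule Bochner_Integration.integrable_bound[OF int_g])
    show "case_prod I \<in> borel_measurable (lborel \<Otimes>\<^sub>M (M \<Otimes>\<^sub>M M))"
      unfolding I_def by measurable
  qed (auto simp: I_def norm_mult)
  have "(LINT p|(M \<Otimes>\<^sub>M M). I s p) = complex_of_real (gaussian e s)
      * ((LINT x|M. u x * cis (s \<bullet> w x)) * cnj (LINT x|M. v x * cis (s \<bullet> w x)))" for s
    unfolding I_def integral_mult_right_zero
    by (simp only: integral_pair_mult[OF M M int_u int_v] Bochner_Integration.integral_cnj)
  then have "(LINT s|lborel. complex_of_real (gaussian e s)
        * ((LINT x|M. u x * cis (s \<bullet> w x)) * cnj (LINT x|M. v x * cis (s \<bullet> w x))))
      = (LINT s|lborel. LINT p|(M \<Otimes>\<^sub>M M). I s p)"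
    by simp
  also have "\<dots> = (LINT p|(M \<Otimes>\<^sub>M M). LINT s|lborel. I s p)"
    by (rule P.Fubini_integral[symmetric, OF int_I])
  also have "\<dots> = (LINT p|(M \<Otimes>\<^sub>M M). u (fst p) * cnj (v (snd p)) * heat_kernel e (w (fst p) - w (snd p)))"
  proof (rule Bochner_Integration.integral_cong[OF refl])
    fix p
    have "I s p = (u (fst p) * cnj (v (snd p)))
        * (complex_of_real (gaussian e s) * cis (s \<bullet> (w (fst p) - w (snd p))))" for s
    proof -
      have "cis (s \<bullet> (w (fst p) - w (snd p))) = cis (s \<bullet> w (fst p)) * cis (- (s \<bullet> w (snd p)))"
        by (simp add: cis_mult inner_diff_right)
      then show ?thesis
        by (simp add: I_def cis_cnj)
    qed
    then show "(LINT s|lborel. I s p) = u (fst p) * cnj (v (snd p)) * heat_kernel e (w (fst p) - w (snd p))"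
      by (simp add: gaussian_fourier[OF e])
  qed
  finally show ?thesis .
qed

section \<open>Affine changes of variables and approximate identities\<close>

lemma
  fixes f :: "'a::euclidean_space \<Rightarrow> 'b::{banach, second_countable_topology}"
  assumes c: "c \<noteq> 0" and f: "f \<in> borel_measurable borel"
  shows lborel_integrable_affine_iff: "integrable lborel (\<lambda>x. f (t + c *\<^sub>R x)) \<longleftrightarrow> integrable lborel f"
    and lborel_integral_affine: "(LINT x|lborel. f x) = \<bar>c\<bar> ^ DIM('a) *\<^sub>R (LINT x|lborel. f (t + c *\<^sub>R x))"
proof -
  let ?D = "distr lborel borel (\<lambda>x::'a. t + c *\<^sub>R x)"
  have eq: "lborel = density ?D (\<lambda>_. ennreal (\<bar>c\<bar> ^ DIM('a)))"
    by (rule lborel_affine[OF c])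
  have T: "(\<lambda>x::'a. t + c *\<^sub>R x) \<in> measurable lborel borel" by simp
  have pos: "\<bar>c\<bar> ^ DIM('a) > 0" using c by simp
  have "integrable lborel f \<longleftrightarrow> integrable (density ?D (\<lambda>_. ennreal (\<bar>c\<bar> ^ DIM('a)))) f"
    by (simp only: eq[symmetric])
  also have "\<dots> \<longleftrightarrow> integrable ?D (\<lambda>x. \<bar>c\<bar> ^ DIM('a) *\<^sub>R f x)"
    by (rule integrable_density) (use f in auto)
  also have "\<dots> \<longleftrightarrow> integrable ?D f"
    using pos integrable_scaleR_right[of "1 / \<bar>c\<bar> ^ DIM('a)" ?D "\<lambda>x. \<bar>c\<bar> ^ DIM('a) *\<^sub>R f x"]
      integrable_scaleR_right[of "\<bar>c\<bar> ^ DIM('a)" ?D f] by auto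
  also have "\<dots> \<longleftrightarrow> integrable lborel (\<lambda>x. f (t + c *\<^sub>R x))"
    by (rule integrable_distr_eq[OF T f])
  finally show "integrable lborel (\<lambda>x. f (t + c *\<^sub>R x)) \<longleftrightarrow> integrable lborel f" ..
  have "(LINT x|lborel. f x) = (LINT x|density ?D (\<lambda>_. ennreal (\<bar>c\<bar> ^ DIM('a))). f x)"
    by (simp only: eq[symmetric])
  also have "\<dots> = (LINT x|?D. \<bar>c\<bar> ^ DIM('a) *\<^sub>R f x)"
    by (rule integral_density) (use f in auto)
  also have "\<dots> = \<bar>c\<bar> ^ DIM('a) *\<^sub>R (LINT x|?D. f x)"
    by simp
  also have "(LINT x|?D. f x) = (LINT x|lborel. f (t + c *\<^sub>R x))"
    by (rule integral_distr[OF T f])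
  finally show "(LINT x|lborel. f x) = \<bar>c\<bar> ^ DIM('a) *\<^sub>R (LINT x|lborel. f (t + c *\<^sub>R x))" .
qed

text \<open>\<open>heat_kernel e\<close> normalised to mass 1, that is the centred Gaussian density
  with variance \<open>e\<close> in each coordinate.\<close>

definition mollifier :: "real \<Rightarrow> 'a::euclidean_space \<Rightarrow> real" where
  "mollifier e x = heat_kernel e x / (2 * pi) ^ DIM('a)"

lemma mollifier_nonneg [simp]: "0 \<le> mollifier e x"
  by (simp add: mollifier_def)

lemma mollifier_measurable [measurable]: "mollifier e \<in> borel_measurable borel"
  unfolding mollifier_def by measurable

lemma mollifier_minus [simp]: "mollifier e (- x) = mollifier e x"
  by (simp add: mollifier_def heat_kernel_def)

lemma
  assumes "e > 0"
  shows integrable_mollifier: "integrable lborel (mollifier e :: 'a::euclidean_space \<Rightarrow> real)"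
    and integral_mollifier: "(LINT x|lborel. mollifier e (x::'a)) = 1"
  unfolding mollifier_def using assms by (simp_all add: integrable_heat_kernel integral_heat_kernel)

text \<open>Variance \<open>e^2\<close> means width \<open>e\<close>, so this is the usual scaling
  of an approximate identity. It is the reason for damping with \<open>(e k)^2\<close> in
  \<open>fourier_integral_inner_continuous\<close>.\<close>

lemma mollifier_scale:
  assumes "e > 0"
  shows "mollifier (e\<^sup>2) (e *\<^sub>R x :: 'a::euclidean_space) = mollifier 1 x / e ^ DIM('a)"
proof -
  have a: "(2 * pi / e\<^sup>2) powr (real DIM('a) / 2) = (2 * pi) powr (real DIM('a) / 2) / e ^ DIM('a)"
  proof -
    have "(e\<^sup>2) powr (real DIM('a) / 2) = e powr (real DIM('a))"
      using powr_powr[of e 2 "real DIM('a) / 2"] assms by simp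
    also have "\<dots> = e ^ DIM('a)"
      using assms by (simp add: powr_realpow)
    finally show ?thesis
      using assms by (simp add: powr_divide)
  qed
  have b: "(norm (e *\<^sub>R x))\<^sup>2 / (2 * e\<^sup>2) = (norm x)\<^sup>2 / 2"
    using assms by (simp add: power_mult_distrib)
  show ?thesis
    unfolding mollifier_def heat_kernel_def a b by simp
qed

lemma
  fixes h :: "'a::euclidean_space \<Rightarrow> real"
  assumes h: "integrable lborel h" and e: "e > 0"
  shows integrable_mult_mollifier: "integrable (lborel \<Otimes>\<^sub>M lborel) (\<lambda>(x, y). h x * mollifier e (x - y))"
    and integral_mult_mollifier:
      "(LINT p|(lborel \<Otimes>\<^sub>M lborel). h (fst p) * mollifier e (fst p - snd p)) = (LINT x|lborel. h x)"
proof -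
  have [measurable]: "h \<in> borel_measurable borel"
    using borel_measurable_integrable[OF h] by simp
  have shift: "integrable lborel (\<lambda>y. mollifier e (x - y))"
    "(LINT y|lborel. mollifier e (x - y)) = 1" for x :: 'a
    using lborel_integrable_affine_iff[of "-1" "mollifier e :: 'a \<Rightarrow> real" x]
      lborel_integral_affine[of "-1" "mollifier e :: 'a \<Rightarrow> real" x]
      integrable_mollifier[OF e, where 'a = 'a] integral_mollifier[OF e, where 'a = 'a]
    by simp_all
  show int: "integrable (lborel \<Otimes>\<^sub>M lborel) (\<lambda>(x, y). h x * mollifier e (x - y))"
  proof (rule lborel_pair.Fubini_integrable)
    show "(\<lambda>(x, y). h x * mollifier e (x - y)) \<in> borel_measurable (lborel \<Otimes>\<^sub>M lborel)"
      by measurable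
    show "integrable lborel (\<lambda>x. LINT y|lborel. norm (case (x, y) of (x, y) \<Rightarrow> h x * mollifier e (x - y)))"
      using h by (simp add: abs_mult shift)
    show "AE x in lborel. integrable lborel (\<lambda>y. case (x, y) of (x, y) \<Rightarrow> h x * mollifier e (x - y))"
      by (simp add: shift)
  qed
  show "(LINT p|(lborel \<Otimes>\<^sub>M lborel). h (fst p) * mollifier e (fst p - snd p)) = (LINT x|lborel. h x)"
    using lborel_pair.integral_fst[OF int] by (simp add: case_prod_beta' shift)
qed

section \<open>The Plancherel theorem\<close>

definition fourier_const :: "'n::finite itself \<Rightarrow> real" where
  "fourier_const _ = (2 * pi) powr (- real CARD('n) / 2)"

lemma fourier_const_sq: "fourier_const TYPE('n::finite) ^ 2 = 1 / (2 * pi) ^ CARD('n)"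
proof -
  have "fourier_const TYPE('n) ^ 2 = (2 * pi) powr (- real CARD('n))"
    by (simp add: fourier_const_def power2_eq_square powr_add[symmetric])
  also have "\<dots> = 1 / (2 * pi) ^ CARD('n)"
    by (simp add: powr_minus powr_realpow inverse_eq_divide)
  finally show ?thesis .
qed

lemma fourier_const_pos: "fourier_const TYPE('n::finite) > 0"
  by (simp add: fourier_const_def)

lemma fourier_integral_eq:
  fixes f :: "real^'n::finite \<Rightarrow> complex"
  shows "fourier_integral f \<xi> = fourier_const TYPE('n) * (LINT x|lborel. f x * cis (\<xi> \<bullet> (- x)))"
  unfolding fourier_integral_def fourier_const_def by (simp add: mult.commute)

lemma integrable_mult_cis:
  fixes f :: "'a::euclidean_space \<Rightarrow> complex"
  assumes f: "integrable lborel f" and "w \<in> borel_measurable borel"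
  shows "integrable lborel (\<lambda>x. f x * cis (w x))"
  by (rule Bochner_Integration.integrable_bound[OF f])
     (use assms borel_measurable_integrable[OF f] in \<open>auto simp: norm_mult\<close>)

lemma fourier_integral_linear:
  assumes "integrable lborel f" "integrable lborel g"
  shows "fourier_integral (\<lambda>x. a * f x + b * g x) \<xi> = a * fourier_integral f \<xi> + b * fourier_integral g \<xi>"
  unfolding fourier_integral_eq using assms
  by (simp add: distrib_right mult.assoc integrable_mult_cis[unfolded inner_minus_right] algebra_simps)

lemma fourier_integral_diff:
  assumes "integrable lborel f" "integrable lborel g"
  shows "fourier_integral (\<lambda>x. f x - g x) \<xi> = fourier_integral f \<xi> - fourier_integral g \<xi>"
  using fourier_integral_linear[OF assms, of 1 "-1" \<xi>] by simp

lemma fourier_integral_measurable: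
  assumes "integrable lborel (f :: real^'n::finite \<Rightarrow> complex)"
  shows "fourier_integral f \<in> borel_measurable borel"
proof -
  have [measurable]: "f \<in> borel_measurable borel"
    using borel_measurable_integrable[OF assms] by simp
  show ?thesis
    unfolding fourier_integral_eq[abs_def] by measurable
qed

lemma norm_fourier_integral_le:
  fixes f :: "real^'n::finite \<Rightarrow> complex"
  shows "norm (fourier_integral f \<xi>) \<le> fourier_const TYPE('n) * (LINT x|lborel. norm (f x))"
proof -
  have "norm (LINT x|lborel. f x * cis (\<xi> \<bullet> (- x))) \<le> (LINT x|lborel. norm (f x * cis (\<xi> \<bullet> (- x))))"
    by (rule integral_norm_bound)
  then have "norm (LINT x|lborel. f x * cis (\<xi> \<bullet> (- x))) \<le> (LINT x|lborel. norm (f x))"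
    by (simp add: norm_mult)
  then show ?thesis
    unfolding fourier_integral_eq norm_mult using fourier_const_pos[where 'n='n] by simp
qed

text \<open>A damped Parseval identity. The square of the constant in the transform is exactly the
  inverse of the mass of the heat kernel, which makes the kernel an approximate identity.\<close>

lemma fourier_damped:
  fixes f g :: "real^'n::finite \<Rightarrow> complex"
  assumes f: "integrable lborel f" and g: "integrable lborel g" and e: "e > 0"
  shows "(LINT s|lborel. complex_of_real (gaussian e s) * (fourier_integral f s * cnj (fourier_integral g s)))
    = (LINT p|(lborel \<Otimes>\<^sub>M lborel). f (fst p) * cnj (g (snd p)) * mollifier e (fst p - snd p))"
proof -
  let ?c = "fourier_const TYPE('n)"
  have "(LINT s|lborel. complex_of_real (gaussian e s) * (fourier_integral f s * cnj (fourier_integral g s)))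
      = (LINT s|lborel. complex_of_real (?c^2) * (complex_of_real (gaussian e s) *
          ((LINT x|lborel. f x * cis (s \<bullet> (- x))) * cnj (LINT x|lborel. g x * cis (s \<bullet> (- x))))))"
    unfolding fourier_integral_eq by (simp add: power2_eq_square algebra_simps)
  also have "\<dots> = complex_of_real (?c^2) * (LINT p|(lborel \<Otimes>\<^sub>M lborel).
      f (fst p) * cnj (g (snd p)) * heat_kernel e (- fst p - (- snd p)))"
    by (subst integral_mult_right_zero, subst damped_oscillating_integral)
       (use f g e in \<open>auto intro: lborel.sigma_finite_measure_axioms\<close>)
  also have "\<dots> = (LINT p|(lborel \<Otimes>\<^sub>M lborel). f (fst p) * cnj (g (snd p)) * mollifier e (fst p - snd p))"
  proof -
    have "complex_of_real (?c^2) * (f (fst p) * cnj (g (snd p)) * heat_kernel e (- fst p - (- snd p)))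
        = f (fst p) * cnj (g (snd p)) * mollifier e (fst p - snd p)" for p
    proof -
      have "mollifier e (fst p - snd p) = ?c^2 * heat_kernel e (- fst p - (- snd p))"
        by (simp add: mollifier_def heat_kernel_def fourier_const_sq norm_minus_commute)
      then show ?thesis by simp
    qed
    then show ?thesis
      by (simp only: integral_mult_right_zero[symmetric])
  qed
  finally show ?thesis .
qed

text \<open>Removes the damping by Fatou's lemma along \<open>e = 1 / (k + 1)\<close>, both for the
  Fourier transform and for the time integrals of matrix elements.\<close>

lemma nn_integral_le_of_damped:
  fixes h :: "'a::euclidean_space \<Rightarrow> complex"
  assumes h[measurable]: "h \<in> borel_measurable borel"
    and le: "\<And>e. e > 0 \<Longrightarrow> (\<integral>\<^sup>+ s. ennreal (gaussian e s * (norm (h s))\<^sup>2) \<partial>lborel) \<le> B"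
  shows "(\<integral>\<^sup>+ s. ennreal ((norm (h s))\<^sup>2) \<partial>lborel) \<le> B"
proof -
  have "(\<integral>\<^sup>+ s. ennreal ((norm (h s))\<^sup>2) \<partial>lborel)
      = (\<integral>\<^sup>+ s. liminf (\<lambda>k. ennreal (gaussian (1 / real (Suc k)) s * (norm (h s))\<^sup>2)) \<partial>lborel)"
  proof (rule nn_integral_cong)
    fix s :: 'a
    have "(\<lambda>k. gaussian (1 / real (Suc k)) s) \<longlonglongrightarrow> exp (- (0 * (norm s)\<^sup>2 / 2))"
      unfolding gaussian_def by (intro tendsto_intros LIMSEQ_Suc[OF lim_1_over_n]) auto
    then have "(\<lambda>k. ennreal (gaussian (1 / real (Suc k)) s * (norm (h s))\<^sup>2)) \<longlonglongrightarrow> ennreal (1 * (norm (h s))\<^sup>2)"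
      by (intro tendsto_ennrealI tendsto_mult tendsto_const) simp
    from lim_imp_Liminf[OF trivial_limit_sequentially this]
    show "ennreal ((norm (h s))\<^sup>2) = liminf (\<lambda>k. ennreal (gaussian (1 / real (Suc k)) s * (norm (h s))\<^sup>2))"
      by simp
  qed
  also have "\<dots> \<le> liminf (\<lambda>k. \<integral>\<^sup>+ s. ennreal (gaussian (1 / real (Suc k)) s * (norm (h s))\<^sup>2) \<partial>lborel)"
    by (rule nn_integral_liminf) simp
  also have "\<dots> \<le> limsup (\<lambda>k. \<integral>\<^sup>+ s. ennreal (gaussian (1 / real (Suc k)) s * (norm (h s))\<^sup>2) \<partial>lborel)"
    by (rule Liminf_le_Limsup) simp
  also have "\<dots> \<le> B"
    by (rule Limsup_bounded, rule always_eventually, rule allI, rule le) simp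
  finally show ?thesis .
qed

lemma integrable_gaussian_mult_bounded:
  fixes h :: "'a::euclidean_space \<Rightarrow> complex"
  assumes [measurable]: "h \<in> borel_measurable borel" and B: "\<And>s. norm (h s) \<le> B" and "e > 0"
  shows "integrable lborel (\<lambda>s. gaussian e s * (norm (h s))\<^sup>2)"
proof (rule Bochner_Integration.integrable_bound)
  show "integrable lborel (\<lambda>s::'a. B\<^sup>2 * gaussian e s)"
    by (intro integrable_mult_right integrable_gaussian assms)
  show "AE s in lborel. norm (gaussian e s * (norm (h s))\<^sup>2) \<le> norm (B\<^sup>2 * gaussian e s)"
    by (intro AE_I2) (auto simp: abs_mult mult.commute intro!: mult_left_mono mult_right_mono power_mono B)
qed simp

text \<open>The inequality comes before the equality because the limits that prove the latter
  require the transform to be in \<open>L2\<close> and to depend continuously on \<open>f\<close>.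
  The product \<open>norm (f x) * norm (f y)\<close> is split evenly into squares, each half being
  integrated against a kernel of mass 1, so no constant is lost.\<close>

lemma fourier_integral_L2:
  fixes f :: "real^'n::finite \<Rightarrow> complex"
  assumes int: "integrable lborel f" and L2: "f \<in> L2"
  shows "fourier_integral f \<in> L2" and "L2sq (fourier_integral f) \<le> L2sq f"
proof -
  let ?F = "fourier_integral f"
  have [measurable]: "?F \<in> borel_measurable borel" "f \<in> borel_measurable borel"
    using fourier_integral_measurable[OF int] L2 by auto
  define B where "B = fourier_const TYPE('n) * (LINT x|lborel. norm (f x))"
  have B: "norm (?F s) \<le> B" for s
    unfolding B_def by (rule norm_fourier_integral_le)
  have int_damped: "integrable lborel (\<lambda>s. gaussian e s * (norm (?F s))\<^sup>2)" if "e > 0" for e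
    by (rule integrable_gaussian_mult_bounded[OF _ B that]) simp
  have damped: "(LINT s|lborel. gaussian e s * (norm (?F s))\<^sup>2) \<le> L2sq f" if e: "e > 0" for e
  proof -
    let ?u = "\<lambda>p. f (fst p) * cnj (f (snd p)) * mollifier e (fst p - snd p)"
    let ?h = "\<lambda>x. (norm (f x))\<^sup>2 / 2"
    let ?v = "\<lambda>p. ?h (fst p) * mollifier e (fst p - snd p)"
    have h: "integrable lborel ?h"
      using L2_integrable[OF L2] by simp
    have v: "integrable (lborel \<Otimes>\<^sub>M lborel) ?v"
      using integrable_mult_mollifier[OF h e] by (simp add: case_prod_beta')
    have v_sw: "integrable (lborel \<Otimes>\<^sub>M lborel) (\<lambda>(x, y). ?v (y, x))"
      using lborel_pair.integrable_product_swap[OF v] by simp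
    have v_sw_eq: "(LINT p|(lborel \<Otimes>\<^sub>M lborel). ?v (snd p, fst p)) = (LINT p|(lborel \<Otimes>\<^sub>M lborel). ?v p)"
      using lborel_pair.integral_product_swap[of ?v] v by (simp add: case_prod_beta')
    have "complex_of_real (LINT s|lborel. gaussian e s * (norm (?F s))\<^sup>2)
        = (LINT s|lborel. complex_of_real (gaussian e s) * (?F s * cnj (?F s)))"
      unfolding complex_norm_square[symmetric] of_real_mult[symmetric] by (rule integral_complex_of_real[symmetric])
    also have "\<dots> = (LINT p|(lborel \<Otimes>\<^sub>M lborel). ?u p)"
      by (rule fourier_damped[OF int int e])
    finally have eq: "complex_of_real (LINT s|lborel. gaussian e s * (norm (?F s))\<^sup>2)
        = (LINT p|(lborel \<Otimes>\<^sub>M lborel). ?u p)" .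
    have "(LINT s|lborel. gaussian e s * (norm (?F s))\<^sup>2)
        \<le> norm (complex_of_real (LINT s|lborel. gaussian e s * (norm (?F s))\<^sup>2))"
      by (simp only: norm_of_real abs_ge_self)
    also have "\<dots> \<le> (LINT p|(lborel \<Otimes>\<^sub>M lborel). norm (?u p))"
      unfolding eq by (rule integral_norm_bound)
    also have "\<dots> \<le> (LINT p|(lborel \<Otimes>\<^sub>M lborel). ?v p + ?v (snd p, fst p))"
    proof (rule Bochner_Integration.integral_mono_AE')
      show "integrable (lborel \<Otimes>\<^sub>M lborel) (\<lambda>p. ?v p + ?v (snd p, fst p))"
        using v v_sw by (intro Bochner_Integration.integrable_add) (auto simp: case_prod_beta')
      show "AE p in lborel \<Otimes>\<^sub>M lborel. norm (?u p) \<le> ?v p + ?v (snd p, fst p)"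
      proof (rule AE_I2)
        fix p :: "(real^'n) \<times> (real^'n)"
        have "norm (f (fst p)) * norm (f (snd p)) \<le> ?h (fst p) + ?h (snd p)"
          using sum_squares_bound[of "norm (f (fst p))" "norm (f (snd p))"] by simp
        from mult_right_mono[OF this mollifier_nonneg[of e "fst p - snd p"]]
        show "norm (?u p) \<le> ?v p + ?v (snd p, fst p)"
          using mollifier_minus[of e "fst p - snd p"]
          by (simp add: norm_mult distrib_right del: mollifier_minus)
      qed
    qed auto
    also have "\<dots> = 2 * (LINT p|(lborel \<Otimes>\<^sub>M lborel). ?v p)"
      using v v_sw v_sw_eq by (subst Bochner_Integration.integral_add) (auto simp: case_prod_beta')
    also have "\<dots> = L2sq f"
      unfolding integral_mult_mollifier[OF h e] L2sq_def by simp
    finally show ?thesis .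
  qed
  have le: "(\<integral>\<^sup>+ s. ennreal ((norm (?F s))\<^sup>2) \<partial>lborel) \<le> ennreal (L2sq f)"
  proof (rule nn_integral_le_of_damped)
    fix e :: real assume e: "e > 0"
    have "(\<integral>\<^sup>+ s. ennreal (gaussian e s * (norm (?F s))\<^sup>2) \<partial>lborel)
        = ennreal (LINT s|lborel. gaussian e s * (norm (?F s))\<^sup>2)"
      by (rule nn_integral_eq_integral[OF int_damped[OF e]]) simp
    also have "\<dots> \<le> ennreal (L2sq f)"
      by (rule ennreal_leI[OF damped[OF e]])
    finally show "(\<integral>\<^sup>+ s. ennreal (gaussian e s * (norm (?F s))\<^sup>2) \<partial>lborel) \<le> ennreal (L2sq f)" .
  qed simp
  show F: "?F \<in> L2"
    by (rule L2_I) (auto intro!: integrableI_bounded le_less_trans[OF le])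
  show "L2sq ?F \<le> L2sq f"
    using le unfolding nn_integral_L2sq[OF F] by simp
qed

text \<open>The damped Parseval identity is evaluated in the limit on both sides. For continuous
  bounded \<open>g\<close> the mollifier acts pointwise: after the substitution
  \<open>y = x + e k * z\<close> the kernel no longer depends on \<open>k\<close>, and dominated
  convergence applies.\<close>

lemma fourier_integral_inner_continuous:
  fixes f g :: "real^'n::finite \<Rightarrow> complex"
  assumes f: "integrable lborel f" "f \<in> L2" and g: "integrable lborel g" "g \<in> L2"
    and cont: "continuous_on UNIV g" and bdd: "bounded (range g)"
  shows "L2_inner (fourier_integral g) (fourier_integral f) = L2_inner g f"
proof -
  let ?F = "fourier_integral f" and ?G = "fourier_integral g"
  have F: "?F \<in> L2" and G: "?G \<in> L2"
    using fourier_integral_L2 f g by auto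
  have [measurable]: "f \<in> borel_measurable borel" "g \<in> borel_measurable borel"
    using f g by auto
  obtain B where B: "\<And>x. norm (g x) \<le> B"
    using bdd by (auto simp: bounded_iff)
  define e where "e k = 1 / real (Suc k)" for k
  have e_pos: "e k > 0" for k by (simp add: e_def)
  have e_lim: "e \<longlonglongrightarrow> 0"
    unfolding e_def by (rule LIMSEQ_Suc[OF lim_1_over_n])
  let ?j = "\<lambda>k s. complex_of_real (gaussian ((e k)\<^sup>2) s) * (?F s * cnj (?G s))"
  let ?T = "\<lambda>k x z. cnj (g (x + e k *\<^sub>R z)) * complex_of_real (mollifier 1 z)"
  let ?S = "\<lambda>k x. LINT z|lborel. ?T k x z"
  define J where "J k = (LINT s|lborel. ?j k s)" for k
  have "J \<longlonglongrightarrow> (LINT s|lborel. ?F s * cnj (?G s))"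
    unfolding J_def
  proof (rule integral_dominated_convergence)
    show "integrable lborel (\<lambda>s. norm (?F s * cnj (?G s)))"
      using L2_inner_integrable[OF G F] by (simp add: mult.commute)
    show "AE s in lborel. (\<lambda>k. ?j k s) \<longlonglongrightarrow> ?F s * cnj (?G s)"
    proof (rule AE_I2)
      fix s :: "real^'n"
      have "(\<lambda>k. ?j k s)
          \<longlonglongrightarrow> complex_of_real (exp (- (0\<^sup>2 * (norm s)\<^sup>2 / 2))) * (?F s * cnj (?G s))"
        unfolding gaussian_def by (intro tendsto_intros e_lim) simp
      then show "(\<lambda>k. ?j k s) \<longlonglongrightarrow> ?F s * cnj (?G s)"
        by simp
    qed
    show "AE s in lborel. norm (?j k s) \<le> norm (?F s * cnj (?G s))" for k
      by (intro AE_I2) (simp add: norm_mult mult_left_le_one_le gaussian_le_1)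
  qed (use F G in measurable)
  then have lim1: "J \<longlonglongrightarrow> L2_inner ?G ?F"
    by (simp add: L2_inner_def mult.commute)
  have J_eq: "J k = (LINT x|lborel. f x * ?S k x)" for k
  proof -
    let ?u = "\<lambda>x y. f x * cnj (g y) * mollifier ((e k)\<^sup>2) (x - y)"
    have "norm (mollifier ((e k)\<^sup>2) z) \<le> norm (mollifier ((e k)\<^sup>2) (0 :: real^'n))" for z :: "real^'n"
      by (auto simp: mollifier_def heat_kernel_def intro!: divide_right_mono mult_right_le_one_le)
    then obtain C where C: "\<And>z :: real^'n. norm (mollifier ((e k)\<^sup>2) z) \<le> C" by blast
    have "integrable (lborel \<Otimes>\<^sub>M lborel) (\<lambda>(x, y). f x * cnj (g y))"
      using f g by (intro integrable_pair_mult lborel.sigma_finite_measure_axioms) auto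
    then have "integrable (lborel \<Otimes>\<^sub>M lborel) (\<lambda>p. of_real C * (f (fst p) * cnj (g (snd p))))"
      by (simp add: case_prod_beta')
    then have int: "integrable (lborel \<Otimes>\<^sub>M lborel) (\<lambda>(x, y). ?u x y)"
    proof (rule Bochner_Integration.integrable_bound)
      show "AE p in lborel \<Otimes>\<^sub>M lborel. norm (case p of (x, y) \<Rightarrow> ?u x y) \<le> norm (of_real C * (f (fst p) * cnj (g (snd p))))"
      proof (rule AE_I2)
        fix p :: "(real^'n) \<times> (real^'n)"
        show "norm (case p of (x, y) \<Rightarrow> ?u x y) \<le> norm (of_real C * (f (fst p) * cnj (g (snd p))))"
          using mult_right_mono[OF order_trans[OF C[of "fst p - snd p"] abs_ge_self], of "norm (f (fst p)) * norm (g (snd p))"]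
          by (simp add: case_prod_beta' norm_mult mult_ac)
      qed
    qed measurable
    have "J k = (LINT p|(lborel \<Otimes>\<^sub>M lborel). ?u (fst p) (snd p))"
      unfolding J_def by (rule fourier_damped) (use f g e_pos[of k] in auto)
    also have "\<dots> = (LINT x|lborel. LINT y|lborel. ?u x y)"
      using lborel_pair.integral_fst[OF int] by (simp add: case_prod_beta')
    also have "\<dots> = (LINT x|lborel. f x * ?S k x)"
    proof (rule Bochner_Integration.integral_cong[OF refl])
      fix x
      have "(LINT y|lborel. ?u x y)
          = \<bar>e k\<bar> ^ DIM(real^'n) *\<^sub>R (LINT z|lborel. ?u x (x + e k *\<^sub>R z))"
        using e_pos[of k] by (intro lborel_integral_affine) auto
      also have "\<dots> = (LINT z|lborel. \<bar>e k\<bar> ^ DIM(real^'n) *\<^sub>R ?u x (x + e k *\<^sub>R z))"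
        by simp
      also have "\<dots> = (LINT z|lborel. f x * (cnj (g (x + e k *\<^sub>R z)) * mollifier 1 z))"
        using e_pos[of k] by (intro Bochner_Integration.integral_cong refl)
          (simp add: mollifier_scale scaleR_conv_of_real[where 'a = complex])
      finally show "(LINT y|lborel. ?u x y) = f x * ?S k x"
        by simp
    qed
    finally show ?thesis .
  qed
  have int_moll: "integrable lborel (\<lambda>z::real^'n. B * mollifier 1 z)"
    by (intro integrable_mult_right integrable_mollifier) simp
  have bound: "norm (?T k x z) \<le> B * mollifier 1 z" for x k z
    using B by (simp add: norm_mult mult_right_mono)
  have inner_lim: "(\<lambda>k. ?S k x) \<longlonglongrightarrow> cnj (g x)" for x
  proof -
    have "(\<lambda>k. ?S k x)
        \<longlonglongrightarrow> (LINT z|lborel. cnj (g x) * complex_of_real (mollifier 1 (z::real^'n)))"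
    proof (rule integral_dominated_convergence[OF _ _ int_moll])
      show "AE z in lborel. (\<lambda>k. ?T k x z)
          \<longlonglongrightarrow> cnj (g x) * complex_of_real (mollifier 1 z)"
      proof (rule AE_I2)
        fix z :: "real^'n"
        have "(\<lambda>k. x + e k *\<^sub>R z) \<longlonglongrightarrow> x + 0 *\<^sub>R z"
          by (intro tendsto_intros e_lim)
        then have "(\<lambda>k. g (x + e k *\<^sub>R z)) \<longlonglongrightarrow> g x"
          using continuous_on_tendsto_compose[OF cont] by simp
        then show "(\<lambda>k. ?T k x z)
          \<longlonglongrightarrow> cnj (g x) * complex_of_real (mollifier 1 z)"
          by (intro tendsto_intros)
      qed
      show "AE z in lborel. norm (?T k x z) \<le> B * mollifier 1 z" for k
        by (intro AE_I2 bound)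
    qed measurable
    then show ?thesis by (simp add: integral_mollifier)
  qed
  have "J \<longlonglongrightarrow> (LINT x|lborel. f x * cnj (g x))"
    unfolding J_eq
  proof (rule integral_dominated_convergence)
    show "integrable lborel (\<lambda>x. B * norm (f x))"
      using f by simp
    show "AE x in lborel. (\<lambda>k. f x * ?S k x) \<longlonglongrightarrow> f x * cnj (g x)"
      by (intro AE_I2 tendsto_intros inner_lim)
    show "AE x in lborel. norm (f x * ?S k x) \<le> B * norm (f x)" for k
    proof (rule AE_I2)
      fix x
      have "norm (?S k x) \<le> (LINT z|lborel. B * mollifier 1 (z::real^'n))"
        by (rule Bochner_Integration.integral_norm_bound_integral[OF _ int_moll bound])
           (rule Bochner_Integration.integrable_bound[OF int_moll], measurable,
            rule AE_I2, rule order_trans[OF bound], simp)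
      then have "norm (?S k x) \<le> B"
        by (simp add: integral_mollifier)
      from mult_left_mono[OF this norm_ge_zero[of "f x"]]
      show "norm (f x * ?S k x) \<le> B * norm (f x)"
        unfolding norm_mult mult.commute[of B "norm (f x)"] .
    qed
  qed measurable
  then have lim2: "J \<longlonglongrightarrow> L2_inner g f"
    by (simp add: L2_inner_def mult.commute)
  show ?thesis
    by (rule LIMSEQ_unique[OF lim1 lim2])
qed

theorem fourier_integral_inner:
  fixes f g :: "real^'n::finite \<Rightarrow> complex"
  assumes f: "integrable lborel f" "f \<in> L2" and g: "integrable lborel g" "g \<in> L2"
  shows "L2_inner (fourier_integral g) (fourier_integral f) = L2_inner g f"
proof -
  have "\<exists>h. h \<in> L2 \<and> integrable lborel h \<and> continuous_on UNIV h \<and> bounded (range h)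
      \<and> L2sq (\<lambda>x. h x - g x) < 1 / real (Suc k)" for k
    by (rule L2_approx_continuous[OF g(2)]) simp
  then obtain h where h: "\<And>k. h k \<in> L2" "\<And>k. integrable lborel (h k)" "\<And>k. continuous_on UNIV (h k)"
      "\<And>k. bounded (range (h k))" and close: "\<And>k. L2sq (\<lambda>x. h k x - g x) < 1 / real (Suc k)"
    by metis
  have const: "(\<lambda>k. L2sq (\<lambda>x. u x - u x)) \<longlonglongrightarrow> 0" for u :: "real^'n \<Rightarrow> complex"
    by (simp add: L2sq_def)
  have lim: "L2_tendsto h g"
    by (rule L2sq_squeeze[OF allI[OF less_imp_le[OF close]] LIMSEQ_Suc[OF lim_1_over_n] refl])
  have "L2sq (\<lambda>x. fourier_integral (h k) x - fourier_integral g x) \<le> L2sq (\<lambda>x. h k x - g x)" for k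
  proof -
    have "fourier_integral (\<lambda>x. h k x - g x) = (\<lambda>x. fourier_integral (h k) x - fourier_integral g x)"
      using h g by (intro ext fourier_integral_diff)
    then show ?thesis
      using fourier_integral_L2(2)[of "\<lambda>x. h k x - g x"] h g by (simp add: L2_diff)
  qed
  then have "\<forall>k. L2sq (\<lambda>x. fourier_integral (h k) x - fourier_integral g x) \<le> L2sq (\<lambda>x. h k x - g x)" ..
  from L2sq_squeeze[OF this lim refl]
  have limF: "(\<lambda>k. L2sq (\<lambda>x. fourier_integral (h k) x - fourier_integral g x)) \<longlonglongrightarrow> 0" .
  have "(\<lambda>k. L2_inner (fourier_integral (h k)) (fourier_integral f)) \<longlonglongrightarrow> L2_inner (fourier_integral g) (fourier_integral f)"
    by (rule L2_inner_tendsto[OF _ _ _ _ limF const]) (use f g h in \<open>auto intro: fourier_integral_L2(1)\<close>)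
  moreover have "(\<lambda>k. L2_inner (h k) f) \<longlonglongrightarrow> L2_inner g f"
    by (rule L2_inner_tendsto[OF _ _ _ _ lim const]) (use f g h in auto)
  moreover have "L2_inner (fourier_integral (h k)) (fourier_integral f) = L2_inner (h k) f" for k
    by (rule fourier_integral_inner_continuous) (use f h in auto)
  ultimately show ?thesis
    using LIMSEQ_unique by simp
qed

lemma L2sq_fourier_integral:
  fixes f :: "real^'n::finite \<Rightarrow> complex"
  assumes "integrable lborel f" "f \<in> L2"
  shows "L2sq (fourier_integral f) = L2sq f"
  using fourier_integral_inner[OF assms assms] by (simp add: L2_inner_self)

section \<open>Extension of the transform to all of L2\<close>

lemma fourier_L2_iff:
  "(f, F) \<in> fourier_L2 \<longleftrightarrow> f \<in> L2 \<and> F \<in> L2 \<and>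
    L2_tendsto (\<lambda>k. fourier_integral (ball_trunc k f)) F"
proof -
  have "L2_lim (\<lambda>k. fourier_integral (ball_trunc k f)) F
      \<longleftrightarrow> L2_tendsto (\<lambda>k. fourier_integral (ball_trunc k f)) F" if "f \<in> L2" "F \<in> L2"
    using that by (intro L2_lim_iff fourier_integral_L2(1) ball_trunc_integrable ball_trunc_L2)
  then show ?thesis
    unfolding fourier_L2_def by (auto simp: ball_trunc_def)
qed

lemma fourier_L2_D:
  assumes "(f, F) \<in> fourier_L2"
  shows "f \<in> L2" "F \<in> L2" "L2_tendsto (\<lambda>k. fourier_integral (ball_trunc k f)) F"
  using assms by (auto simp: fourier_L2_iff)

lemma fourier_ball_trunc_L2:
  "f \<in> L2 \<Longrightarrow> fourier_integral (ball_trunc k f) \<in> L2"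
  by (intro fourier_integral_L2(1) ball_trunc_integrable ball_trunc_L2)

lemma L2sq_fourier_integral_diff:
  assumes "integrable lborel f" "f \<in> L2" "integrable lborel g" "g \<in> L2"
  shows "L2sq (\<lambda>x. fourier_integral f x - fourier_integral g x) = L2sq (\<lambda>x. f x - g x)"
proof -
  have "(\<lambda>x. fourier_integral f x - fourier_integral g x) = fourier_integral (\<lambda>x. f x - g x)"
    using assms by (intro ext fourier_integral_diff[symmetric])
  then show ?thesis
    using assms by (simp add: L2sq_fourier_integral L2_diff)
qed

lemma L2sq_zero [simp]: "L2sq (\<lambda>x. 0) = 0"
  by (simp add: L2sq_def)

lemma fourier_L2_exists:
  assumes f: "f \<in> L2"
  shows "\<exists>F. (f, F) \<in> fourier_L2"
proof -
  let ?F = "\<lambda>k. fourier_integral (ball_trunc k f)"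
  have "\<exists>F\<in>L2. L2_tendsto (\<lambda>k. ?F k) F"
  proof (rule L2_complete)
    fix e :: real assume "e > 0"
    then have "eventually (\<lambda>k. L2sq (\<lambda>x. ball_trunc k f x - f x) < e / 4) sequentially"
      by (intro order_tendstoD(2)[OF ball_trunc_tendsto[OF f]]) simp
    then obtain N where N: "\<And>k. k \<ge> N \<Longrightarrow> L2sq (\<lambda>x. ball_trunc k f x - f x) < e / 4"
      by (auto simp: eventually_sequentially)
    have "L2sq (\<lambda>x. ?F i x - ?F j x) < e"
      if "i \<ge> N" "j \<ge> N" for i j
    proof -
      have "L2sq (\<lambda>x. ?F i x - ?F j x)
          = L2sq (\<lambda>x. ball_trunc i f x - ball_trunc j f x)"
        by (intro L2sq_fourier_integral_diff ball_trunc_integrable ball_trunc_L2 f)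
      also have "\<dots> \<le> 2 * L2sq (\<lambda>x. ball_trunc i f x - f x) + 2 * L2sq (\<lambda>x. f x - ball_trunc j f x)"
        by (intro L2sq_diff_le ball_trunc_L2 f)
      also have "\<dots> < e"
        using N[OF that(1)] N[OF that(2)] by (simp add: L2sq_diff_commute[of f])
      finally show ?thesis .
    qed
    then show "\<exists>N. \<forall>i\<ge>N. \<forall>j\<ge>N.
        L2sq (\<lambda>x. ?F i x - ?F j x) < e"
      by blast
  qed (rule fourier_ball_trunc_L2[OF f])
  then show ?thesis
    using f by (auto simp: fourier_L2_iff)
qed

theorem fourier_L2_inner:
  assumes f: "(f, F) \<in> fourier_L2" and g: "(g, G) \<in> fourier_L2"
  shows "L2_inner F G = L2_inner f g"
proof -
  note D = fourier_L2_D[OF f] fourier_L2_D[OF g]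
  have "(\<lambda>k. L2_inner (fourier_integral (ball_trunc k f)) (fourier_integral (ball_trunc k g))) \<longlonglongrightarrow> L2_inner F G"
    by (rule L2_inner_tendsto) (use D in \<open>auto intro: fourier_ball_trunc_L2\<close>)
  moreover have "L2_inner (fourier_integral (ball_trunc k f)) (fourier_integral (ball_trunc k g))
      = L2_inner (ball_trunc k f) (ball_trunc k g)" for k
    by (rule fourier_integral_inner) (use D in \<open>auto intro: ball_trunc_integrable ball_trunc_L2\<close>)
  moreover have "(\<lambda>k. L2_inner (ball_trunc k f) (ball_trunc k g)) \<longlonglongrightarrow> L2_inner f g"
    by (rule L2_inner_tendsto) (use D in \<open>auto intro: ball_trunc_L2 ball_trunc_tendsto\<close>)
  ultimately show ?thesis
    using LIMSEQ_unique by simp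
qed

lemma fourier_L2_sq:
  assumes "(f, F) \<in> fourier_L2"
  shows "L2sq F = L2sq f"
  using fourier_L2_inner[OF assms assms] by (simp add: L2_inner_self)

lemma fourier_L2_diff_sq:
  assumes f: "(f, F) \<in> fourier_L2" and g: "(g, G) \<in> fourier_L2"
  shows "L2sq (\<lambda>x. F x - G x) = L2sq (\<lambda>x. f x - g x)"
  using fourier_L2_D[OF f] fourier_L2_D[OF g]
  by (simp add: L2sq_diff_expand fourier_L2_inner[OF f g] fourier_L2_sq[OF f] fourier_L2_sq[OF g])

lemma fourier_L2_linear:
  assumes f: "(f, F) \<in> fourier_L2" and g: "(g, G) \<in> fourier_L2"
  shows "(\<lambda>x. a * f x + b * g x, \<lambda>x. a * F x + b * G x) \<in> fourier_L2"
proof -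
  note D = fourier_L2_D[OF f] fourier_L2_D[OF g]
  let ?f = "\<lambda>k. fourier_integral (ball_trunc k f)" and ?g = "\<lambda>k. fourier_integral (ball_trunc k g)"
  let ?h = "\<lambda>k. fourier_integral (ball_trunc k (\<lambda>x. a * f x + b * g x))"
  let ?e = "\<lambda>k. 2 * ((norm a)\<^sup>2 * L2sq (\<lambda>x. ?f k x - F x)) + 2 * ((norm b)\<^sup>2 * L2sq (\<lambda>x. ?g k x - G x))"
  have eq: "?h k x = a * ?f k x + b * ?g k x" for k x
  proof -
    have "ball_trunc k (\<lambda>x. a * f x + b * g x) = (\<lambda>x. a * ball_trunc k f x + b * ball_trunc k g x)"
      by (simp add: ball_trunc_def fun_eq_iff algebra_simps)
    then show ?thesis
      using D by (simp add: fourier_integral_linear ball_trunc_integrable)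
  qed
  have "L2sq (\<lambda>x. ?h k x - (a * F x + b * G x))
      \<le> ?e k" for k
  proof -
    have "L2sq (\<lambda>x. ?h k x - (a * F x + b * G x))
        = L2sq (\<lambda>x. a * (?f k x - F x) + b * (?g k x - G x))"
      unfolding eq by (simp add: algebra_simps)
    also have "\<dots> \<le> 2 * L2sq (\<lambda>x. a * (?f k x - F x)) + 2 * L2sq (\<lambda>x. b * (?g k x - G x))"
      using D by (intro L2sq_add_le L2_cmult L2_diff fourier_ball_trunc_L2)
    finally show ?thesis
      by (simp add: L2sq_cmult)
  qed
  then have "\<forall>k. L2sq (\<lambda>x. ?h k x - (a * F x + b * G x))
      \<le> ?e k" by blast
  moreover have "(\<lambda>k. ?e k)
      \<longlonglongrightarrow> 2 * ((norm a)\<^sup>2 * 0) + 2 * ((norm b)\<^sup>2 * 0)"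
    by (intro tendsto_intros D)
  ultimately have "(\<lambda>k. L2sq (\<lambda>x. ?h k x - (a * F x + b * G x))) \<longlonglongrightarrow> 0"
    by (rule L2sq_squeeze) simp
  then show ?thesis
    using D by (simp add: fourier_L2_iff L2_add L2_cmult)
qed

lemma fourier_L2_integral:
  assumes "integrable lborel f" "f \<in> L2"
  shows "(f, fourier_integral f) \<in> fourier_L2"
proof -
  have "L2sq (\<lambda>x. fourier_integral (ball_trunc k f) x - fourier_integral f x) = L2sq (\<lambda>x. ball_trunc k f x - f x)" for k
    using assms by (intro L2sq_fourier_integral_diff ball_trunc_integrable ball_trunc_L2)
  then show ?thesis
    using assms by (simp add: fourier_L2_iff fourier_integral_L2 ball_trunc_tendsto)
qed

lemma fourier_L2_cong_AE:
  assumes f: "(f, F) \<in> fourier_L2" and G: "G \<in> L2" and ae: "AE x in lborel. F x = G x"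
  shows "(f, G) \<in> fourier_L2"
proof -
  note D = fourier_L2_D[OF f]
  have "L2sq (\<lambda>x. fourier_integral (ball_trunc k f) x - F x) = L2sq (\<lambda>x. fourier_integral (ball_trunc k f) x - G x)" for k
    using D G ae by (intro L2sq_cong_AE L2_diff fourier_ball_trunc_L2) auto
  then show ?thesis
    using D G by (simp add: fourier_L2_iff)
qed

lemma L2sq_cnj [simp]: "L2sq (\<lambda>x. cnj (f x)) = L2sq f"
  by (simp add: L2sq_def)

lemma L2sq_cnj_diff [simp]: "L2sq (\<lambda>x. cnj (f x) - cnj (g x)) = L2sq (\<lambda>x. f x - g x)"
  using L2sq_cnj[of "\<lambda>x. f x - g x"] by simp

lemma fourier_integral_multiplication:
  fixes f g :: "real^'n::finite \<Rightarrow> complex"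
  assumes f: "integrable lborel f" and g: "integrable lborel g"
  shows "(LINT x|lborel. fourier_integral f x * g x) = (LINT x|lborel. f x * fourier_integral g x)"
proof -
  let ?c = "fourier_const TYPE('n)"
  define I where "I x y = f x * g y * cis (y \<bullet> (- x))" for x y
  have [measurable]: "f \<in> borel_measurable borel" "g \<in> borel_measurable borel"
    using f g by auto
  have "integrable (lborel \<Otimes>\<^sub>M lborel) (\<lambda>(x, y). f x * g y)"
    using f g by (intro integrable_pair_mult lborel.sigma_finite_measure_axioms)
  moreover have "case_prod I \<in> borel_measurable (lborel \<Otimes>\<^sub>M lborel)"
    unfolding I_def by measurable
  ultimately have int: "integrable (lborel \<Otimes>\<^sub>M lborel) (case_prod I)"
    by (rule Bochner_Integration.integrable_bound) (auto simp: I_def norm_mult)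
  have "(LINT y|lborel. fourier_integral f y * g y) = ?c * (LINT y|lborel. LINT x|lborel. I x y)"
    unfolding I_def fourier_integral_eq integral_mult_right_zero[symmetric] integral_mult_left_zero[symmetric]
    by (simp add: mult_ac)
  also have "\<dots> = ?c * (LINT x|lborel. LINT y|lborel. I x y)"
    using lborel_pair.Fubini_integral[OF int] by simp
  also have "\<dots> = (LINT x|lborel. f x * fourier_integral g x)"
    unfolding I_def fourier_integral_eq integral_mult_right_zero[symmetric] integral_mult_left_zero[symmetric]
    by (simp add: mult_ac inner_commute)
  finally show ?thesis .
qed

lemma fourier_L2_multiplication:
  assumes f: "(f, F) \<in> fourier_L2" and g: "(g, G) \<in> fourier_L2"
  shows "L2_inner (\<lambda>x. cnj (F x)) g = L2_inner (\<lambda>x. cnj (f x)) G"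
proof -
  note D = fourier_L2_D[OF f] fourier_L2_D[OF g]
  have 1: "(\<lambda>k. L2_inner (\<lambda>x. cnj (fourier_integral (ball_trunc k f) x)) (ball_trunc k g)) \<longlonglongrightarrow> L2_inner (\<lambda>x. cnj (F x)) g"
    by (rule L2_inner_tendsto)
       (use D in \<open>auto intro: fourier_ball_trunc_L2 ball_trunc_L2 ball_trunc_tendsto L2_cnj\<close>)
  have 2: "(\<lambda>k. L2_inner (\<lambda>x. cnj (ball_trunc k f x)) (fourier_integral (ball_trunc k g))) \<longlonglongrightarrow> L2_inner (\<lambda>x. cnj (f x)) G"
    by (rule L2_inner_tendsto)
       (use D in \<open>auto intro: fourier_ball_trunc_L2 ball_trunc_L2 ball_trunc_tendsto L2_cnj\<close>)
  have "L2_inner (\<lambda>x. cnj (fourier_integral (ball_trunc k f) x)) (ball_trunc k g)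
      = L2_inner (\<lambda>x. cnj (ball_trunc k f x)) (fourier_integral (ball_trunc k g))" for k
    unfolding L2_inner_def complex_cnj_cnj
    by (intro fourier_integral_multiplication ball_trunc_integrable D)
  with 1 2 show ?thesis
    using LIMSEQ_unique by simp
qed

text \<open>Replaces the inversion formula. The inverse of the transform should be conjugation,
  transform, conjugation, so with \<open>P\<close> the transform of \<open>cnj F\<close> the
  preimage is \<open>cnj P\<close>. Its transform \<open>F'\<close> agrees with \<open>F\<close>
  because the multiplication formula evaluates the inner product of \<open>F'\<close> and
  \<open>F\<close> as the squared norm of \<open>P\<close>.\<close>

theorem fourier_L2_surj:
  assumes F: "F \<in> L2"
  shows "\<exists>f. (f, F) \<in> fourier_L2"
proof -
  obtain P where P: "(\<lambda>x. cnj (F x), P) \<in> fourier_L2"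
    using fourier_L2_exists[OF L2_cnj[OF F]] by blast
  have P_L2: "P \<in> L2" by (rule fourier_L2_D[OF P])
  obtain F' where F': "(\<lambda>x. cnj (P x), F') \<in> fourier_L2"
    using fourier_L2_exists[OF L2_cnj[OF P_L2]] by blast
  have F'_L2: "F' \<in> L2" by (rule fourier_L2_D[OF F'])
  have sqP: "L2sq P = L2sq F" using fourier_L2_sq[OF P] by simp
  have "L2_inner F' F = cnj (L2_inner (\<lambda>x. cnj (F' x)) (\<lambda>x. cnj (F x)))"
    unfolding L2_inner_def by (subst Bochner_Integration.integral_cnj[symmetric]) simp
  also have "\<dots> = cnj (L2_inner P P)"
    using fourier_L2_multiplication[OF F' P] by simp
  finally have "L2sq (\<lambda>x. F' x - F x) = 0" \<comment> \<open>as all three terms of the expanded square are multiples of \<open>L2sq F\<close>\<close>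
    using fourier_L2_sq[OF F'] by (simp add: L2sq_diff_expand[OF F'_L2 F] L2_inner_self sqP)
  from L2sq_diff_eq_0_imp_AE[OF F'_L2 F this] show ?thesis
    using fourier_L2_cong_AE[OF F' F] by blast
qed

section \<open>Dilations\<close>

text \<open>The unitary group \<open>e^(isA)\<close>; the exponential factor compensates the
  Jacobian of the scaling.\<close>

definition dilate :: "real \<Rightarrow> ('a::euclidean_space \<Rightarrow> complex) \<Rightarrow> 'a \<Rightarrow> complex" where
  "dilate s f x = complex_of_real (exp (real DIM('a) * s / 2)) * f (exp s *\<^sub>R x)"

lemma dilate_measurable [measurable]:
  assumes [measurable]: "f \<in> borel_measurable borel"
  shows "dilate s f \<in> borel_measurable borel"
  unfolding dilate_def by measurable

lemma dilate_diff: "dilate s (\<lambda>x. f x - g x) = (\<lambda>x. dilate s f x - dilate s g x)"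
  by (simp add: dilate_def fun_eq_iff algebra_simps)

lemma exp_real_mult_power: "exp (real n * s) = exp s ^ n"
  by (simp add: exp_of_nat_mult)

lemma lborel_integral_exp_scale:
  fixes f :: "'a::euclidean_space \<Rightarrow> 'b::{banach, second_countable_topology}"
  assumes "f \<in> borel_measurable borel"
  shows "(LINT x|lborel. f x) = exp (real DIM('a) * s) *\<^sub>R (LINT x|lborel. f (exp s *\<^sub>R x))"
  using lborel_integral_affine[OF _ assms, of "exp s" 0] by (simp add: exp_real_mult_power)

lemma lborel_integrable_exp_scale_iff:
  fixes f :: "'a::euclidean_space \<Rightarrow> 'b::{banach, second_countable_topology}"
  assumes "f \<in> borel_measurable borel"
  shows "integrable lborel (\<lambda>x. f (exp s *\<^sub>R x)) \<longleftrightarrow> integrable lborel f"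
  using lborel_integrable_affine_iff[OF _ assms, of "exp s" 0] by simp

lemma norm_dilate_sq:
  "(norm (dilate s f (x::'a::euclidean_space)))\<^sup>2 = exp (real DIM('a) * s) * (norm (f (exp s *\<^sub>R x)))\<^sup>2"
  by (simp add: dilate_def norm_mult power_mult_distrib flip: exp_double)

lemma dilate_L2: "f \<in> L2 \<Longrightarrow> dilate s f \<in> L2"
  unfolding L2_iff norm_dilate_sq
  using lborel_integrable_exp_scale_iff[of "\<lambda>x. (norm (f x))\<^sup>2" s] by auto

lemma dilate_integrable: "integrable lborel f \<Longrightarrow> integrable lborel (dilate s f)"
  unfolding dilate_def[abs_def] using lborel_integrable_exp_scale_iff[of f s] by auto

lemma L2sq_dilate:
  assumes "f \<in> L2"
  shows "L2sq (dilate s f) = L2sq f"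
  unfolding L2sq_def norm_dilate_sq
  using lborel_integral_exp_scale[of "\<lambda>x. (norm (f x))\<^sup>2" s] assms by simp

lemma fourier_integral_dilate:
  fixes f :: "real^'n::finite \<Rightarrow> complex"
  assumes f: "integrable lborel f"
  shows "fourier_integral (dilate s f) = dilate (- s) (fourier_integral f)"
proof
  fix \<xi> :: "real^'n"
  have [measurable]: "f \<in> borel_measurable borel" using f by auto
  let ?n = "real CARD('n)"
  have "(LINT x|lborel. f x * cis ((exp (- s) *\<^sub>R \<xi>) \<bullet> (- x)))
      = exp (?n * s) *\<^sub>R (LINT x|lborel. f (exp s *\<^sub>R x) * cis ((exp (- s) *\<^sub>R \<xi>) \<bullet> (- (exp s *\<^sub>R x))))"
    using lborel_integral_exp_scale[of "\<lambda>x. f x * cis ((exp (- s) *\<^sub>R \<xi>) \<bullet> (- x))" s] by simp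
  also have "\<dots> = exp (?n * s) * (LINT x|lborel. f (exp s *\<^sub>R x) * cis (\<xi> \<bullet> (- x)))"
    by (simp add: scaleR_conv_of_real[where 'a = complex] mult.assoc[symmetric] exp_add[symmetric])
  finally have eq: "(LINT x|lborel. f x * cis ((exp (- s) *\<^sub>R \<xi>) \<bullet> (- x)))
      = exp (?n * s) * (LINT x|lborel. f (exp s *\<^sub>R x) * cis (\<xi> \<bullet> (- x)))" .
  have e: "complex_of_real (exp (- (?n * s) / 2)) * complex_of_real (exp (?n * s)) = complex_of_real (exp (?n * s / 2))"
    by (simp add: exp_add[symmetric] flip: of_real_mult)
  have "dilate (- s) (fourier_integral f) \<xi> = fourier_const TYPE('n)
      * (complex_of_real (exp (- (?n * s) / 2)) * complex_of_real (exp (?n * s)) * (LINT x|lborel. f (exp s *\<^sub>R x) * cis (\<xi> \<bullet> (- x))))"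
    unfolding dilate_def fourier_integral_eq eq by (simp add: mult_ac)
  also have "\<dots> = fourier_integral (dilate s f) \<xi>"
    unfolding e unfolding dilate_def fourier_integral_eq by (simp add: mult.assoc)
  finally show "fourier_integral (dilate s f) \<xi> = dilate (- s) (fourier_integral f) \<xi>" ..
qed

text \<open>Dilating a truncation yields a truncation to a different ball, so the defining limit
  does not carry over directly. Instead an arbitrary transform \<open>G\<close> of the dilated
  function is compared with the candidate through truncations, with an error that vanishes as
  \<open>k\<close> grows.\<close>

lemma fourier_L2_dilate:
  assumes f: "(f, F) \<in> fourier_L2"
  shows "(dilate s f, dilate (- s) F) \<in> fourier_L2"
proof -
  note D = fourier_L2_D[OF f]
  obtain G where G: "(dilate s f, G) \<in> fourier_L2"
    using fourier_L2_exists[OF dilate_L2[OF D(1)]] by blast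
  have G_L2: "G \<in> L2" by (rule fourier_L2_D[OF G])
  let ?F = "\<lambda>k. fourier_integral (ball_trunc k f)"
  have F_L2: "?F k \<in> L2" for k by (rule fourier_ball_trunc_L2[OF D(1)])
  have le: "L2sq (\<lambda>x. G x - dilate (- s) F x)
      \<le> 2 * L2sq (\<lambda>x. ball_trunc k f x - f x) + 2 * L2sq (\<lambda>x. ?F k x - F x)" for k
  proof -
    have "L2sq (\<lambda>x. G x - dilate (- s) F x)
        \<le> 2 * L2sq (\<lambda>x. G x - dilate (- s) (?F k) x) + 2 * L2sq (\<lambda>x. dilate (- s) (?F k) x - dilate (- s) F x)"
      by (intro L2sq_diff_le G_L2 dilate_L2 F_L2 D)
    also have "L2sq (\<lambda>x. dilate (- s) (?F k) x - dilate (- s) F x) = L2sq (\<lambda>x. ?F k x - F x)"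
      by (subst dilate_diff[symmetric], rule L2sq_dilate) (intro L2_diff F_L2 D)
    also have "L2sq (\<lambda>x. G x - dilate (- s) (?F k) x) = L2sq (\<lambda>x. dilate s f x - dilate s (ball_trunc k f) x)"
      using fourier_L2_diff_sq[OF G fourier_L2_integral[OF dilate_integrable[OF ball_trunc_integrable[OF D(1)]] dilate_L2[OF ball_trunc_L2[OF D(1)]]]]
      by (simp add: fourier_integral_dilate ball_trunc_integrable D)
    also have "\<dots> = L2sq (\<lambda>x. f x - ball_trunc k f x)"
      by (subst dilate_diff[symmetric], rule L2sq_dilate) (intro L2_diff ball_trunc_L2 D)
    finally show ?thesis
      by (simp add: L2sq_diff_commute[of f])
  qed
  have "(\<lambda>k. 2 * L2sq (\<lambda>x. ball_trunc k f x - f x) + 2 * L2sq (\<lambda>x. ?F k x - F x)) \<longlonglongrightarrow> 2 * 0 + 2 * 0"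
    by (intro tendsto_intros ball_trunc_tendsto D)
  then have "L2sq (\<lambda>x. G x - dilate (- s) F x) \<le> 0"
    by (intro LIMSEQ_le_const[of _ 0]) (use le in auto)
  then have "L2sq (\<lambda>x. G x - dilate (- s) F x) = 0"
    using L2sq_nonneg by (intro antisym)
  from L2sq_diff_eq_0_imp_AE[OF G_L2 dilate_L2[OF D(2)] this] show ?thesis
    using fourier_L2_cong_AE[OF G dilate_L2[OF D(2)]] by blast
qed

section \<open>Bounded functions of \<open>H\<close> as multipliers\<close>

lemma H_fun_inner:
  fixes f g :: "real^'n::finite \<Rightarrow> complex"
  assumes f: "(f, F) \<in> fourier_L2" and g: "(g, G) \<in> fourier_L2"
    and p: "(\<lambda>\<xi>::real^'n. p (sqrt ((norm \<xi>)\<^sup>2 + m\<^sup>2))) \<in> borel_measurable borel"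
    and bound: "\<And>\<xi>::real^'n. norm (p (sqrt ((norm \<xi>)\<^sup>2 + m\<^sup>2))) \<le> B"
  shows "L2_inner g (op_app (H_fun m p) f)
      = (LINT \<xi>|lborel. cnj (G \<xi>) * (p (sqrt ((norm \<xi>)\<^sup>2 + m\<^sup>2)) * F \<xi>))"
proof -
  note D = fourier_L2_D[OF f] fourier_L2_D[OF g]
  let ?P = "\<lambda>\<xi>::real^'n. p (sqrt ((norm \<xi>)\<^sup>2 + m\<^sup>2))"
  have PF: "(\<lambda>\<xi>. ?P \<xi> * F \<xi>) \<in> L2"
    by (rule L2_mult_bounded[OF D(2) p bound])
  \<comment> \<open>Surjectivity of the transform puts \<open>f\<close> into the domain, so that the
    choice in \<open>op_app\<close> has a witness.\<close>
  obtain h0 where h0: "(h0, \<lambda>\<xi>. ?P \<xi> * F \<xi>) \<in> fourier_L2"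
    using fourier_L2_surj[OF PF] by blast
  then have "\<exists>h. (f, h) \<in> H_fun m p"
    using f unfolding H_fun_def neg_laplacian_fun_def by auto
  then have "(f, op_app (H_fun m p) f) \<in> H_fun m p"
    unfolding op_app_def by (rule someI_ex)
  then obtain F' K where F': "(f, F') \<in> fourier_L2" and K: "(op_app (H_fun m p) f, K) \<in> fourier_L2"
    and ae: "AE \<xi> in lborel. K \<xi> = ?P \<xi> * F' \<xi>"
    unfolding H_fun_def neg_laplacian_fun_def by auto
  \<comment> \<open>The chosen value comes with some transform \<open>F'\<close> of
    \<open>f\<close>; two transforms of the same function agree up to a null set.\<close>
  have "AE \<xi> in lborel. F' \<xi> = F \<xi>"
    using fourier_L2_diff_sq[OF F' f] fourier_L2_D[OF F'] D
    by (intro L2sq_diff_eq_0_imp_AE) auto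
  with ae have "AE \<xi> in lborel. K \<xi> = ?P \<xi> * F \<xi>"
    by eventually_elim simp
  then have "L2_inner G K = L2_inner G (\<lambda>\<xi>. ?P \<xi> * F \<xi>)"
    using D PF fourier_L2_D[OF K] by (intro L2_inner_cong_AE) auto
  then show ?thesis
    using fourier_L2_inner[OF g K] by (simp add: L2_inner_def)
qed

section \<open>The generator of dilations\<close>

definition rapidly_decreasing :: "('a::euclidean_space \<Rightarrow> complex) \<Rightarrow> bool" where
  "rapidly_decreasing h \<longleftrightarrow> (\<forall>k. \<exists>C. \<forall>x. norm x ^ k * norm (h x) \<le> C)"

lemma rapidly_decreasing_add:
  assumes "rapidly_decreasing f" "rapidly_decreasing g"
  shows "rapidly_decreasing (\<lambda>x. f x + g x)"
  unfolding rapidly_decreasing_def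
proof
  fix k
  obtain C D where C: "\<And>x. norm x ^ k * norm (f x) \<le> C" and D: "\<And>x. norm x ^ k * norm (g x) \<le> D"
    using assms unfolding rapidly_decreasing_def by metis
  have "norm x ^ k * norm (f x + g x) \<le> C + D" for x
  proof -
    have "norm x ^ k * norm (f x + g x) \<le> norm x ^ k * (norm (f x) + norm (g x))"
      by (intro mult_left_mono norm_triangle_ineq) simp
    also have "\<dots> \<le> C + D"
      using C[of x] D[of x] by (simp add: distrib_left)
    finally show ?thesis .
  qed
  then show "\<exists>C. \<forall>x. norm x ^ k * norm (f x + g x) \<le> C" by blast
qed

lemma rapidly_decreasing_sum:
  assumes "finite A" "\<And>a. a \<in> A \<Longrightarrow> rapidly_decreasing (f a)"
  shows "rapidly_decreasing (\<lambda>x. \<Sum>a\<in>A. f a x)"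
  using assms
proof (induction A rule: finite_induct)
  case empty
  show ?case by (auto simp: rapidly_decreasing_def)
next
  case (insert a A)
  then show ?case by (simp add: rapidly_decreasing_add)
qed

lemma rapidly_decreasing_cmult:
  assumes "rapidly_decreasing f"
  shows "rapidly_decreasing (\<lambda>x. c * f x)"
  unfolding rapidly_decreasing_def
proof
  fix k
  obtain C where C: "\<And>x. norm x ^ k * norm (f x) \<le> C"
    using assms unfolding rapidly_decreasing_def by metis
  have "norm x ^ k * norm (c * f x) \<le> norm c * C" for x
    using mult_left_mono[OF C[of x] norm_ge_zero[of c]] by (simp add: norm_mult mult_ac)
  then show "\<exists>C. \<forall>x. norm x ^ k * norm (c * f x) \<le> C" by blast
qed

lemma rapidly_decreasing_coordinate:
  fixes f :: "real^'n::finite \<Rightarrow> complex"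
  assumes "rapidly_decreasing f"
  shows "rapidly_decreasing (\<lambda>x. complex_of_real (x $ j) * f x)"
  unfolding rapidly_decreasing_def
proof
  fix k
  obtain C where C: "\<And>x. norm x ^ Suc k * norm (f x) \<le> C"
    using assms unfolding rapidly_decreasing_def by metis
  have "norm x ^ k * norm (complex_of_real (x $ j) * f x) \<le> C" for x
  proof -
    have "norm x ^ k * norm (complex_of_real (x $ j) * f x) \<le> norm x ^ k * (norm x * norm (f x))"
      unfolding norm_mult norm_of_real
      by (intro mult_left_mono mult_right_mono component_le_norm_cart) auto
    also have "\<dots> \<le> C"
      using C[of x] by (simp add: mult_ac)
    finally show ?thesis .
  qed
  then show "\<exists>C. \<forall>x. norm x ^ k * norm (complex_of_real (x $ j) * f x) \<le> C" by blast
qed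

lemma rapidly_decreasing_bound:
  assumes "rapidly_decreasing h"
  shows "\<exists>C. \<forall>x. norm (h x) \<le> C / (1 + (norm x)\<^sup>2) ^ N"
proof -
  obtain C D where C: "\<And>x. norm x ^ 0 * norm (h x) \<le> C" and D: "\<And>x. norm x ^ (2 * N) * norm (h x) \<le> D"
    using assms unfolding rapidly_decreasing_def by metis
  have "norm (h x) \<le> (2 ^ N * (C + D)) / (1 + (norm x)\<^sup>2) ^ N" for x
  proof -
    have le: "(1 + (norm x)\<^sup>2) ^ N \<le> 2 ^ N * (1 + norm x ^ (2 * N))"
    proof (cases "norm x \<le> 1")
      case True
      then have "(1 + (norm x)\<^sup>2) ^ N \<le> 2 ^ N"
        by (intro power_mono) (auto simp: power_le_one)
      also have "\<dots> \<le> 2 ^ N * (1 + norm x ^ (2 * N))" by simp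
      finally show ?thesis .
    next
      case False
      then have "1 \<le> (norm x)\<^sup>2" by (simp add: one_le_power)
      then have "(1 + (norm x)\<^sup>2) ^ N \<le> (2 * (norm x)\<^sup>2) ^ N"
        by (intro power_mono) auto
      also have "\<dots> \<le> 2 ^ N * (1 + norm x ^ (2 * N))"
        by (simp add: power_mult_distrib power_mult)
      finally show ?thesis .
    qed
    have "(1 + (norm x)\<^sup>2) ^ N * norm (h x) \<le> 2 ^ N * (1 + norm x ^ (2 * N)) * norm (h x)"
      by (intro mult_right_mono le) simp
    also have "\<dots> = 2 ^ N * (norm (h x) + norm x ^ (2 * N) * norm (h x))"
      by (simp add: algebra_simps)
    also have "\<dots> \<le> 2 ^ N * (C + D)"
      using C[of x] D[of x] by (intro mult_left_mono add_mono) auto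
    finally have "(1 + (norm x)\<^sup>2) ^ N * norm (h x) \<le> 2 ^ N * (C + D)" .
    moreover have "0 < (1 + (norm x)\<^sup>2) ^ N"
      by (intro zero_less_power add_pos_nonneg) auto
    ultimately show ?thesis
      by (simp add: field_simps)
  qed
  then show ?thesis by blast
qed

text \<open>Each \<open>1 + (x \<bullet> b)^2\<close> is at most \<open>1 + (norm x)^2\<close>, so
  the product of the integrable functions \<open>1 / (1 + (x \<bullet> b)^2)\<close> over the
  coordinates dominates as soon as the power is at least the dimension.\<close>

lemma integrable_inverse_1_plus_norm_power:
  fixes c :: real
  assumes "N \<ge> DIM('a)"
  shows "integrable lborel (\<lambda>x::'a::euclidean_space. c / (1 + (norm x)\<^sup>2) ^ N)"
proof -
  have "integrable lborel (\<lambda>x::real. inverse (1 + x\<^sup>2))"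
    using integrable_inverse_1_plus_square by (simp add: set_integrable_def)
  then have int: "integrable lborel (\<lambda>x::'a. \<Prod>b\<in>Basis. inverse (1 + (x \<bullet> b)\<^sup>2))"
    by (intro integrable_lborel_prod)
  have "integrable lborel (\<lambda>x::'a. 1 / (1 + (norm x)\<^sup>2) ^ N)"
  proof (rule Bochner_Integration.integrable_bound[OF int])
    show "AE x::'a in lborel. norm (1 / (1 + (norm x)\<^sup>2) ^ N) \<le> norm (\<Prod>b\<in>Basis. inverse (1 + (x \<bullet> b)\<^sup>2))"
    proof (rule AE_I2)
      fix x :: 'a
      have pos: "0 < (\<Prod>b\<in>Basis. 1 + (x \<bullet> b)\<^sup>2)"
        by (intro prod_pos) (simp add: add_pos_nonneg)
      have "(\<Prod>b\<in>Basis. 1 + (x \<bullet> b)\<^sup>2) \<le> (\<Prod>b\<in>(Basis::'a set). 1 + (norm x)\<^sup>2)"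
        by (intro prod_mono) (auto simp: abs_le_square_iff[symmetric] Basis_le_norm)
      also have "\<dots> = (1 + (norm x)\<^sup>2) ^ DIM('a)" by simp
      also have "\<dots> \<le> (1 + (norm x)\<^sup>2) ^ N"
        by (intro power_increasing assms) simp
      finally have "(\<Prod>b\<in>Basis. 1 + (x \<bullet> b)\<^sup>2) \<le> (1 + (norm x)\<^sup>2) ^ N" .
      then have "1 / (1 + (norm x)\<^sup>2) ^ N \<le> 1 / (\<Prod>b\<in>Basis. 1 + (x \<bullet> b)\<^sup>2)"
        using pos by (intro divide_left_mono) auto
      moreover have "1 / (\<Prod>b\<in>Basis. 1 + (x \<bullet> b)\<^sup>2) = (\<Prod>b\<in>Basis. inverse (1 + (x \<bullet> b)\<^sup>2))"
        by (simp add: prod_inversef inverse_eq_divide prod_dividef)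
      ultimately show "norm (1 / (1 + (norm x)\<^sup>2) ^ N) \<le> norm (\<Prod>b\<in>Basis. inverse (1 + (x \<bullet> b)\<^sup>2))"
        by (simp add: abs_le_iff)
    qed
  qed simp
  then have "integrable lborel (\<lambda>x::'a. c * (1 / (1 + (norm x)\<^sup>2) ^ N))"
    by (rule integrable_mult_right)
  then show ?thesis by simp
qed

lemma L2_of_decay:
  fixes h :: "'a::euclidean_space \<Rightarrow> complex"
  assumes "h \<in> borel_measurable borel" "\<And>x. norm (h x) \<le> C / (1 + (norm x)\<^sup>2) ^ DIM('a)"
  shows "h \<in> L2"
proof (rule L2_I[OF assms(1)])
  have sq: "(C / (1 + (norm x)\<^sup>2) ^ DIM('a))\<^sup>2 = C\<^sup>2 / (1 + (norm x)\<^sup>2) ^ (2 * DIM('a))" for x :: 'a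
    by (simp add: power_divide power_mult[symmetric] mult.commute)
  have "(norm (h x))\<^sup>2 \<le> C\<^sup>2 / (1 + (norm x)\<^sup>2) ^ (2 * DIM('a))" for x
    using power_mono[OF assms(2)[of x], of 2] unfolding sq by simp
  then show "integrable lborel (\<lambda>x. (norm (h x))\<^sup>2)"
    by (intro Bochner_Integration.integrable_bound[OF integrable_inverse_1_plus_norm_power[of "2 * DIM('a)" "C\<^sup>2"]])
       (use assms(1) in auto)
qed

section \<open>Schwartz functions and the dilation operator\<close>

lemma schwartz_rapidly_decreasing:
  assumes "\<phi> \<in> schwartz"
  shows "rapidly_decreasing (foldr partial is \<phi>)"
  unfolding rapidly_decreasing_def
proof
  fix k
  have "bounded (range (\<lambda>x. (norm x) ^ k *\<^sub>R foldr partial is \<phi> x))"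
    using assms unfolding schwartz_def by blast
  then obtain C where "\<And>x. norm ((norm x) ^ k *\<^sub>R foldr partial is \<phi> x) \<le> C"
    unfolding bounded_iff by blast
  then show "\<exists>C. \<forall>x. norm x ^ k * norm (foldr partial is \<phi> x) \<le> C"
    by auto
qed

lemma schwartz_continuous:
  assumes "\<phi> \<in> schwartz"
  shows "continuous_on UNIV (foldr partial is \<phi>)"
  using assms unfolding schwartz_def by (auto intro: differentiable_imp_continuous_on)

lemma schwartz_has_derivative:
  assumes "\<phi> \<in> schwartz"
  shows "(\<phi> has_derivative frechet_derivative \<phi> (at x)) (at x)"
proof -
  have "foldr partial [] \<phi> differentiable_on UNIV"
    using assms unfolding schwartz_def by blast
  then have "\<phi> differentiable at x"
    by (simp add: differentiable_on_def)
  then show ?thesis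
    by (simp add: frechet_derivative_works)
qed

lemma dilation_core_partial:
  fixes \<phi> :: "real^'n::finite \<Rightarrow> complex"
  assumes "\<phi> \<in> schwartz"
  shows "\<i> * dilation_core \<phi> x
    = (\<Sum>j\<in>UNIV. complex_of_real (x $ j) * partial j \<phi> x) + complex_of_real (real CARD('n) / 2) * \<phi> x"
proof -
  have "partial j (\<lambda>y. complex_of_real (y $ j) * \<phi> y) x = complex_of_real (x $ j) * partial j \<phi> x + \<phi> x" for j
  proof -
    have "((\<lambda>y. complex_of_real (y $ j)) has_derivative (\<lambda>h. complex_of_real (h $ j))) (at x)"
      by (intro bounded_linear.has_derivative[OF bounded_linear_of_real] bounded_linear_imp_has_derivative bounded_linear_vec_nth)
    from has_derivative_mult[OF this schwartz_has_derivative[OF assms]]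
    show ?thesis
      unfolding partial_def by (subst frechet_derivative_at[symmetric]) (assumption, simp add: axis_def)
  qed
  then show ?thesis
    unfolding dilation_core_def by (simp add: sum.distrib algebra_simps)
qed

text \<open>The form with partial derivatives serves decay and continuity; this form, with the
  derivative in the radial direction, is what the chain rule along a dilation orbit
  produces.\<close>

lemma dilation_core_frechet:
  fixes \<phi> :: "real^'n::finite \<Rightarrow> complex"
  assumes "\<phi> \<in> schwartz"
  shows "\<i> * dilation_core \<phi> x
    = frechet_derivative \<phi> (at x) x + complex_of_real (real CARD('n) / 2) * \<phi> x"
proof -
  have lin: "linear (frechet_derivative \<phi> (at x))"
    using schwartz_has_derivative[OF assms, of x] by (rule has_derivative_linear)
  have "frechet_derivative \<phi> (at x) x = frechet_derivative \<phi> (at x) (\<Sum>j\<in>UNIV. (x $ j) *\<^sub>R axis j 1)"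
    using basis_expansion[of x] by (simp add: scalar_mult_eq_scaleR)
  also have "\<dots> = (\<Sum>j\<in>UNIV. (x $ j) *\<^sub>R partial j \<phi> x)"
    unfolding partial_def by (simp add: linear_sum[OF lin] linear_scale[OF lin])
  finally show ?thesis
    unfolding dilation_core_partial[OF assms] by (simp add: scaleR_conv_of_real)
qed

lemma dilation_core_continuous:
  fixes \<phi> :: "real^'n::finite \<Rightarrow> complex"
  assumes "\<phi> \<in> schwartz"
  shows "continuous_on UNIV (\<lambda>x. \<i> * dilation_core \<phi> x)"
  unfolding dilation_core_partial[OF assms]
  using schwartz_continuous[OF assms, of "[]"] schwartz_continuous[OF assms, of "[_]"]
  by (intro continuous_intros) auto

lemma dilation_core_rapidly_decreasing:
  fixes \<phi> :: "real^'n::finite \<Rightarrow> complex"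
  assumes "\<phi> \<in> schwartz"
  shows "rapidly_decreasing (\<lambda>x. \<i> * dilation_core \<phi> x)"
  unfolding dilation_core_partial[OF assms]
  using schwartz_rapidly_decreasing[OF assms, of "[]"] schwartz_rapidly_decreasing[OF assms, of "[_]"]
  by (intro rapidly_decreasing_add rapidly_decreasing_sum rapidly_decreasing_cmult rapidly_decreasing_coordinate) auto

lemma L2_of_rapidly_decreasing:
  assumes "rapidly_decreasing h" "continuous_on UNIV h"
  shows "h \<in> L2"
proof -
  obtain C where "\<And>x. norm (h x) \<le> C / (1 + (norm x)\<^sup>2) ^ DIM('a)"
    using rapidly_decreasing_bound[OF assms(1)] by blast
  then show ?thesis
    by (intro L2_of_decay borel_measurable_continuous_onI assms(2))
qed

lemma schwartz_L2: "\<phi> \<in> schwartz \<Longrightarrow> \<phi> \<in> L2"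
  using schwartz_rapidly_decreasing[of \<phi> "[]"] schwartz_continuous[of \<phi> "[]"]
  by (auto intro: L2_of_rapidly_decreasing)

lemma dilation_core_L2:
  assumes "\<phi> \<in> schwartz"
  shows "dilation_core \<phi> \<in> L2"
  using L2_cmult[OF L2_of_rapidly_decreasing[OF dilation_core_rapidly_decreasing[OF assms] dilation_core_continuous[OF assms]], of "- \<i>"]
  by (simp add: mult.assoc[symmetric])

section \<open>Difference quotients of the dilation group\<close>

lemma dilate_has_vector_derivative:
  fixes \<phi> :: "real^'n::finite \<Rightarrow> complex"
  assumes "\<phi> \<in> schwartz"
  shows "((\<lambda>s. dilate s \<phi> x) has_vector_derivative dilate s (\<lambda>y. \<i> * dilation_core \<phi> y) x) (at s)"
proof -
  let ?D = "frechet_derivative \<phi> (at (exp s *\<^sub>R x))"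
  let ?n = "real DIM(real^'n)"
  have lin: "linear ?D"
    using schwartz_has_derivative[OF assms] by (rule has_derivative_linear)
  have 1: "((\<lambda>s. exp s *\<^sub>R x) has_derivative (\<lambda>h. (h * exp s) *\<^sub>R x)) (at s)"
    by (auto intro!: derivative_eq_intros)
  have 2: "((\<lambda>s. \<phi> (exp s *\<^sub>R x)) has_derivative (\<lambda>h. ?D ((h * exp s) *\<^sub>R x))) (at s)"
    by (rule has_derivative_compose[OF 1 schwartz_has_derivative[OF assms]])
  have 3: "((\<lambda>s. complex_of_real (exp (?n * s / 2))) has_derivative
      (\<lambda>h. complex_of_real (exp (?n * s / 2) * (?n * h / 2)))) (at s)"
    by (auto intro!: derivative_eq_intros bounded_linear.has_derivative[OF bounded_linear_of_real])
  have M: "((\<lambda>s. complex_of_real (exp (?n * s / 2)) * \<phi> (exp s *\<^sub>R x)) has_derivative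
     (\<lambda>h. complex_of_real (exp (?n * s / 2)) * ?D ((h * exp s) *\<^sub>R x)
        + complex_of_real (exp (?n * s / 2) * (?n * h / 2)) * \<phi> (exp s *\<^sub>R x))) (at s)"
    by (rule has_derivative_mult[OF 3 2])
  have L: "?D ((h * exp s) *\<^sub>R x) = h *\<^sub>R ?D (exp s *\<^sub>R x)" for h
    by (simp add: linear_scale[OF lin, symmetric])
  show ?thesis
    unfolding has_vector_derivative_def dilate_def dilation_core_frechet[OF assms]
    by (rule has_derivative_eq_rhs[OF M[unfolded L]])
       (simp add: fun_eq_iff scaleR_conv_of_real algebra_simps)
qed

text \<open>The quotients are taken along a sequence because \<open>L2_tendsto\<close> speaks of
  sequences; steps in \<open>(0, 1]\<close> only move points outwards, which keeps the dominating
  function simple.\<close>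

definition dil_step :: "nat \<Rightarrow> real" where
  "dil_step k = 1 / real (Suc k)"

lemma dil_step_pos [simp]: "0 < dil_step k" and dil_step_le_1: "dil_step k \<le> 1"
  by (simp_all add: dil_step_def)

lemma dil_step_tendsto: "dil_step \<longlonglongrightarrow> 0"
  unfolding dil_step_def by (rule LIMSEQ_Suc[OF lim_1_over_n])

lemma dil_step_filterlim: "filterlim dil_step (at 0) sequentially"
proof -
  have "dil_step k \<noteq> 0" for k
    using dil_step_pos[of k] by linarith
  then show ?thesis
    using dil_step_tendsto by (auto simp: filterlim_at)
qed

lemma dil_step_quotient:
  assumes "(q has_vector_derivative d) (at (0::real))"
  shows "(\<lambda>k. (q (dil_step k) - q 0) /\<^sub>R dil_step k) \<longlonglongrightarrow> (d :: 'a::real_normed_vector)"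
proof -
  have "((\<lambda>s. (q s - q 0) /\<^sub>R s) \<longlongrightarrow> d) (at 0)"
  proof -
    have "((\<lambda>s. norm ((q s - q 0) - s *\<^sub>R d) / norm s) \<longlongrightarrow> 0) (at 0)"
      using assms unfolding has_vector_derivative_def has_derivative_at by simp
    moreover have "eventually (\<lambda>s. norm ((q s - q 0) - s *\<^sub>R d) / norm s = norm ((q s - q 0) /\<^sub>R s - d)) (at (0::real))"
      unfolding eventually_at_filter
    proof (intro always_eventually allI impI)
      fix s :: real assume "s \<noteq> 0"
      then have "(q s - q 0) /\<^sub>R s - d = ((q s - q 0) - s *\<^sub>R d) /\<^sub>R s"
        by (simp add: scaleR_diff_right)
      then show "norm ((q s - q 0) - s *\<^sub>R d) / norm s = norm ((q s - q 0) /\<^sub>R s - d)"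
        by (simp add: divide_inverse mult.commute)
    qed
    ultimately have "((\<lambda>s. norm ((q s - q 0) /\<^sub>R s - d)) \<longlongrightarrow> 0) (at 0)"
      by (rule Lim_transform_eventually)
    then have "((\<lambda>s. (q s - q 0) /\<^sub>R s - d) \<longlongrightarrow> 0) (at 0)"
      by (rule tendsto_norm_zero_cancel)
    then show ?thesis
      by (rule LIM_zero_cancel)
  qed
  from filterlim_compose[OF this dil_step_filterlim] show ?thesis .
qed

lemma dilate_0 [simp]: "dilate 0 f = f"
  by (simp add: dilate_def fun_eq_iff)

lemma scaleR_inverse_of_real: "z /\<^sub>R r = z / complex_of_real r"
  by (simp add: scaleR_conv_of_real divide_inverse)

text \<open>Schwartz functions lie in the domain of the generator of the group
  \<open>dilate\<close>, which is \<open>i\<close> times \<open>dilation_core\<close> on them. The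
  pointwise limit is the derivative along the orbit; the mean value inequality bounds the quotient
  by the derivatives at intermediate dilations, uniformly in the step.\<close>

lemma schwartz_dilate_quotient:
  fixes \<phi> :: "real^'n::finite \<Rightarrow> complex"
  assumes \<phi>: "\<phi> \<in> schwartz"
  shows "(\<lambda>k. L2sq (\<lambda>x. (dilate (dil_step k) \<phi> x - \<phi> x) / complex_of_real (dil_step k)
    - \<i> * dilation_core \<phi> x)) \<longlonglongrightarrow> 0"
proof -
  let ?q = "\<lambda>k x. (dilate (dil_step k) \<phi> x - \<phi> x) / complex_of_real (dil_step k)"
  let ?E = "\<lambda>x. \<i> * dilation_core \<phi> x" and ?n = "real CARD('n)"
  obtain C where C: "\<And>x. norm (?E x) \<le> C / (1 + (norm x)\<^sup>2) ^ CARD('n)"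
    using rapidly_decreasing_bound[OF dilation_core_rapidly_decreasing[OF \<phi>]] by blast
  have C_nonneg: "0 \<le> C" using order_trans[OF norm_ge_zero C[of 0]] by simp
  \<comment> \<open>For \<open>s\<close> in \<open>[0, 1]\<close> the point \<open>exp s * x\<close>
    is no closer to the origin than \<open>x\<close>, so the decay bound persists;
    \<open>exp (?n / 2)\<close> bounds the normalising factor of \<open>dilate s\<close>.\<close>
  define K where "K = exp (?n / 2) * C"
  have dil_le: "norm (dilate s ?E x) \<le> K / (1 + (norm x)\<^sup>2) ^ CARD('n)" if "0 \<le> s" "s \<le> 1" for s x
  proof -
    have "norm (?E (exp s *\<^sub>R x)) \<le> C / (1 + (norm (exp s *\<^sub>R x))\<^sup>2) ^ CARD('n)"
      by (rule C)
    also have "\<dots> \<le> C / (1 + (norm x)\<^sup>2) ^ CARD('n)"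
    proof (intro divide_left_mono power_mono add_left_mono C_nonneg mult_pos_pos zero_less_power add_pos_nonneg)
      show "norm x \<le> norm (exp s *\<^sub>R x)"
        using mult_right_mono[of 1 "exp s" "norm x"] that by simp
    qed auto
    finally have 1: "norm (?E (exp s *\<^sub>R x)) \<le> C / (1 + (norm x)\<^sup>2) ^ CARD('n)" .
    have 2: "exp (?n * s / 2) \<le> exp (?n / 2)"
      using that by (simp add: mult_left_le)
    have "norm (dilate s ?E x) = exp (?n * s / 2) * norm (?E (exp s *\<^sub>R x))"
      unfolding dilate_def norm_mult[of "complex_of_real _"] by simp
    also have "\<dots> \<le> exp (?n / 2) * (C / (1 + (norm x)\<^sup>2) ^ CARD('n))"
      by (rule mult_mono[OF 2 1]) auto
    finally show ?thesis by (simp add: K_def)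
  qed
  have quot_le: "norm (?q k x)
      \<le> K / (1 + (norm x)\<^sup>2) ^ CARD('n)" for k x
  proof -
    have "norm (dilate (dil_step k) \<phi> x - dilate 0 \<phi> x)
        \<le> K / (1 + (norm x)\<^sup>2) ^ CARD('n) * norm (dil_step k - 0)"
    proof (rule differentiable_bound[where S = "{0..1}" and f' = "\<lambda>s h. h *\<^sub>R dilate s ?E x"])
      fix s :: real assume s: "s \<in> {0..1}"
      show "((\<lambda>s. dilate s \<phi> x) has_derivative (\<lambda>h. h *\<^sub>R dilate s ?E x)) (at s within {0..1})"
        using dilate_has_vector_derivative[OF \<phi>, of x s]
        by (auto simp: has_vector_derivative_def intro: has_derivative_at_withinI)
      show "onorm (\<lambda>h. h *\<^sub>R dilate s ?E x) \<le> K / (1 + (norm x)\<^sup>2) ^ CARD('n)"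
      proof (rule onorm_le)
        fix h :: real
        have "\<bar>h\<bar> * norm (dilate s ?E x) \<le> \<bar>h\<bar> * (K / (1 + (norm x)\<^sup>2) ^ CARD('n))"
          using s by (intro mult_left_mono dil_le) auto
        then show "norm (h *\<^sub>R dilate s ?E x) \<le> K / (1 + (norm x)\<^sup>2) ^ CARD('n) * norm h"
          by (simp add: mult.commute)
      qed
    qed (auto simp: dil_step_le_1 less_imp_le)
    then show ?thesis
      using dil_step_pos[of k] by (simp add: norm_divide pos_divide_le_eq abs_of_pos)
  qed
  have sq: "(2 * K / (1 + (norm x)\<^sup>2) ^ CARD('n))\<^sup>2 = (2 * K)\<^sup>2 / (1 + (norm x)\<^sup>2) ^ (2 * CARD('n))" for x :: "real^'n"
    by (simp add: power_divide power_mult[symmetric] mult.commute)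
  have meas_\<phi>: "\<phi> \<in> borel_measurable borel"
    using schwartz_L2[OF \<phi>] by simp
  have meas_E: "?E \<in> borel_measurable borel"
    by (rule borel_measurable_continuous_onI[OF dilation_core_continuous[OF \<phi>]])
  show ?thesis
  proof (rule L2_dominated_convergence[where w = "\<lambda>x. (2 * K)\<^sup>2 / (1 + (norm x)\<^sup>2) ^ (2 * CARD('n))"])
    show "(\<lambda>x. ?q k x) \<in> borel_measurable borel" for k
      using meas_\<phi> dilate_measurable[OF meas_\<phi>, of "dil_step k"] by measurable
    show "integrable lborel (\<lambda>x::real^'n. (2 * K)\<^sup>2 / (1 + (norm x)\<^sup>2) ^ (2 * CARD('n)))"
      by (rule integrable_inverse_1_plus_norm_power) simp
    show "AE x in lborel. (\<lambda>k. ?q k x) \<longlonglongrightarrow> ?E x"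
    proof (rule AE_I2)
      fix x :: "real^'n"
      from dil_step_quotient[OF dilate_has_vector_derivative[OF \<phi>, of x 0]]
      show "(\<lambda>k. ?q k x) \<longlonglongrightarrow> ?E x"
        by (simp only: dilate_0 scaleR_inverse_of_real)
    qed
    show "AE x in lborel. (norm (?q k x - ?E x))\<^sup>2
        \<le> (2 * K)\<^sup>2 / (1 + (norm x)\<^sup>2) ^ (2 * CARD('n))" for k
    proof (rule AE_I2)
      fix x :: "real^'n"
      have "norm (?q k x - ?E x)
          \<le> K / (1 + (norm x)\<^sup>2) ^ CARD('n) + K / (1 + (norm x)\<^sup>2) ^ CARD('n)"
        using dil_le[of 0 x] by (intro order_trans[OF norm_triangle_ineq4] add_mono quot_le) simp
      also have "\<dots> = 2 * K / (1 + (norm x)\<^sup>2) ^ CARD('n)" by simp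
      finally show "(norm (?q k x - ?E x))\<^sup>2
        \<le> (2 * K)\<^sup>2 / (1 + (norm x)\<^sup>2) ^ (2 * CARD('n))"
        unfolding sq[symmetric] by (rule power_mono) simp
    qed
  qed (rule meas_E)
qed

section \<open>The commutator of a multiplier with the generator\<close>

definition dilation_smooth :: "real \<Rightarrow> ('a::euclidean_space \<Rightarrow> complex) \<Rightarrow> ('a \<Rightarrow> complex) \<Rightarrow> bool" where
  "dilation_smooth B Q D \<longleftrightarrow> Q \<in> borel_measurable borel \<and> D \<in> borel_measurable borel
    \<and> (\<forall>\<xi>. norm (Q \<xi>) \<le> B) \<and> (\<forall>\<xi>. norm (D \<xi>) \<le> B)
    \<and> (\<forall>\<xi> s. norm (Q (exp s *\<^sub>R \<xi>) - Q \<xi>) \<le> B * \<bar>s\<bar>)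
    \<and> (\<forall>\<xi>. ((\<lambda>s. Q (exp s *\<^sub>R \<xi>)) has_vector_derivative D \<xi>) (at 0))"

text \<open>Moves both dilations onto the multiplier, where the difference quotient becomes
  pointwise and needs no regularity of \<open>F\<close> and \<open>G\<close>.\<close>

lemma L2_inner_dilate:
  fixes F G :: "'a::euclidean_space \<Rightarrow> complex"
  assumes F: "F \<in> L2" and G: "G \<in> L2" and Q[measurable]: "Q \<in> borel_measurable borel"
  shows "L2_inner (dilate (- s) F) (\<lambda>\<xi>. Q \<xi> * dilate (- s) G \<xi>)
    = (LINT \<xi>|lborel. cnj (F \<xi>) * (Q (exp s *\<^sub>R \<xi>) * G \<xi>))"
proof -
  have [measurable]: "F \<in> borel_measurable borel" "G \<in> borel_measurable borel"
    using F G by auto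
  let ?n = "real DIM('a)"
  let ?f = "\<lambda>\<xi>. cnj (dilate (- s) F \<xi>) * (Q \<xi> * dilate (- s) G \<xi>)"
  define c where "c = complex_of_real (exp (?n * (- s) / 2))"
  have c: "complex_of_real (exp (?n * s)) * (c * c) = 1"
    unfolding c_def by (simp add: exp_add[symmetric] flip: of_real_mult)
  have "L2_inner (dilate (- s) F) (\<lambda>\<xi>. Q \<xi> * dilate (- s) G \<xi>) = (LINT \<xi>|lborel. ?f \<xi>)"
    by (simp add: L2_inner_def)
  also have "\<dots> = exp (?n * s) *\<^sub>R (LINT \<xi>|lborel. ?f (exp s *\<^sub>R \<xi>))"
    by (rule lborel_integral_exp_scale) measurable
  also have "\<dots> = (LINT \<xi>|lborel. complex_of_real (exp (?n * s)) * ?f (exp s *\<^sub>R \<xi>))"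
    by (simp add: scaleR_conv_of_real)
  also have "\<dots> = (LINT \<xi>|lborel. cnj (F \<xi>) * (Q (exp s *\<^sub>R \<xi>) * G \<xi>))"
  proof (rule Bochner_Integration.integral_cong[OF refl])
    fix \<xi> :: 'a
    have "?f (exp s *\<^sub>R \<xi>) = (c * c) * (cnj (F \<xi>) * (Q (exp s *\<^sub>R \<xi>) * G \<xi>))"
      by (simp add: dilate_def c_def exp_minus)
    then show "complex_of_real (exp (?n * s)) * ?f (exp s *\<^sub>R \<xi>) = cnj (F \<xi>) * (Q (exp s *\<^sub>R \<xi>) * G \<xi>)"
      by (simp only: mult.assoc[symmetric] c) (simp add: c[unfolded mult.assoc[symmetric]])
  qed
  finally show ?thesis .
qed

lemma L2sq_mult_bounded_le:
  assumes f: "f \<in> L2" and b: "b \<in> borel_measurable borel" "\<And>x. norm (b x) \<le> B"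
  shows "L2sq (\<lambda>x. b x * f x) \<le> B\<^sup>2 * L2sq f"
proof -
  have "L2sq (\<lambda>x. b x * f x) \<le> (LINT x|lborel. B\<^sup>2 * (norm (f x))\<^sup>2)"
    unfolding L2sq_def
  proof (rule integral_mono)
    show "integrable lborel (\<lambda>x. (norm (b x * f x))\<^sup>2)"
      by (rule L2_integrable[OF L2_mult_bounded[OF f b]])
    show "integrable lborel (\<lambda>x. B\<^sup>2 * (norm (f x))\<^sup>2)"
      by (intro integrable_mult_right L2_integrable f)
    show "(norm (b x * f x))\<^sup>2 \<le> B\<^sup>2 * (norm (f x))\<^sup>2" for x
      using b(2)[of x] by (auto simp: norm_mult power_mult_distrib intro!: mult_right_mono power_mono)
  qed
  then show ?thesis
    by (simp add: L2sq_def)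
qed

lemma L2sq_mult_bounded_tendsto:
  assumes L2: "\<And>k. \<phi> k \<in> L2" "f \<in> L2" and b: "b \<in> borel_measurable borel" "\<And>x. norm (b x) \<le> B"
    and lim: "L2_tendsto \<phi> f"
  shows "(\<lambda>k. L2sq (\<lambda>x. b x * \<phi> k x - b x * f x)) \<longlonglongrightarrow> 0"
proof (rule L2sq_squeeze)
  show "\<forall>k. L2sq (\<lambda>x. b x * \<phi> k x - b x * f x) \<le> B\<^sup>2 * L2sq (\<lambda>x. \<phi> k x - f x)"
    using L2sq_mult_bounded_le[OF L2_diff[OF L2] b] by (simp add: right_diff_distrib)
  show "(\<lambda>k. B\<^sup>2 * L2sq (\<lambda>x. \<phi> k x - f x)) \<longlonglongrightarrow> B\<^sup>2 * 0"
    by (intro tendsto_intros lim)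
qed simp

text \<open>Plancherel applied to \<open>schwartz_dilate_quotient\<close>; the step is negative
  because the transform reverses dilations.\<close>

lemma fourier_dilate_quotient:
  assumes \<phi>: "\<phi> \<in> schwartz" and \<Phi>: "(\<phi>, \<Phi>) \<in> fourier_L2" and A: "(dilation_core \<phi>, A) \<in> fourier_L2"
  shows "(\<lambda>k. L2sq (\<lambda>\<xi>. (dilate (- dil_step k) \<Phi> \<xi> - \<Phi> \<xi>) / complex_of_real (dil_step k) - \<i> * A \<xi>)) \<longlonglongrightarrow> 0"
proof -
  have "L2sq (\<lambda>\<xi>. (dilate (- dil_step k) \<Phi> \<xi> - \<Phi> \<xi>) / complex_of_real (dil_step k) - \<i> * A \<xi>)
     = L2sq (\<lambda>x. (dilate (dil_step k) \<phi> x - \<phi> x) / complex_of_real (dil_step k) - \<i> * dilation_core \<phi> x)" for k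
  proof -
    let ?c = "1 / complex_of_real (dil_step k)"
    have 1: "(\<lambda>x. ?c * dilate (dil_step k) \<phi> x + (- ?c) * \<phi> x, \<lambda>\<xi>. ?c * dilate (- dil_step k) \<Phi> \<xi> + (- ?c) * \<Phi> \<xi>) \<in> fourier_L2"
      by (rule fourier_L2_linear[OF fourier_L2_dilate[OF \<Phi>] \<Phi>])
    from fourier_L2_linear[OF this A, of 1 "- \<i>"] show ?thesis
      by (auto dest!: fourier_L2_sq simp: diff_divide_distrib)
  qed
  then show ?thesis
    using schwartz_dilate_quotient[OF \<phi>] by simp
qed

lemma L2_dilate_quotient:
  "F \<in> L2 \<Longrightarrow> (\<lambda>\<xi>. (dilate s F \<xi> - F \<xi>) / c) \<in> L2"
  using L2_cmult[OF L2_diff[OF dilate_L2], where c = "1 / c"] by simp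

text \<open>With \<open>U = dilate (- s)\<close>, the derivative at \<open>s = 0\<close> of the
  inner product of \<open>U F\<close> with \<open>Q * U G\<close> is computed twice. The product
  rule gives the right-hand side, since \<open>U F\<close> and \<open>U G\<close> have derivatives
  \<open>i A\<close> and \<open>i B\<close>; moving \<open>U\<close> onto \<open>Q\<close> gives the
  left-hand side. So \<open>D\<close> is the multiplier of \<open>i\<close> times the commutator of
  \<open>Q\<close> with the generator.\<close>

lemma dilation_commutator_schwartz:
  fixes \<phi> \<psi> :: "real^'n::finite \<Rightarrow> complex"
  assumes \<phi>: "\<phi> \<in> schwartz" "(\<phi>, F) \<in> fourier_L2" "(dilation_core \<phi>, A) \<in> fourier_L2"
    and \<psi>: "\<psi> \<in> schwartz" "(\<psi>, G) \<in> fourier_L2" "(dilation_core \<psi>, B) \<in> fourier_L2"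
    and Q: "dilation_smooth C Q D"
  shows "L2_inner F (\<lambda>\<xi>. D \<xi> * G \<xi>)
    = - \<i> * L2_inner A (\<lambda>\<xi>. Q \<xi> * G \<xi>) + \<i> * L2_inner F (\<lambda>\<xi>. Q \<xi> * B \<xi>)"
proof -
  have Qm[measurable]: "Q \<in> borel_measurable borel" and Dm[measurable]: "D \<in> borel_measurable borel"
    and Qb: "\<And>\<xi>. norm (Q \<xi>) \<le> C" and Db: "\<And>\<xi>. norm (D \<xi>) \<le> C"
    and Qlip: "\<And>\<xi> s. norm (Q (exp s *\<^sub>R \<xi>) - Q \<xi>) \<le> C * \<bar>s\<bar>"
    and Qder: "\<And>\<xi>. ((\<lambda>s. Q (exp s *\<^sub>R \<xi>)) has_vector_derivative D \<xi>) (at 0)"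
    using Q unfolding dilation_smooth_def by auto
  have L2: "F \<in> L2" "G \<in> L2" "A \<in> L2" "B \<in> L2"
    using \<phi> \<psi> fourier_L2_D by blast+
  have [measurable]: "F \<in> borel_measurable borel" "G \<in> borel_measurable borel"
    using L2 by auto
  define u where "u k \<xi> = (dilate (- dil_step k) F \<xi> - F \<xi>) / complex_of_real (dil_step k)" for k \<xi>
  define v where "v k \<xi> = (dilate (- dil_step k) G \<xi> - G \<xi>) / complex_of_real (dil_step k)" for k \<xi>
  have u_L2: "u k \<in> L2" and v_L2: "v k \<in> L2" for k
    unfolding u_def v_def by (intro L2_dilate_quotient L2)+
  have u_lim: "(\<lambda>k. L2sq (\<lambda>\<xi>. u k \<xi> - \<i> * A \<xi>)) \<longlonglongrightarrow> 0"
    unfolding u_def by (rule fourier_dilate_quotient[OF \<phi>])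
  have v_lim: "(\<lambda>k. L2sq (\<lambda>\<xi>. v k \<xi> - \<i> * B \<xi>)) \<longlonglongrightarrow> 0"
    unfolding v_def by (rule fourier_dilate_quotient[OF \<psi>])
  let ?G = "\<lambda>k. dilate (- dil_step k) G"
  have G_L2: "?G k \<in> L2" for k by (rule dilate_L2[OF L2(2)])
  \<comment> \<open>Strong continuity of the dilations at \<open>G\<close>, read off from the
    difference quotients: the increment is \<open>dil_step k\<close> times \<open>v k\<close>, and
    \<open>v k\<close> converges.\<close>
  have "(\<lambda>k. (dil_step k)\<^sup>2 * L2sq (v k)) \<longlonglongrightarrow> 0\<^sup>2 * L2sq (\<lambda>\<xi>. \<i> * B \<xi>)"
    by (intro tendsto_intros dil_step_tendsto L2sq_tendsto v_L2 L2_cmult L2 v_lim)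
  moreover have "(dil_step k)\<^sup>2 * L2sq (v k) = L2sq (\<lambda>\<xi>. ?G k \<xi> - G \<xi>)" for k
  proof -
    have "(\<lambda>\<xi>. ?G k \<xi> - G \<xi>) = (\<lambda>\<xi>. complex_of_real (dil_step k) * v k \<xi>)"
      using dil_step_pos[of k] by (simp add: v_def fun_eq_iff)
    then show ?thesis
      by (simp add: L2sq_cmult)
  qed
  ultimately have G_lim: "L2_tendsto ?G G"
    by simp
  \<comment> \<open>The discrete product rule: the first factor varies against the dilated
    \<open>G\<close>, the second against the fixed \<open>F\<close>, so the sum telescopes to one
    difference quotient.\<close>
  define I where "I k = L2_inner (u k) (\<lambda>\<xi>. Q \<xi> * ?G k \<xi>) + L2_inner F (\<lambda>\<xi>. Q \<xi> * v k \<xi>)" for k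
  have QL2: "(\<lambda>\<xi>. Q \<xi> * h \<xi>) \<in> L2" if "h \<in> L2" for h
    by (rule L2_mult_bounded[OF that Qm Qb])
  have const: "(\<lambda>k::nat. L2sq (\<lambda>\<xi>. F \<xi> - F \<xi>)) \<longlonglongrightarrow> 0" by simp
  have "I \<longlonglongrightarrow> L2_inner (\<lambda>\<xi>. \<i> * A \<xi>) (\<lambda>\<xi>. Q \<xi> * G \<xi>) + L2_inner F (\<lambda>\<xi>. Q \<xi> * (\<i> * B \<xi>))"
    unfolding I_def
    by (intro tendsto_add L2_inner_tendsto u_lim const L2sq_mult_bounded_tendsto[OF _ _ Qm Qb] G_lim v_lim
        u_L2 v_L2 G_L2 L2 L2_cmult QL2)
  moreover have "L2_inner F (\<lambda>\<xi>. Q \<xi> * (\<i> * B \<xi>)) = \<i> * L2_inner F (\<lambda>\<xi>. Q \<xi> * B \<xi>)"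
    by (subst L2_inner_cmult_right[symmetric]) (simp add: mult.left_commute)
  ultimately have lim1: "I \<longlonglongrightarrow> - \<i> * L2_inner A (\<lambda>\<xi>. Q \<xi> * G \<xi>) + \<i> * L2_inner F (\<lambda>\<xi>. Q \<xi> * B \<xi>)"
    by (simp add: L2_inner_cmult_left)
  define q where "q k \<xi> = (Q (exp (dil_step k) *\<^sub>R \<xi>) - Q \<xi>) /\<^sub>R dil_step k" for k \<xi>
  have I_eq: "I k = (LINT \<xi>|lborel. cnj (F \<xi>) * (q k \<xi> * G \<xi>))" for k
  proof -
    let ?s = "complex_of_real (dil_step k)"
    have Qs: "(\<lambda>\<xi>. Q (exp (dil_step k) *\<^sub>R \<xi>) * G \<xi>) \<in> L2"
      by (rule L2_mult_bounded[OF L2(2) _ Qb]) measurable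
    have u_eq: "u k = (\<lambda>\<xi>. (1 / ?s) * (dilate (- dil_step k) F \<xi> - F \<xi>))"
      and v_eq: "(\<lambda>\<xi>. Q \<xi> * v k \<xi>) = (\<lambda>\<xi>. (1 / ?s) * (Q \<xi> * ?G k \<xi> - Q \<xi> * G \<xi>))"
      by (auto simp: u_def v_def fun_eq_iff right_diff_distrib diff_divide_distrib)
    have "I k = (1 / ?s) * (L2_inner (dilate (- dil_step k) F) (\<lambda>\<xi>. Q \<xi> * ?G k \<xi>) - L2_inner F (\<lambda>\<xi>. Q \<xi> * G \<xi>))"
      unfolding I_def u_eq v_eq L2_inner_cmult_left L2_inner_cmult_right
      by (subst L2_inner_diff_left L2_inner_diff_right,
          use L2 G_L2 QL2 in \<open>auto intro: dilate_L2\<close>)+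
         (simp add: diff_divide_distrib)
    also have "\<dots> = (1 / ?s) * (L2_inner F (\<lambda>\<xi>. Q (exp (dil_step k) *\<^sub>R \<xi>) * G \<xi> - Q \<xi> * G \<xi>))"
      unfolding L2_inner_dilate[OF L2(1,2) Qm]
      by (subst L2_inner_diff_right[OF L2(1) Qs QL2[OF L2(2)]]) (simp add: L2_inner_def)
    also have "\<dots> = (LINT \<xi>|lborel. cnj (F \<xi>) * (q k \<xi> * G \<xi>))"
      unfolding L2_inner_cmult_right[symmetric] unfolding L2_inner_def q_def
      by (simp add: scaleR_inverse_of_real left_diff_distrib)
    finally show ?thesis .
  qed
  have q_meas[measurable]: "q k \<in> borel_measurable borel" for k
    unfolding q_def by measurable
  have "I \<longlonglongrightarrow> (LINT \<xi>|lborel. cnj (F \<xi>) * (D \<xi> * G \<xi>))"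
    unfolding I_eq
  proof (rule integral_dominated_convergence)
    show "integrable lborel (\<lambda>\<xi>. C * norm (cnj (F \<xi>) * G \<xi>))"
      by (intro integrable_mult_right integrable_norm L2_inner_integrable L2)
    show "AE \<xi> in lborel. (\<lambda>k. cnj (F \<xi>) * (q k \<xi> * G \<xi>)) \<longlonglongrightarrow> cnj (F \<xi>) * (D \<xi> * G \<xi>)"
    proof (rule AE_I2)
      fix \<xi> :: "real^'n"
      have "(\<lambda>k. q k \<xi>) \<longlonglongrightarrow> D \<xi>"
        using dil_step_quotient[OF Qder[of \<xi>]] by (simp add: q_def)
      then show "(\<lambda>k. cnj (F \<xi>) * (q k \<xi> * G \<xi>)) \<longlonglongrightarrow> cnj (F \<xi>) * (D \<xi> * G \<xi>)"
        by (intro tendsto_intros)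
    qed
    show "AE \<xi> in lborel. norm (cnj (F \<xi>) * (q k \<xi> * G \<xi>)) \<le> C * norm (cnj (F \<xi>) * G \<xi>)" for k
    proof (rule AE_I2)
      fix \<xi> :: "real^'n"
      have "norm (q k \<xi>) = norm (Q (exp (dil_step k) *\<^sub>R \<xi>) - Q \<xi>) / dil_step k"
        using dil_step_pos[of k] by (simp add: q_def divide_inverse mult.commute abs_of_pos)
      also have "\<dots> \<le> C"
        using Qlip[of "dil_step k" \<xi>] dil_step_pos[of k] by (simp add: pos_divide_le_eq abs_of_pos)
      finally have "norm (q k \<xi>) \<le> C" .
      from mult_right_mono[OF this, of "norm (cnj (F \<xi>) * G \<xi>)"]
      show "norm (cnj (F \<xi>) * (q k \<xi> * G \<xi>)) \<le> C * norm (cnj (F \<xi>) * G \<xi>)"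
        by (simp add: norm_mult mult_ac)
    qed
  qed measurable
  then have lim2: "I \<longlonglongrightarrow> L2_inner F (\<lambda>\<xi>. D \<xi> * G \<xi>)"
    by (simp add: L2_inner_def)
  show ?thesis
    by (rule LIMSEQ_unique[OF lim2 lim1])
qed

lemma dilation_gen_approx:
  fixes f a :: "real^'n::finite \<Rightarrow> complex"
  assumes fa: "(f, a) \<in> dilation_gen" and F: "(f, F) \<in> fourier_L2" and A: "(a, A) \<in> fourier_L2"
  shows "\<exists>\<phi> \<Phi> \<Psi>. (\<forall>k. \<phi> k \<in> schwartz \<and> (\<phi> k, \<Phi> k) \<in> fourier_L2 \<and> (dilation_core (\<phi> k), \<Psi> k) \<in> fourier_L2)
    \<and> L2_tendsto \<Phi> F \<and> L2_tendsto \<Psi> A"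
proof -
  from fa obtain \<phi> where L2: "f \<in> L2" "a \<in> L2" and \<phi>: "\<And>k. \<phi> k \<in> schwartz"
    and lims: "L2_lim \<phi> f" "L2_lim (\<lambda>k. dilation_core (\<phi> k)) a"
    unfolding dilation_gen_def by auto
  have "\<forall>k. \<exists>\<Phi>. (\<phi> k, \<Phi>) \<in> fourier_L2" "\<forall>k. \<exists>\<Psi>. (dilation_core (\<phi> k), \<Psi>) \<in> fourier_L2"
    by (auto intro!: fourier_L2_exists schwartz_L2 dilation_core_L2 \<phi>)
  then obtain \<Phi> \<Psi> where \<Phi>: "\<And>k. (\<phi> k, \<Phi> k) \<in> fourier_L2" and \<Psi>: "\<And>k. (dilation_core (\<phi> k), \<Psi> k) \<in> fourier_L2"
    by metis
  have "L2_tendsto \<phi> f" "(\<lambda>k. L2sq (\<lambda>x. dilation_core (\<phi> k) x - a x)) \<longlonglongrightarrow> 0"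
    using lims L2 by (simp_all add: L2_lim_iff schwartz_L2 dilation_core_L2 \<phi>)
  then have "L2_tendsto \<Phi> F" "L2_tendsto \<Psi> A"
    by (simp_all add: fourier_L2_diff_sq[OF \<Phi> F] fourier_L2_diff_sq[OF \<Psi> A])
  with \<phi> \<Phi> \<Psi> show ?thesis by blast
qed

text \<open>As \<open>Q\<close> and \<open>D\<close> are bounded, both sides are continuous in
  \<open>F\<close>, \<open>A\<close>, \<open>G\<close>, \<open>B\<close> separately approximated in
  L2, and the closure in \<open>dilation_gen\<close> approximates a function and its image
  simultaneously.\<close>

theorem dilation_commutator:
  fixes f g :: "real^'n::finite \<Rightarrow> complex"
  assumes f: "(f, a) \<in> dilation_gen" "(f, F) \<in> fourier_L2" "(a, A) \<in> fourier_L2"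
    and g: "(g, b) \<in> dilation_gen" "(g, G) \<in> fourier_L2" "(b, B) \<in> fourier_L2"
    and Q: "dilation_smooth C Q D"
  shows "L2_inner F (\<lambda>\<xi>. D \<xi> * G \<xi>)
    = - \<i> * L2_inner A (\<lambda>\<xi>. Q \<xi> * G \<xi>) + \<i> * L2_inner F (\<lambda>\<xi>. Q \<xi> * B \<xi>)"
proof -
  have Qm: "Q \<in> borel_measurable borel" and Dm: "D \<in> borel_measurable borel"
    and Qb: "\<And>\<xi>. norm (Q \<xi>) \<le> C" and Db: "\<And>\<xi>. norm (D \<xi>) \<le> C"
    using Q unfolding dilation_smooth_def by auto
  obtain \<phi> \<Phi> \<Phi>' where \<phi>: "\<And>k. \<phi> k \<in> schwartz" "\<And>k. (\<phi> k, \<Phi> k) \<in> fourier_L2"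
    "\<And>k. (dilation_core (\<phi> k), \<Phi>' k) \<in> fourier_L2"
    and \<phi>_lim: "L2_tendsto \<Phi> F" "L2_tendsto \<Phi>' A"
    using dilation_gen_approx[OF f] by blast
  obtain \<psi> \<Psi> \<Psi>' where \<psi>: "\<And>k. \<psi> k \<in> schwartz" "\<And>k. (\<psi> k, \<Psi> k) \<in> fourier_L2"
    "\<And>k. (dilation_core (\<psi> k), \<Psi>' k) \<in> fourier_L2"
    and \<psi>_lim: "L2_tendsto \<Psi> G" "L2_tendsto \<Psi>' B"
    using dilation_gen_approx[OF g] by blast
  note L2 = fourier_L2_D(2)[OF \<phi>(2)] fourier_L2_D(2)[OF \<phi>(3)] fourier_L2_D(2)[OF \<psi>(2)] fourier_L2_D(2)[OF \<psi>(3)]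
    fourier_L2_D(2)[OF f(2)] fourier_L2_D(2)[OF f(3)] fourier_L2_D(2)[OF g(2)] fourier_L2_D(2)[OF g(3)]
  have "(\<lambda>k. L2_inner (\<Phi> k) (\<lambda>\<xi>. D \<xi> * \<Psi> k \<xi>)) \<longlonglongrightarrow> L2_inner F (\<lambda>\<xi>. D \<xi> * G \<xi>)"
    by (intro L2_inner_tendsto L2sq_mult_bounded_tendsto[OF _ _ Dm Db] L2_mult_bounded[OF _ Dm Db] L2 \<phi>_lim \<psi>_lim)
  moreover have "(\<lambda>k. - \<i> * L2_inner (\<Phi>' k) (\<lambda>\<xi>. Q \<xi> * \<Psi> k \<xi>) + \<i> * L2_inner (\<Phi> k) (\<lambda>\<xi>. Q \<xi> * \<Psi>' k \<xi>))
      \<longlonglongrightarrow> - \<i> * L2_inner A (\<lambda>\<xi>. Q \<xi> * G \<xi>) + \<i> * L2_inner F (\<lambda>\<xi>. Q \<xi> * B \<xi>)"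
    by (intro tendsto_add tendsto_mult tendsto_const L2_inner_tendsto L2sq_mult_bounded_tendsto[OF _ _ Qm Qb]
        L2_mult_bounded[OF _ Qm Qb] L2 \<phi>_lim \<psi>_lim)
  moreover have "L2_inner (\<Phi> k) (\<lambda>\<xi>. D \<xi> * \<Psi> k \<xi>)
    = - \<i> * L2_inner (\<Phi>' k) (\<lambda>\<xi>. Q \<xi> * \<Psi> k \<xi>) + \<i> * L2_inner (\<Phi> k) (\<lambda>\<xi>. Q \<xi> * \<Psi>' k \<xi>)" for k
    by (rule dilation_commutator_schwartz[OF \<phi> \<psi> Q])
  ultimately show ?thesis
    using LIMSEQ_unique by simp
qed

section \<open>Decay of matrix elements\<close>

text \<open>The hypothesis \<open>u_le\<close> compares products at two points because these are
  what the damped double integral contains; the heat kernel being nonnegative, the comparison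
  survives integration. For \<open>P\<close> and \<open>Q\<close> damping only lowers the time
  integrals, so the resulting bound does not depend on \<open>e\<close>.\<close>

lemma time_L2_bound:
  fixes w :: "'m \<Rightarrow> real" and u :: "'m \<Rightarrow> complex" and P Q :: "'m \<Rightarrow> real"
  assumes M: "sigma_finite_measure M"
    and u: "integrable M u" and P: "integrable M P" and Q: "integrable M Q"
    and P_nonneg: "\<And>x. 0 \<le> P x" and Q_nonneg: "\<And>x. 0 \<le> Q x"
    and w[measurable]: "w \<in> borel_measurable M"
    and C: "0 \<le> C" and u_le: "\<And>x y. norm (u x) * norm (u y) \<le> C * (P x * P y + Q x * Q y)"
    and finP: "(\<integral>\<^sup>+ s. ennreal ((norm (LINT x|M. complex_of_real (P x) * cis (s * w x)))\<^sup>2) \<partial>lborel) < \<infinity>"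
    and finQ: "(\<integral>\<^sup>+ s. ennreal ((norm (LINT x|M. complex_of_real (Q x) * cis (s * w x)))\<^sup>2) \<partial>lborel) < \<infinity>"
  shows "(\<integral>\<^sup>+ s. ennreal ((norm (LINT x|M. u x * cis (s * w x)))\<^sup>2) \<partial>lborel) < \<infinity>"
proof -
  interpret M: sigma_finite_measure M by fact
  let ?k = "\<lambda>e p. heat_kernel e (w (fst p) - w (snd p))"
  define tr where "tr v s = (LINT x|M. v x * cis (s * w x))" for v s
  have tr_meas: "tr v \<in> borel_measurable borel" if "integrable M v" for v
  proof -
    have [measurable]: "v \<in> borel_measurable M" using that by simp
    show ?thesis unfolding tr_def by measurable
  qed
  have tr_bound: "norm (tr v s) \<le> (LINT x|M. norm (v x))" for v s
    using integral_norm_bound[of M "\<lambda>x. v x * cis (s * w x)"] by (simp add: tr_def norm_mult)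
  have int_damped: "integrable lborel (\<lambda>s. gaussian e s * (norm (tr v s))\<^sup>2)" if "integrable M v" "e > 0" for v e
    by (rule integrable_gaussian_mult_bounded[OF tr_meas tr_bound]) (use that in auto)
  have damped: "complex_of_real (LINT s|lborel. gaussian e s * (norm (tr v s))\<^sup>2)
      = (LINT p|(M \<Otimes>\<^sub>M M). v (fst p) * cnj (v (snd p)) * ?k e p)"
    if v: "integrable M v" and e: "e > 0" for v e
  proof -
    have "complex_of_real (LINT s|lborel. gaussian e s * (norm (tr v s))\<^sup>2)
        = (LINT s|lborel. complex_of_real (gaussian e s) * (tr v s * cnj (tr v s)))"
      unfolding complex_norm_square[symmetric] of_real_mult[symmetric] by (rule integral_complex_of_real[symmetric])
    also have "\<dots> = (LINT p|(M \<Otimes>\<^sub>M M). v (fst p) * cnj (v (snd p)) * ?k e p)"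
      unfolding tr_def using damped_oscillating_integral[OF M v v w e] by simp
    finally show ?thesis .
  qed
  have int_pair: "integrable (M \<Otimes>\<^sub>M M) (\<lambda>p. R (fst p) * R (snd p) * ?k e p)"
    if R: "integrable M R" and e: "e > 0" for R :: "'m \<Rightarrow> real" and e
  proof -
    have [measurable]: "R \<in> borel_measurable M" using R by simp
    have "integrable (M \<Otimes>\<^sub>M M) (\<lambda>(x, y). R x * R y)"
      by (rule integrable_pair_mult[OF M M R R])
    then have "integrable (M \<Otimes>\<^sub>M M) (\<lambda>p. heat_kernel e (0::real) * (R (fst p) * R (snd p)))"
      by (simp add: case_prod_beta')
    then show ?thesis
    proof (rule Bochner_Integration.integrable_bound)
      have k: "heat_kernel e (z::real) \<le> heat_kernel e (0::real)" for z
        using e by (auto simp: heat_kernel_def intro!: mult_right_le_one_le)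
      show "AE p in M \<Otimes>\<^sub>M M. norm (R (fst p) * R (snd p) * ?k e p)
          \<le> norm (heat_kernel e (0::real) * (R (fst p) * R (snd p)))"
        by (intro AE_I2)
           (auto simp: abs_mult mult.commute[of "heat_kernel e 0"] intro!: mult_left_mono k)
    qed measurable
  qed
  have P': "integrable M (\<lambda>x. complex_of_real (P x))" and Q': "integrable M (\<lambda>x. complex_of_real (Q x))"
    using P Q by auto
  let ?B = "ennreal C * ((\<integral>\<^sup>+ s. ennreal ((norm (tr P s))\<^sup>2) \<partial>lborel) + (\<integral>\<^sup>+ s. ennreal ((norm (tr Q s))\<^sup>2) \<partial>lborel))"
  have "(\<integral>\<^sup>+ s. ennreal ((norm (tr u s))\<^sup>2) \<partial>lborel) \<le> ?B"
  proof (rule nn_integral_le_of_damped[OF tr_meas[OF u]])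
    fix e :: real assume e: "e > 0"
    define I where "I v = (LINT s|lborel. gaussian e s * (norm (tr v s))\<^sup>2)" for v
    have I_eq: "I (\<lambda>x. complex_of_real (R x)) = (LINT p|(M \<Otimes>\<^sub>M M). R (fst p) * R (snd p) * ?k e p)"
      if R: "integrable M R" for R
    proof -
      have R': "integrable M (\<lambda>x. complex_of_real (R x))" using R by simp
      have "complex_of_real (I (\<lambda>x. complex_of_real (R x)))
          = (LINT p|(M \<Otimes>\<^sub>M M). complex_of_real (R (fst p) * R (snd p) * ?k e p))"
        unfolding I_def damped[OF R' e] by simp
      then show ?thesis
        unfolding integral_complex_of_real of_real_eq_iff .
    qed
    have "I u \<le> norm (complex_of_real (I u))"
      by (simp only: norm_of_real abs_ge_self)
    also have "\<dots> \<le> (LINT p|(M \<Otimes>\<^sub>M M). norm (u (fst p) * cnj (u (snd p)) * ?k e p))"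
      unfolding I_def damped[OF u e] by (rule integral_norm_bound)
    also have "\<dots> \<le> (LINT p|(M \<Otimes>\<^sub>M M). C * (P (fst p) * P (snd p) * ?k e p
        + Q (fst p) * Q (snd p) * ?k e p))"
    proof (rule Bochner_Integration.integral_mono_AE')
      show "AE p in M \<Otimes>\<^sub>M M. norm (u (fst p) * cnj (u (snd p)) * ?k e p)
        \<le> C * (P (fst p) * P (snd p) * ?k e p
        + Q (fst p) * Q (snd p) * ?k e p)"
      proof (rule AE_I2)
        fix p
        from mult_right_mono[OF u_le[of "fst p" "snd p"] heat_kernel_nonneg[of e "w (fst p) - w (snd p)"]]
        show "norm (u (fst p) * cnj (u (snd p)) * ?k e p)
        \<le> C * (P (fst p) * P (snd p) * ?k e p
        + Q (fst p) * Q (snd p) * ?k e p)"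
          by (simp add: norm_mult algebra_simps)
      qed
    qed (auto simp: P_nonneg Q_nonneg C intro!: integrable_mult_right Bochner_Integration.integrable_add int_pair P Q e)
    also have "\<dots> = C * (I P + I Q)"
      by (simp add: I_eq P Q int_pair[OF P e] int_pair[OF Q e])
    finally have I_le: "I u \<le> C * (I P + I Q)" .
    have I_nonneg: "0 \<le> I v" for v
      unfolding I_def by simp
    have I_nn: "(\<integral>\<^sup>+ s. ennreal (gaussian e s * (norm (tr v s))\<^sup>2) \<partial>lborel) = ennreal (I v)" if "integrable M v" for v
      unfolding I_def by (rule nn_integral_eq_integral[OF int_damped[OF that e]]) simp
    have I_nn_le: "ennreal (I v) \<le> (\<integral>\<^sup>+ s. ennreal ((norm (tr v s))\<^sup>2) \<partial>lborel)" if "integrable M v" for v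
      unfolding I_nn[OF that, symmetric] using e
      by (intro nn_integral_mono ennreal_leI) (simp add: mult_left_le_one_le gaussian_le_1)
    have "(\<integral>\<^sup>+ s. ennreal (gaussian e s * (norm (tr u s))\<^sup>2) \<partial>lborel) \<le> ennreal (C * (I P + I Q))"
      unfolding I_nn[OF u] by (rule ennreal_leI[OF I_le])
    also have "\<dots> = ennreal C * (ennreal (I P) + ennreal (I Q))"
      using C I_nonneg by (simp add: ennreal_mult' ennreal_plus)
    also have "\<dots> \<le> ?B"
      by (intro mult_left_mono add_mono I_nn_le P' Q') simp
    finally show "(\<integral>\<^sup>+ s. ennreal (gaussian e s * (norm (tr u s))\<^sup>2) \<partial>lborel) \<le> ?B" .
  qed
  also have "?B < \<infinity>"
    using finP finQ unfolding tr_def by (auto simp: ennreal_mult_less_top)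
  finally show ?thesis
    unfolding tr_def .
qed

section \<open>Matrix elements of functions of \<open>H\<close>\<close>

definition dispersion :: "real \<Rightarrow> 'a::euclidean_space \<Rightarrow> real" where
  "dispersion m \<xi> = sqrt ((norm \<xi>)\<^sup>2 + m\<^sup>2)"

lemma dispersion_measurable [measurable]: "dispersion m \<in> borel_measurable borel"
  unfolding dispersion_def by measurable

lemma dispersion_ge: "m \<ge> 0 \<Longrightarrow> m \<le> dispersion m \<xi>"
  unfolding dispersion_def by (intro real_le_rsqrt) simp

lemma dispersion_sq: "(dispersion m \<xi>)\<^sup>2 = (norm \<xi>)\<^sup>2 + m\<^sup>2"
  unfolding dispersion_def by simp

text \<open>The matrix element \<open>\<langle>f, b(H) e\<^sup>i\<^sup>s\<^sup>H g\<rangle>\<close> on the Fourier side.\<close>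

definition osc :: "real \<Rightarrow> (real \<Rightarrow> real) \<Rightarrow> ('a::euclidean_space \<Rightarrow> complex) \<Rightarrow> ('a \<Rightarrow> complex) \<Rightarrow> real \<Rightarrow> complex" where
  "osc m b F G s = (LINT \<xi>|lborel. (cnj (F \<xi>) * (complex_of_real (b (dispersion m \<xi>)) * G \<xi>)) * cis (s * dispersion m \<xi>))"

text \<open>Finiteness of the bracket expressed through the transform, with the square roots
  removed.\<close>

definition osc_L2 :: "real \<Rightarrow> ('a::euclidean_space \<Rightarrow> complex) \<Rightarrow> bool" where
  "osc_L2 m F \<longleftrightarrow> (\<integral>\<^sup>+ s. ennreal ((norm (osc m (\<lambda>_. 1) F F s))\<^sup>2) \<partial>lborel) < \<infinity>"

lemma osc_integrable:
  assumes F: "F \<in> L2" and G: "G \<in> L2" and m: "m > 0"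
    and b: "b \<in> borel_measurable borel" and bound: "\<And>l. l \<ge> m \<Longrightarrow> \<bar>b l\<bar> \<le> B"
  shows "integrable lborel (\<lambda>\<xi>. cnj (F \<xi>) * (complex_of_real (b (dispersion m \<xi>)) * G \<xi>))"
proof (intro L2_inner_integrable F L2_mult_bounded[OF G])
  show "(\<lambda>\<xi>. complex_of_real (b (dispersion m \<xi>))) \<in> borel_measurable borel"
    using b by measurable
  show "norm (complex_of_real (b (dispersion m \<xi>))) \<le> B" for \<xi> :: 'a
    using bound[of "dispersion m \<xi>"] dispersion_ge[of m \<xi>] m by simp
qed

lemma osc_measurable:
  assumes [measurable]: "F \<in> borel_measurable borel" "G \<in> borel_measurable borel" "b \<in> borel_measurable borel"
  shows "osc m b F G \<in> borel_measurable borel"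
  unfolding osc_def by measurable

lemma norm_osc_le:
  "norm (osc m b F G s) \<le> (LINT \<xi>|lborel. norm (cnj (F \<xi>) * (complex_of_real (b (dispersion m \<xi>)) * G \<xi>)))"
proof -
  let ?u = "\<lambda>\<xi>. cnj (F \<xi>) * (complex_of_real (b (dispersion m \<xi>)) * G \<xi>)"
  have "norm (osc m b F G s) \<le> (LINT \<xi>|lborel. norm (?u \<xi> * cis (s * dispersion m \<xi>)))"
    unfolding osc_def by (rule integral_norm_bound)
  also have "\<dots> = (LINT \<xi>|lborel. norm (?u \<xi>))"
    by (simp add: norm_mult)
  finally show ?thesis .
qed

text \<open>Reduces negative times to positive ones at the cost of exchanging \<open>F\<close> and
  \<open>G\<close>; this relies on the weight \<open>b\<close> being real.\<close>

lemma osc_uminus: "osc m b F G (- s) = cnj (osc m b G F s)"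
  unfolding osc_def
  by (subst Bochner_Integration.integral_cnj[symmetric]) (simp add: cis_cnj mult_ac)

lemma osc_sq_integrable:
  assumes F: "F \<in> L2" "osc_L2 m F" and G: "G \<in> L2" "osc_L2 m G" and m: "m > 0"
    and b: "b \<in> borel_measurable borel" and bound: "\<And>l. l \<ge> m \<Longrightarrow> \<bar>b l\<bar> \<le> B"
  shows "integrable lborel (\<lambda>s. (norm (osc m b F G s))\<^sup>2)"
proof (rule integrableI_bounded)
  let ?u = "\<lambda>\<xi>. cnj (F \<xi>) * (complex_of_real (b (dispersion m \<xi>)) * G \<xi>)"
  have B: "0 \<le> B" using bound[of m] by simp
  have u_le: "norm (?u \<xi>) \<le> B * (norm (F \<xi>) * norm (G \<xi>))" for \<xi>
    using mult_right_mono[OF bound[of "dispersion m \<xi>"], of "norm (F \<xi>) * norm (G \<xi>)"] dispersion_ge[of m \<xi>] m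
    by (simp add: norm_mult mult_ac)
  have fin: "(\<integral>\<^sup>+ s. ennreal ((norm (LINT \<xi>|lborel. complex_of_real ((norm (h \<xi>))\<^sup>2) * cis (s * dispersion m \<xi>)))\<^sup>2) \<partial>lborel) < \<infinity>"
    if "osc_L2 m h" for h :: "'a \<Rightarrow> complex"
  proof -
    have "cnj (h \<xi>) * (complex_of_real 1 * h \<xi>) = complex_of_real ((norm (h \<xi>))\<^sup>2)" for \<xi>
      by (simp only: complex_norm_square of_real_1 mult_1_left mult.commute)
    then show ?thesis
      using that unfolding osc_L2_def osc_def by (simp only:)
  qed
  have "(\<integral>\<^sup>+ s. ennreal ((norm (osc m b F G s))\<^sup>2) \<partial>lborel) < \<infinity>"
    unfolding osc_def
  proof (rule time_L2_bound[where P = "\<lambda>\<xi>. (norm (F \<xi>))\<^sup>2" and Q = "\<lambda>\<xi>. (norm (G \<xi>))\<^sup>2" and C = "B\<^sup>2"])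
    show "integrable lborel ?u"
      by (rule osc_integrable[OF F(1) G(1) m b bound])
    fix x y
    \<comment> \<open>The grouping matters: pairing \<open>F\<close> at \<open>x\<close> with
      \<open>F\<close> at \<open>y\<close>, and \<open>G\<close> with \<open>G\<close>, before
      splitting is what yields the separated products \<open>P x * P y\<close> and
      \<open>Q x * Q y\<close>.\<close>
    let ?a = "norm (F x) * norm (F y)" and ?b = "norm (G x) * norm (G y)"
    have "norm (?u x) * norm (?u y) \<le> (B * (norm (F x) * norm (G x))) * (B * (norm (F y) * norm (G y)))"
      using B by (intro mult_mono u_le) auto
    also have "\<dots> = B\<^sup>2 * (?a * ?b)"
      by (simp add: power2_eq_square mult_ac)
    also have "\<dots> \<le> B\<^sup>2 * (?a\<^sup>2 + ?b\<^sup>2)"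
      using norm_mult_le_sum_squares[of ?a ?b] by (intro mult_left_mono) (auto simp: abs_mult)
    finally show "norm (?u x) * norm (?u y) \<le> B\<^sup>2 * ((norm (F x))\<^sup>2 * (norm (F y))\<^sup>2 + (norm (G x))\<^sup>2 * (norm (G y))\<^sup>2)"
      by (simp add: power_mult_distrib)
  qed (use F G fin in \<open>auto intro: lborel.sigma_finite_measure_axioms L2_integrable\<close>)
  then show "(\<integral>\<^sup>+ s. ennreal (norm ((norm (osc m b F G s))\<^sup>2)) \<partial>lborel) < \<infinity>"
    by simp
qed (use osc_measurable[of F G b m] F G b in auto)

lemma osc_L2_of_E_space:
  fixes h :: "real^'n::finite \<Rightarrow> complex"
  assumes h: "h \<in> E_space m" and H: "(h, H) \<in> fourier_L2"
  shows "osc_L2 m H"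
proof -
  have eq: "L2_inner h (op_app (exp_itH m t) h) = osc m (\<lambda>_. 1) H H t" for t
  proof -
    have "L2_inner h (op_app (exp_itH m t) h)
        = (LINT \<xi>|lborel. cnj (H \<xi>) * (exp (\<i> * complex_of_real (t * sqrt ((norm \<xi>)\<^sup>2 + m\<^sup>2))) * H \<xi>))"
      unfolding exp_itH_def
      by (rule H_fun_inner[OF H H, where B = 1]) (simp_all flip: cis_conv_exp)
    also have "\<dots> = osc m (\<lambda>_. 1) H H t"
      unfolding osc_def dispersion_def by (simp add: cis_conv_exp mult_ac)
    finally show ?thesis .
  qed
  then show ?thesis
    using h unfolding E_space_def mem_Collect_eq H_bracket_def L2_norm_def enn_sqrt_less_top_iff eq osc_L2_def
    by blast
qed

text \<open>For functions of \<open>H\<close> the generator of \<open>s \<mapsto> Q(e\<^sup>s\<xi>)\<close> acts as \<open>(H - m\<^sup>2/H) d/dH\<close>; the phase below solves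
  \<open>(l - m) p'(l) = e\<^sup>i\<^sup>r\<^sup>(\<^sup>l\<^sup>-\<^sup>m\<^sup>) - e\<^sup>i\<^sup>t\<^sup>(\<^sup>l\<^sup>-\<^sup>m\<^sup>)\<close> while being an average over the times between \<open>t\<close> and \<open>r\<close>.\<close>

definition phase_avg :: "real \<Rightarrow> real \<Rightarrow> real \<Rightarrow> real \<Rightarrow> complex" where
  "phase_avg m t r l = integral {t..r} (\<lambda>s. cis (s * (l - m)) / complex_of_real s)"

lemma cis_has_vector_derivative:
  "((\<lambda>s. cis (s * c)) has_vector_derivative (complex_of_real c * (\<i> * cis (s * c)))) (at s within S)"
  unfolding cis_conv_exp
  by (auto intro!: derivative_eq_intros has_vector_derivative_real_field simp: mult_ac)

lemma phase_avg_integrable: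
  assumes "0 < t"
  shows "continuous_on {t..r} (\<lambda>s. cis (s * (l - m)) / complex_of_real s)"
  using assms by (intro continuous_intros) auto

lemma norm_phase_avg_le:
  assumes "0 < t" "t \<le> r" "r \<le> 2 * t"
  shows "norm (phase_avg m t r l) \<le> 1"
proof -
  have "norm (phase_avg m t r l) \<le> (1 / t) * (r - t)"
    unfolding phase_avg_def
  proof (rule integral_bound)
    show "continuous_on {t..r} (\<lambda>s. cis (s * (l - m)) / complex_of_real s)"
      by (rule phase_avg_integrable[OF assms(1)])
    show "norm (cis (s * (l - m)) / complex_of_real s) \<le> 1 / t" if "s \<in> {t..r}" for s
      using assms that by (simp add: norm_divide frac_le)
  qed (use assms in auto)
  also have "\<dots> \<le> 1"
    using assms by (simp add: field_simps)
  finally show ?thesis .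
qed

text \<open>Differentiating in \<open>l\<close> brings down \<open>i * s\<close>, which cancels the
  weight \<open>1 / s\<close>; the remaining exponential integrates explicitly. At
  \<open>l = m\<close> the derivative is \<open>i * (r - t)\<close>, whereas the quotient in the
  statement would be \<open>0 / 0 = 0\<close>.\<close>

lemma phase_avg_has_vector_derivative:
  assumes t: "0 < t" "t \<le> r" and l: "l \<noteq> m"
  shows "(phase_avg m t r has_vector_derivative
    (cis (r * (l - m)) - cis (t * (l - m))) / complex_of_real (l - m)) (at l)"
proof -
  have "((\<lambda>l. integral (cbox t r) (\<lambda>s. cis (s * (l - m)) / complex_of_real s)) has_vector_derivative
      integral (cbox t r) (\<lambda>s. \<i> * cis (s * (l - m)))) (at l within UNIV)"
  proof (rule leibniz_rule_vector_derivative)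
    fix l s :: real assume s: "s \<in> cbox t r"
    have 1: "((\<lambda>l. l - m) has_vector_derivative 1) (at l)"
      by (auto intro!: derivative_eq_intros)
    have "((\<lambda>l. cis (s * (l - m))) has_vector_derivative (complex_of_real s * (\<i> * cis (s * (l - m))))) (at l within UNIV)"
      using vector_diff_chain_at[OF 1, of "\<lambda>y. cis (y * s)"] cis_has_vector_derivative[of s "l - m" UNIV]
      by (simp add: o_def mult.commute)
    from has_vector_derivative_divide[OF this, of "complex_of_real s"]
    show "((\<lambda>l. cis (s * (l - m)) / complex_of_real s) has_vector_derivative \<i> * cis (s * (l - m))) (at l within UNIV)"
      using s t by simp
  next
    fix l :: real
    show "(\<lambda>s. cis (s * (l - m)) / complex_of_real s) integrable_on cbox t r"
      using phase_avg_integrable[OF t(1), of r l m] integrable_continuous_real by simp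
  next
    show "continuous_on (UNIV \<times> cbox t r) (\<lambda>(l, s). \<i> * cis (s * (l - m)))"
      unfolding case_prod_beta' by (intro continuous_intros)
  qed auto
  moreover have "integral (cbox t r) (\<lambda>s. \<i> * cis (s * (l - m))) = (cis (r * (l - m)) - cis (t * (l - m))) / complex_of_real (l - m)"
  proof -
    have "((\<lambda>s. complex_of_real (l - m) * (\<i> * cis (s * (l - m)))) has_integral (cis (r * (l - m)) - cis (t * (l - m)))) {t..r}"
      by (rule fundamental_theorem_of_calculus[OF t(2)]) (rule cis_has_vector_derivative)
    from has_integral_mult_right[OF this, of "1 / complex_of_real (l - m)"] l
    have "((\<lambda>s. \<i> * cis (s * (l - m))) has_integral (cis (r * (l - m)) - cis (t * (l - m))) / complex_of_real (l - m)) {t..r}"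
      by (simp flip: of_real_diff)
    then show ?thesis
      unfolding cbox_interval by (rule integral_unique)
  qed
  ultimately show ?thesis
    by (simp add: phase_avg_def[abs_def])
qed

text \<open>The gauge integral of the definition suits the Leibniz rule and the fundamental theorem
  of calculus; the Lebesgue form is needed for measurability in \<open>l\<close> and for
  Fubini.\<close>

lemma phase_avg_eq_lebesgue:
  assumes t: "0 < t"
  shows "phase_avg m t r l = (LINT s|lborel. indicator {t..r} s *\<^sub>R (cis (s * (l - m)) / complex_of_real s))"
proof -
  have "set_integrable lborel {t..r} (\<lambda>s. cis (s * (l - m)) / complex_of_real s)"
    by (intro borel_integrable_atLeastAtMost' phase_avg_integrable t)
  from set_borel_integral_eq_integral(2)[OF this] show ?thesis
    by (simp add: phase_avg_def set_lebesgue_integral_def)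
qed

lemma phase_avg_measurable:
  assumes "0 < t"
  shows "phase_avg m t r \<in> borel_measurable borel"
  unfolding phase_avg_eq_lebesgue[OF assms, abs_def] by measurable

text \<open>The source of the rate. By Fubini the left-hand side is the integral of a matrix element
  over \<open>[t, r]\<close> against \<open>ds / s\<close>; square-integrability in time, with
  \<open>1 / s\<close> of order \<open>1 / t\<close> on an interval of length at most
  \<open>t\<close>, leaves \<open>t^(-1/2)\<close>.\<close>

lemma norm_integral_phase_avg_le:
  fixes F G :: "'a::euclidean_space \<Rightarrow> complex"
  assumes F: "F \<in> L2" "osc_L2 m F" and G: "G \<in> L2" "osc_L2 m G" and m: "m > 0"
    and b: "b \<in> borel_measurable borel" and bound: "\<And>l. l \<ge> m \<Longrightarrow> \<bar>b l\<bar> \<le> B"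
    and t: "0 < t" "t \<le> r" "r \<le> 2 * t"
  shows "norm (LINT \<xi>|lborel. cnj (F \<xi>) * ((complex_of_real (b (dispersion m \<xi>)) * phase_avg m t r (dispersion m \<xi>)) * G \<xi>))
    \<le> ((LINT s|lborel. (norm (osc m b F G s))\<^sup>2) + 1) / sqrt t"
proof -
  let ?P = "\<lambda>\<xi>. cnj (F \<xi>) * ((complex_of_real (b (dispersion m \<xi>)) * phase_avg m t r (dispersion m \<xi>)) * G \<xi>)"
  let ?N = "LINT s|lborel. (norm (osc m b F G s))\<^sup>2"
  define u where "u \<xi> = cnj (F \<xi>) * (complex_of_real (b (dispersion m \<xi>)) * G \<xi>)" for \<xi>
  define J where "J \<xi> s = u \<xi> * (indicator {t..r} s *\<^sub>R (cis (s * (dispersion m \<xi> - m)) / complex_of_real s))" for \<xi> s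
  define X where "X s = indicator {t..r} s *\<^sub>R (cis (- (s * m)) / complex_of_real s * osc m b F G s)" for s
  have u: "integrable lborel u"
    unfolding u_def by (rule osc_integrable[OF F(1) G(1) m b bound])
  have [measurable]: "u \<in> borel_measurable borel" using u by auto
  have sq: "integrable lborel (\<lambda>s. (norm (osc m b F G s))\<^sup>2)"
    by (rule osc_sq_integrable[OF F G m b bound])
  have ind: "integrable lborel (\<lambda>s. c * indicator {t..r} s :: real)" for c
    by (intro integrable_mult_right integrable_real_indicator) (use t in \<open>auto simp: emeasure_lborel_Icc_eq\<close>)
  have "integrable (lborel \<Otimes>\<^sub>M lborel) (\<lambda>(\<xi>, s). u \<xi> * complex_of_real (1 / t * indicator {t..r} s))"
    by (intro integrable_pair_mult lborel.sigma_finite_measure_axioms u integrable_of_real ind)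
  then have int_J: "integrable (lborel \<Otimes>\<^sub>M lborel) (\<lambda>(\<xi>, s). J \<xi> s)"
  proof (rule Bochner_Integration.integrable_bound)
    show "(\<lambda>(\<xi>, s). J \<xi> s) \<in> borel_measurable (lborel \<Otimes>\<^sub>M lborel)"
      unfolding J_def by measurable
    have "norm (J \<xi> s) \<le> norm (u \<xi> * complex_of_real (1 / t * indicator {t..r} s))" for \<xi> s
    proof (cases "s \<in> {t..r}")
      case True
      then have "norm (u \<xi>) * (1 / s) \<le> norm (u \<xi>) * (1 / t)"
        using t by (intro mult_left_mono divide_left_mono) auto
      then show ?thesis
        using True t by (simp add: J_def norm_mult norm_divide)
    qed (simp add: J_def)
    then show "AE p in lborel \<Otimes>\<^sub>M lborel. norm (case p of (\<xi>, s) \<Rightarrow> J \<xi> s)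
        \<le> norm (case p of (\<xi>, s) \<Rightarrow> u \<xi> * complex_of_real (1 / t * indicator {t..r} s))"
      by (auto simp: case_prod_beta')
  qed
  have "(LINT \<xi>|lborel. ?P \<xi>)
      = (LINT \<xi>|lborel. LINT s|lborel. J \<xi> s)"
  proof (rule Bochner_Integration.integral_cong[OF refl])
    fix \<xi> :: 'a
    show "?P \<xi>
        = (LINT s|lborel. J \<xi> s)"
      unfolding J_def integral_mult_right_zero phase_avg_eq_lebesgue[OF t(1)] u_def by (simp only: mult_ac)
  qed
  also have "\<dots> = (LINT s|lborel. LINT \<xi>|lborel. J \<xi> s)"
    by (rule lborel_pair.Fubini_integral[symmetric, OF int_J])
  also have "\<dots> = (LINT s|lborel. X s)"
  proof (rule Bochner_Integration.integral_cong[OF refl])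
    fix s :: real
    have "J \<xi> s = (indicator {t..r} s *\<^sub>R (cis (- (s * m)) / complex_of_real s)) * (u \<xi> * cis (s * dispersion m \<xi>))" for \<xi>
    proof -
      have "cis (s * (dispersion m \<xi> - m)) = cis (- (s * m)) * cis (s * dispersion m \<xi>)"
        by (simp add: cis_mult algebra_simps)
      then show ?thesis
        by (simp add: J_def mult_ac)
    qed
    then have "(LINT \<xi>|lborel. J \<xi> s) = (indicator {t..r} s *\<^sub>R (cis (- (s * m)) / complex_of_real s)) * osc m b F G s"
      by (simp add: osc_def u_def)
    then show "(LINT \<xi>|lborel. J \<xi> s) = X s"
      by (simp add: X_def)
  qed
  finally have eq: "(LINT \<xi>|lborel. ?P \<xi>)
      = (LINT s|lborel. X s)" .
  \<comment> \<open>For a value \<open>y\<close> of the norm of the matrix element,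
    \<open>y / t\<close> is \<open>(y * sqrt t) / (t * sqrt t)\<close>, and
    \<open>y * sqrt t \<le> y^2 * t + 1\<close>. This weighting gives both terms the order
    \<open>1 / sqrt t\<close> after integration.\<close>
  define Y where "Y s = 1 / sqrt t * (norm (osc m b F G s))\<^sup>2 + 1 / (t * sqrt t) * indicator {t..r} s" for s
  have Y: "integrable lborel Y"
    unfolding Y_def by (intro Bochner_Integration.integrable_add integrable_mult_right sq ind)
  have XY: "norm (X s) \<le> Y s" for s
  proof (cases "s \<in> {t..r}")
    case True
    define y where "y = norm (osc m b F G s)"
    have "norm (X s) = y / s"
      using True t by (simp add: X_def y_def norm_mult norm_divide)
    also have "\<dots> \<le> y / t"
      using True t by (intro divide_left_mono) (auto simp: y_def)
    also have "\<dots> = (y * sqrt t) / (t * sqrt t)"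
      using t by simp
    also have "\<dots> \<le> ((y * sqrt t)\<^sup>2 + 1) / (t * sqrt t)"
      using norm_mult_le_sum_squares[of "y * sqrt t" 1] t by (intro divide_right_mono) auto
    also have "\<dots> = 1 / sqrt t * y\<^sup>2 + 1 / (t * sqrt t)"
      using t by (simp add: power_mult_distrib add_divide_distrib)
    finally show ?thesis
      using True by (simp add: Y_def y_def)
  next
    case False
    then show ?thesis using t by (simp add: X_def Y_def)
  qed
  have X: "integrable lborel X"
  proof (rule Bochner_Integration.integrable_bound[OF Y])
    show "X \<in> borel_measurable lborel"
      unfolding X_def using osc_measurable[of F G b m] F G b by simp
    show "AE s in lborel. norm (X s) \<le> norm (Y s)"
      unfolding real_norm_def by (intro AE_I2 order_trans[OF XY abs_ge_self])
  qed
  have "norm (LINT s|lborel. X s) \<le> (LINT s|lborel. Y s)"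
    by (rule Bochner_Integration.integral_norm_bound_integral[OF X Y XY])
  also have "\<dots> = 1 / sqrt t * ?N + 1 / (t * sqrt t) * (r - t)"
    unfolding Y_def using t by (subst Bochner_Integration.integral_add[OF integrable_mult_right[OF sq] ind]) simp
  also have "\<dots> \<le> 1 / sqrt t * ?N + 1 / sqrt t"
  proof -
    have "1 / (t * sqrt t) * (r - t) \<le> 1 / (t * sqrt t) * t"
      using t by (intro mult_left_mono) auto
    then show ?thesis using t by simp
  qed
  finally show ?thesis
    unfolding eq by (simp add: add_divide_distrib)
qed

text \<open>By the group property the derivative at any point of an orbit is again a value of
  \<open>D\<close>, so the bound on \<open>D\<close> is also the Lipschitz constant.\<close>

lemma dilation_smoothI:
  fixes Q D :: "'a::euclidean_space \<Rightarrow> complex"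
  assumes "Q \<in> borel_measurable borel" "D \<in> borel_measurable borel"
    and "\<And>\<xi>. norm (Q \<xi>) \<le> B" and D: "\<And>\<xi>. norm (D \<xi>) \<le> B"
    and der: "\<And>\<xi> s. ((\<lambda>s. Q (exp s *\<^sub>R \<xi>)) has_vector_derivative D (exp s *\<^sub>R \<xi>)) (at s)"
  shows "dilation_smooth B Q D"
proof -
  have "norm (Q (exp s *\<^sub>R \<xi>) - Q \<xi>) \<le> B * \<bar>s\<bar>" for \<xi> s
  proof -
    have "norm (Q (exp s *\<^sub>R \<xi>) - Q (exp 0 *\<^sub>R \<xi>)) \<le> B * norm (s - 0)"
    proof (rule differentiable_bound[where S = UNIV and f' = "\<lambda>s h. h *\<^sub>R D (exp s *\<^sub>R \<xi>)"])
      show "((\<lambda>s. Q (exp s *\<^sub>R \<xi>)) has_derivative (\<lambda>h. h *\<^sub>R D (exp s *\<^sub>R \<xi>))) (at s within UNIV)" for s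
        using der[of \<xi> s] by (simp add: has_vector_derivative_def)
      show "onorm (\<lambda>h. h *\<^sub>R D (exp s *\<^sub>R \<xi>)) \<le> B" for s
      proof (rule onorm_le)
        fix h :: real
        show "norm (h *\<^sub>R D (exp s *\<^sub>R \<xi>)) \<le> B * norm h"
          using mult_left_mono[OF D[of "exp s *\<^sub>R \<xi>"], of "\<bar>h\<bar>"] by (simp add: mult.commute)
      qed
    qed auto
    then show ?thesis by simp
  qed
  moreover have "((\<lambda>s. Q (exp s *\<^sub>R \<xi>)) has_vector_derivative D \<xi>) (at 0)" for \<xi>
    using der[of \<xi> 0] by simp
  ultimately show ?thesis
    using assms unfolding dilation_smooth_def by blast
qed

text \<open>The right-hand side is the symbol of \<open>i[H, A] = H - m^2/H\<close> at the dilated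
  point.\<close>

lemma dispersion_dilate_derivative:
  assumes m: "m > 0"
  shows "((\<lambda>s. dispersion m (exp s *\<^sub>R \<xi>)) has_real_derivative
    ((dispersion m (exp s *\<^sub>R \<xi>))\<^sup>2 - m\<^sup>2) / dispersion m (exp s *\<^sub>R \<xi>)) (at s)"
proof -
  have pos: "(exp s * norm \<xi>)\<^sup>2 + m\<^sup>2 > 0"
    using m by (intro add_nonneg_pos) auto
  have "((\<lambda>s. sqrt ((exp s * norm \<xi>)\<^sup>2 + m\<^sup>2)) has_real_derivative
      (exp s * norm \<xi>)\<^sup>2 / sqrt ((exp s * norm \<xi>)\<^sup>2 + m\<^sup>2)) (at s)"
    using pos by (auto intro!: derivative_eq_intros simp: power2_eq_square field_simps)
  then show ?thesis
    using pos by (simp add: dispersion_def)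
qed

text \<open>The product rule along an orbit. In the second term the factor
  \<open>(l^2 - m^2) / l\<close> from the dispersion meets \<open>1 / (l - m)\<close> from
  \<open>phase_avg\<close>, and the quotient \<open>(l + m) / l\<close> is bounded by 2 for
  \<open>l \<ge> m\<close>.\<close>

lemma dilation_smooth_phase_avg:
  fixes \<gamma> \<gamma>' :: "real \<Rightarrow> real"
  assumes m: "m > 0" and t: "0 < t" "t \<le> r" "r \<le> 2 * t"
    and meas[measurable]: "\<gamma> \<in> borel_measurable borel" "\<gamma>' \<in> borel_measurable borel"
    and der: "\<And>l. l \<ge> m \<Longrightarrow> (\<gamma> has_real_derivative \<gamma>' l) (at l)"
    and \<gamma>: "\<And>l. l \<ge> m \<Longrightarrow> \<bar>\<gamma> l\<bar> \<le> B" and \<gamma>': "\<And>l. l \<ge> m \<Longrightarrow> \<bar>\<gamma>' l * ((l\<^sup>2 - m\<^sup>2) / l)\<bar> \<le> B"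
  shows "dilation_smooth (5 * B)
    (\<lambda>\<xi>::'a::euclidean_space. complex_of_real (\<gamma> (dispersion m \<xi>)) * phase_avg m t r (dispersion m \<xi>))
    (\<lambda>\<xi>. complex_of_real (\<gamma>' (dispersion m \<xi>) * (((dispersion m \<xi>)\<^sup>2 - m\<^sup>2) / dispersion m \<xi>)) * phase_avg m t r (dispersion m \<xi>)
      + complex_of_real (\<gamma> (dispersion m \<xi>) * ((dispersion m \<xi> + m) / dispersion m \<xi>))
        * (cis (r * (dispersion m \<xi> - m)) - cis (t * (dispersion m \<xi> - m))))"
    (is "dilation_smooth _ ?Q ?D")
proof (rule dilation_smoothI)
  have B: "0 \<le> B" using \<gamma>[of m] by simp
  have [measurable]: "phase_avg m t r \<in> borel_measurable borel"
    by (rule phase_avg_measurable[OF t(1)])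
  show "?Q \<in> borel_measurable borel" "?D \<in> borel_measurable borel"
    by measurable
  fix \<xi> :: 'a
  let ?l = "dispersion m \<xi>"
  have l: "m \<le> ?l" using dispersion_ge[of m \<xi>] m by simp
  have p: "norm (phase_avg m t r ?l) \<le> 1"
    by (rule norm_phase_avg_le[OF t])
  have "norm (?Q \<xi>) \<le> B * 1"
    unfolding norm_mult norm_of_real using B by (intro mult_mono \<gamma> l p) auto
  then show "norm (?Q \<xi>) \<le> 5 * B" using B by simp
  \<comment> \<open>The factor 5 is 1 for the first term plus 4 for the second: 2 from
    \<open>(l + m) / l\<close> and 2 from the difference of two phases.\<close>
  have "norm (?D \<xi>) \<le> B * 1 + (B * 2) * 2"
  proof (intro order_trans[OF norm_triangle_ineq] add_mono)
    show "norm (complex_of_real (\<gamma>' ?l * ((?l\<^sup>2 - m\<^sup>2) / ?l)) * phase_avg m t r ?l) \<le> B * 1"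
      unfolding norm_mult[of "complex_of_real _"] norm_of_real using B by (intro mult_mono \<gamma>' l p) auto
    have "\<bar>(?l + m) / ?l\<bar> \<le> 2"
      using l m by (simp add: field_simps)
    then have "\<bar>\<gamma> ?l * ((?l + m) / ?l)\<bar> \<le> B * 2"
      unfolding abs_mult using B by (intro mult_mono \<gamma> l) auto
    moreover have "norm (cis (r * (?l - m)) - cis (t * (?l - m))) \<le> 2"
      using norm_triangle_ineq4[of "cis (r * (?l - m))" "cis (t * (?l - m))"] by simp
    ultimately show "norm (complex_of_real (\<gamma> ?l * ((?l + m) / ?l)) * (cis (r * (?l - m)) - cis (t * (?l - m)))) \<le> (B * 2) * 2"
      unfolding norm_mult[of "complex_of_real _"] norm_of_real using B by (intro mult_mono) auto
  qed
  then show "norm (?D \<xi>) \<le> 5 * B" by simp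
  fix s :: real
  show "((\<lambda>s. ?Q (exp s *\<^sub>R \<xi>)) has_vector_derivative ?D (exp s *\<^sub>R \<xi>)) (at s)"
  \<comment> \<open>At the origin the orbit is constant and both terms of \<open>?D\<close> vanish;
    elsewhere the dispersion stays above \<open>m\<close>, as the derivative of
    \<open>phase_avg\<close> requires.\<close>
  proof (cases "\<xi> = 0")
    case True
    then show ?thesis
      using m by (simp add: dispersion_def)
  next
    case False
    define W where "W s = dispersion m (exp s *\<^sub>R \<xi>)" for s
    have W_sq: "(W s)\<^sup>2 > m\<^sup>2"
      using False by (simp add: W_def dispersion_sq)
    have W_ge: "W s \<ge> m" using dispersion_ge[of m] m by (simp add: W_def)
    with W_sq have W_neq: "W s \<noteq> m" by auto
    have W': "(W has_real_derivative ((W s)\<^sup>2 - m\<^sup>2) / W s) (at s)"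
      unfolding W_def by (rule dispersion_dilate_derivative[OF m])
    then have W'v: "(W has_vector_derivative ((W s)\<^sup>2 - m\<^sup>2) / W s) (at s)"
      by (simp add: has_real_derivative_iff_has_vector_derivative)
    have "((\<lambda>s. \<gamma> (W s)) has_real_derivative \<gamma>' (W s) * (((W s)\<^sup>2 - m\<^sup>2) / W s)) (at s)"
      by (rule DERIV_chain2[OF der[OF W_ge] W'])
    then have 1: "((\<lambda>s. complex_of_real (\<gamma> (W s))) has_vector_derivative complex_of_real (\<gamma>' (W s) * (((W s)\<^sup>2 - m\<^sup>2) / W s))) (at s)"
      by (intro has_vector_derivative_of_real) (simp add: has_real_derivative_iff_has_vector_derivative)
    let ?c = "cis (r * (W s - m)) - cis (t * (W s - m))"
    have 2: "((\<lambda>s. phase_avg m t r (W s)) has_vector_derivative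
        (((W s)\<^sup>2 - m\<^sup>2) / W s) *\<^sub>R (?c / complex_of_real (W s - m))) (at s)"
      using vector_diff_chain_at[OF W'v phase_avg_has_vector_derivative[OF t(1,2) W_neq]] by (simp add: o_def)
    have 3: "(((W s)\<^sup>2 - m\<^sup>2) / W s) *\<^sub>R (?c / complex_of_real (W s - m)) = complex_of_real ((W s + m) / W s) * ?c"
    proof -
      have "((W s)\<^sup>2 - m\<^sup>2) / W s = (W s + m) / W s * (W s - m)"
        by (simp add: power2_eq_square algebra_simps diff_divide_distrib add_divide_distrib)
      then have "(((W s)\<^sup>2 - m\<^sup>2) / W s) *\<^sub>R (?c / complex_of_real (W s - m))
          = complex_of_real ((W s + m) / W s) * (complex_of_real (W s - m) * (?c / complex_of_real (W s - m)))"
        unfolding scaleR_conv_of_real by (simp only: of_real_mult mult.assoc)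
      also have "complex_of_real (W s - m) * (?c / complex_of_real (W s - m)) = ?c"
        using W_neq by (simp only: times_divide_eq_right nonzero_mult_div_cancel_left of_real_eq_0_iff right_minus_eq not_False_eq_True)
      finally show ?thesis .
    qed
    have "((\<lambda>s. complex_of_real (\<gamma> (W s)) * phase_avg m t r (W s)) has_vector_derivative
        complex_of_real (\<gamma>' (W s) * (((W s)\<^sup>2 - m\<^sup>2) / W s)) * phase_avg m t r (W s)
        + complex_of_real (\<gamma> (W s) * ((W s + m) / W s)) * ?c) (at s)"
      by (rule has_vector_derivative_eq_rhs[OF has_vector_derivative_mult[OF 1 2[unfolded 3]]])
         (simp only: of_real_mult mult.assoc add.commute)
    then show ?thesis
      unfolding W_def .
  qed
qed

text \<open>Square-integrability bounds the mean of \<open>\<eta>\<close> over \<open>{t..2 * t}\<close> by \<open>t\<^sup>-\<^sup>1\<^sup>/\<^sup>2\<close>, and \<open>\<eta> t\<close> is compared with that mean.\<close>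

lemma average_decay:
  fixes N :: real and \<eta> :: "real \<Rightarrow> complex"
  assumes meas[measurable]: "\<eta> \<in> borel_measurable borel" and sq: "integrable lborel (\<lambda>s. (norm (\<eta> s))\<^sup>2)"
    and bdd: "\<And>s. norm (\<eta> s) \<le> M" and t: "0 < t"
    and diff: "\<And>r. t \<le> r \<Longrightarrow> r \<le> 2 * t \<Longrightarrow> norm (\<eta> r - \<eta> t) \<le> K / sqrt t"
  shows "norm (\<eta> t) \<le> ((LINT s|lborel. (norm (\<eta> s))\<^sup>2) + 1 + K) / sqrt t"
proof -
  let ?I = "indicator {t..2 * t} :: real \<Rightarrow> real"
  have ind: "integrable lborel (\<lambda>s. c * ?I s)" for c
    by (intro integrable_mult_right integrable_real_indicator) (use t in \<open>auto simp: emeasure_lborel_Icc_eq\<close>)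
  have int_ind: "(LINT s|lborel. c * ?I s) = c * t" for c
    using t by simp
  \<comment> \<open>From \<open>y \<le> sqrt t * y^2 + 1 / sqrt t\<close> for
    \<open>y = norm (\<eta> s)\<close>. Integrating over an interval of length \<open>t\<close> and
    dividing by \<open>t\<close> gives every term the order \<open>1 / sqrt t\<close>.\<close>
  have "norm (\<eta> t) * ?I s \<le> sqrt t * (norm (\<eta> s))\<^sup>2 + (1 / sqrt t + K / sqrt t) * ?I s" for s
  proof (cases "s \<in> {t..2 * t}")
    case True
    have "norm (\<eta> t) \<le> norm (\<eta> s) + norm (\<eta> s - \<eta> t)"
      using norm_triangle_ineq4[of "\<eta> s" "\<eta> s - \<eta> t"] by simp
    also have "norm (\<eta> s - \<eta> t) \<le> K / sqrt t"
      using diff[of s] True by simp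
    also have "norm (\<eta> s) \<le> sqrt t * (norm (\<eta> s))\<^sup>2 + 1 / sqrt t"
    proof -
      have "norm (\<eta> s) = (norm (\<eta> s) * sqrt t) / sqrt t"
        using t by simp
      also have "\<dots> \<le> ((norm (\<eta> s) * sqrt t)\<^sup>2 + 1) / sqrt t"
        using norm_mult_le_sum_squares[of "norm (\<eta> s) * sqrt t" 1] t by (intro divide_right_mono) auto
      also have "\<dots> = sqrt t * (norm (\<eta> s))\<^sup>2 + 1 / sqrt t"
        using t by (simp add: power_mult_distrib add_divide_distrib real_div_sqrt)
          (simp add: field_simps)
      finally show ?thesis .
    qed
    finally show ?thesis using True by simp
  qed (use t in simp)
  then have "(LINT s|lborel. norm (\<eta> t) * ?I s)
      \<le> (LINT s|lborel. sqrt t * (norm (\<eta> s))\<^sup>2 + (1 / sqrt t + K / sqrt t) * ?I s)"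
    by (intro integral_mono Bochner_Integration.integrable_add integrable_mult_right sq ind)
  also have "\<dots> = sqrt t * (LINT s|lborel. (norm (\<eta> s))\<^sup>2) + (1 / sqrt t + K / sqrt t) * t"
    unfolding Bochner_Integration.integral_add[OF integrable_mult_right[OF sq] ind] int_ind
    unfolding integral_mult_right_zero ..
  finally have "norm (\<eta> t) * t \<le> sqrt t * (LINT s|lborel. (norm (\<eta> s))\<^sup>2) + (1 / sqrt t + K / sqrt t) * t"
    unfolding int_ind .
  also have "\<dots> = ((LINT s|lborel. (norm (\<eta> s))\<^sup>2) + 1 + K) / sqrt t * t"
    using t by (simp add: field_simps)
  finally have "norm (\<eta> t) * t \<le> ((LINT s|lborel. (norm (\<eta> s))\<^sup>2) + 1 + K) / sqrt t * t" .
  then show ?thesis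
    using t by (rule mult_right_le_imp_le)
qed

text \<open>The commutator for the multiplier \<open>\<gamma>\<close> times \<open>phase_avg\<close>
  produces \<open>\<eta> r - \<eta> t\<close> with weight \<open>\<beta>\<close>. All remaining
  terms are inner products containing \<open>phase_avg\<close>, including the one in which the
  derivative falls on \<open>\<gamma>\<close>, so \<open>norm_integral_phase_avg_le\<close> covers
  them.\<close>

lemma osc_decay:
  fixes f g :: "real^'n::finite \<Rightarrow> complex" and \<gamma> \<gamma>' :: "real \<Rightarrow> real"
  assumes m: "m > 0"
    and f: "(f, a) \<in> dilation_gen" "(f, F) \<in> fourier_L2" "(a, A) \<in> fourier_L2" "osc_L2 m F" "osc_L2 m A"
    and g: "(g, b) \<in> dilation_gen" "(g, G) \<in> fourier_L2" "(b, E) \<in> fourier_L2" "osc_L2 m G" "osc_L2 m E"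
    and meas[measurable]: "\<gamma> \<in> borel_measurable borel" "\<gamma>' \<in> borel_measurable borel"
    and der: "\<And>l. l \<ge> m \<Longrightarrow> (\<gamma> has_real_derivative \<gamma>' l) (at l)"
    and \<gamma>: "\<And>l. l \<ge> m \<Longrightarrow> \<bar>\<gamma> l\<bar> \<le> B" and \<gamma>': "\<And>l. l \<ge> m \<Longrightarrow> \<bar>\<gamma>' l * ((l\<^sup>2 - m\<^sup>2) / l)\<bar> \<le> B"
    and \<beta>: "\<And>l. l \<ge> m \<Longrightarrow> \<beta> l = \<gamma> l * ((l + m) / l)"
  shows "\<exists>C. \<forall>t>0. norm (osc m \<beta> F G t) \<le> C / sqrt t"
proof -
  \<comment> \<open>\<open>\<beta>\<close> is known only on \<open>[m, \<infinity>)\<close>, where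
    the dispersion takes its values; \<open>\<beta>'\<close> is a Borel function on the whole line
    that agrees with it there.\<close>
  define \<beta>' where "\<beta>' l = \<gamma> l * ((l + m) / l)" for l
  define \<kappa> where "\<kappa> l = \<gamma>' l * ((l\<^sup>2 - m\<^sup>2) / l)" for l
  note L2 = fourier_L2_D(2)[OF f(2)] fourier_L2_D(2)[OF f(3)] fourier_L2_D(2)[OF g(2)] fourier_L2_D(2)[OF g(3)]
  have B: "0 \<le> B" using \<gamma>[of m] by simp
  have meas_\<beta>\<kappa>[measurable]: "\<beta>' \<in> borel_measurable borel" "\<kappa> \<in> borel_measurable borel"
    unfolding \<beta>'_def \<kappa>_def by measurable
  have \<beta>'_bound: "\<bar>\<beta>' l\<bar> \<le> B * 2" if "l \<ge> m" for l
  proof -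
    have "\<bar>(l + m) / l\<bar> \<le> 2"
      using that m by (simp add: field_simps)
    then show ?thesis
      unfolding \<beta>'_def abs_mult using B that by (intro mult_mono \<gamma>) auto
  qed
  have \<kappa>_bound: "\<bar>\<kappa> l\<bar> \<le> B" if "l \<ge> m" for l
    unfolding \<kappa>_def by (rule \<gamma>'[OF that])
  have osc_eq: "osc m \<beta> F G = osc m \<beta>' F G"
  proof -
    have "\<beta> (dispersion m \<xi>) = \<beta>' (dispersion m \<xi>)" for \<xi> :: "real^'n"
      unfolding \<beta>'_def using m by (intro \<beta> dispersion_ge) simp
    then show ?thesis unfolding osc_def by simp
  qed
  define N1 where "N1 = (LINT s|lborel. (norm (osc m \<gamma> A G s))\<^sup>2)"
  define N2 where "N2 = (LINT s|lborel. (norm (osc m \<gamma> F E s))\<^sup>2)"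
  define N3 where "N3 = (LINT s|lborel. (norm (osc m \<kappa> F G s))\<^sup>2)"
  \<comment> \<open>One summand for each term of the commutator identity: generator on
    \<open>f\<close>, generator on \<open>g\<close>, and derivative on
    \<open>\<gamma>\<close>.\<close>
  define K where "K = (N1 + 1) + (N2 + 1) + (N3 + 1)"
  have triangle: "norm (- \<i> * x + \<i> * y - z) \<le> norm x + norm y + norm z" for x y z :: complex
    using norm_triangle_ineq4[of "- \<i> * x + \<i> * y" z] norm_triangle_ineq[of "- \<i> * x" "\<i> * y"]
    by (simp add: norm_mult)
  \<comment> \<open>The shift of \<open>H\<close> by \<open>m\<close> amounts to a scalar phase, so
    the modulus, and with it decay and square-integrability, is that of the unshifted matrix
    element.\<close>
  define \<eta> where "\<eta> s = cis (- (s * m)) * osc m \<beta>' F G s" for s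
  have norm_\<eta>: "norm (\<eta> s) = norm (osc m \<beta>' F G s)" for s
    by (simp add: \<eta>_def norm_mult)
  have diff: "norm (\<eta> r - \<eta> t) \<le> K / sqrt t" if t: "0 < t" "t \<le> r" "r \<le> 2 * t" for t r
  proof -
    let ?p = "\<lambda>\<xi>::real^'n. phase_avg m t r (dispersion m \<xi>)"
    let ?ph = "\<lambda>s \<xi>::real^'n. complex_of_real (\<beta>' (dispersion m \<xi>)) * cis (s * (dispersion m \<xi> - m))"
    let ?Q = "\<lambda>\<xi>::real^'n. complex_of_real (\<gamma> (dispersion m \<xi>)) * ?p \<xi>"
    let ?D1 = "\<lambda>\<xi>::real^'n. complex_of_real (\<kappa> (dispersion m \<xi>)) * ?p \<xi>"
    let ?D2 = "\<lambda>\<xi>::real^'n. complex_of_real (\<beta>' (dispersion m \<xi>))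
      * (cis (r * (dispersion m \<xi> - m)) - cis (t * (dispersion m \<xi> - m)))"
    have [measurable]: "phase_avg m t r \<in> borel_measurable borel"
      by (rule phase_avg_measurable[OF t(1)])
    have ge: "m \<le> dispersion m \<xi>" for \<xi> :: "real^'n"
      using m by (intro dispersion_ge) simp
    have "norm (?D1 \<xi>) \<le> B * 1" for \<xi>
      unfolding norm_mult norm_of_real using B by (intro mult_mono \<kappa>_bound ge norm_phase_avg_le t) auto
    then have D1_L2: "(\<lambda>\<xi>. ?D1 \<xi> * G \<xi>) \<in> L2"
      by (intro L2_mult_bounded[OF L2(3)]) measurable
    have phase_L2: "(\<lambda>\<xi>. ?ph s \<xi> * G \<xi>) \<in> L2" for s
    proof (rule L2_mult_bounded[OF L2(3)])
      show "norm (?ph s \<xi>) \<le> B * 2" for \<xi> :: "real^'n"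
        using \<beta>'_bound[OF ge] by (simp add: norm_mult)
    qed measurable
    have \<eta>_eq: "L2_inner F (\<lambda>\<xi>. ?ph s \<xi> * G \<xi>) = \<eta> s" for s
    proof -
      have "cis (s * (l - m)) = cis (- (s * m)) * cis (s * l)" for l
        by (simp add: cis_mult algebra_simps)
      then show ?thesis
        unfolding \<eta>_def osc_def L2_inner_def integral_mult_right_zero[symmetric]
        by (simp add: mult_ac)
    qed
    have commutator: "L2_inner F (\<lambda>\<xi>. (?D1 \<xi> + ?D2 \<xi>) * G \<xi>)
        = - \<i> * L2_inner A (\<lambda>\<xi>. ?Q \<xi> * G \<xi>) + \<i> * L2_inner F (\<lambda>\<xi>. ?Q \<xi> * E \<xi>)"
      unfolding \<kappa>_def \<beta>'_def
      by (rule dilation_commutator[OF f(1-3) g(1-3) dilation_smooth_phase_avg[OF m t meas der \<gamma> \<gamma>']])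
    have split: "L2_inner F (\<lambda>\<xi>. (?D1 \<xi> + ?D2 \<xi>) * G \<xi>) = L2_inner F (\<lambda>\<xi>. ?D1 \<xi> * G \<xi>) + (\<eta> r - \<eta> t)"
    proof -
      have "(\<lambda>\<xi>. (?D1 \<xi> + ?D2 \<xi>) * G \<xi>) = (\<lambda>\<xi>. ?D1 \<xi> * G \<xi> +
          (?ph r \<xi> * G \<xi>
          - ?ph t \<xi> * G \<xi>))"
        by (simp add: fun_eq_iff algebra_simps)
      then show ?thesis
        by (simp only: L2_inner_add_right[OF L2(1) D1_L2 L2_diff[OF phase_L2 phase_L2]]
            L2_inner_diff_right[OF L2(1) phase_L2 phase_L2] \<eta>_eq)
    qed
    have diff_eq: "\<eta> r - \<eta> t = - \<i> * L2_inner A (\<lambda>\<xi>. ?Q \<xi> * G \<xi>) + \<i> * L2_inner F (\<lambda>\<xi>. ?Q \<xi> * E \<xi>)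
        - L2_inner F (\<lambda>\<xi>. ?D1 \<xi> * G \<xi>)"
      using trans[OF split[symmetric] commutator] by (simp only: eq_diff_eq add.commute)
    have "norm (\<eta> r - \<eta> t) \<le> norm (L2_inner A (\<lambda>\<xi>. ?Q \<xi> * G \<xi>)) + norm (L2_inner F (\<lambda>\<xi>. ?Q \<xi> * E \<xi>))
        + norm (L2_inner F (\<lambda>\<xi>. ?D1 \<xi> * G \<xi>))"
      unfolding diff_eq by (rule triangle)
    also have "\<dots> \<le> (N1 + 1) / sqrt t + (N2 + 1) / sqrt t + (N3 + 1) / sqrt t"
      unfolding N1_def N2_def N3_def L2_inner_def
      by (intro add_mono
          norm_integral_phase_avg_le[OF L2(2) f(5) L2(3) g(4) m meas(1) \<gamma> t]
          norm_integral_phase_avg_le[OF L2(1) f(4) L2(4) g(5) m meas(1) \<gamma> t]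
          norm_integral_phase_avg_le[OF L2(1) f(4) L2(3) g(4) m meas_\<beta>\<kappa>(2) \<kappa>_bound t])
    finally show ?thesis
      by (simp add: K_def add_divide_distrib)
  qed
  have \<eta>_meas: "\<eta> \<in> borel_measurable borel"
    unfolding \<eta>_def using osc_measurable[of F G \<beta>' m] L2 by simp
  have \<eta>_sq: "integrable lborel (\<lambda>s. (norm (\<eta> s))\<^sup>2)"
    unfolding norm_\<eta> by (rule osc_sq_integrable[OF L2(1) f(4) L2(3) g(4) m _ \<beta>'_bound]) measurable
  have \<eta>_bdd: "norm (\<eta> s)
      \<le> (LINT \<xi>|lborel. norm (cnj (F \<xi>) * (complex_of_real (\<beta>' (dispersion m \<xi>)) * G \<xi>)))" for s
    unfolding norm_\<eta> by (rule norm_osc_le)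
  have "norm (osc m \<beta> F G t) \<le> ((LINT s|lborel. (norm (\<eta> s))\<^sup>2) + 1 + K) / sqrt t" if "t > 0" for t
    using average_decay[OF \<eta>_meas \<eta>_sq \<eta>_bdd that diff[OF that]] by (simp only: norm_\<eta> osc_eq)
  then show ?thesis by blast
qed

section \<open>Assembling the estimate for all times\<close>

lemma japanese_bracket_bound:
  fixes h :: "real \<Rightarrow> complex"
  assumes decay: "\<And>t. t \<noteq> 0 \<Longrightarrow> norm (h t) \<le> C / sqrt \<bar>t\<bar>" and bdd: "\<And>t. norm (h t) \<le> M"
  shows "\<exists>C. \<forall>t. norm (h t) \<le> C * japanese_bracket t powr (- 1 / 2)"
proof -
  \<comment> \<open>Since \<open>1 + t^2\<close> is at most twice the larger of 1 and
    \<open>t^2\<close>, the power \<open>-1/4\<close> loses at most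
    \<open>2 powr (- 1 / 4) \<ge> 1 / 2\<close>; the factor 2 makes up for it.\<close>
  define K where "K = 2 * max C M"
  have M: "0 \<le> M" using order_trans[OF norm_ge_zero bdd[of 0]] .
  have "norm (h t) \<le> K * japanese_bracket t powr (- 1 / 2)" for t
  proof -
    define y where "y = japanese_bracket t powr (- 1 / 2)"
    have y: "y = (1 + t\<^sup>2) powr (- 1 / 4)"
      by (simp add: y_def japanese_bracket_def powr_powr)
    have two: "(1 / 2) \<le> (2::real) powr (- 1 / 4)"
      using powr_mono[of "- 1" "- 1 / 4" "2::real"] by (simp add: powr_minus_divide)
    show ?thesis
    proof (cases "\<bar>t\<bar> \<le> 1")
      case True
      then have "1 + t\<^sup>2 \<le> 2"
        by (simp add: abs_square_le_1)
      then have "2 powr (- 1 / 4) \<le> y"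
        unfolding y by (intro powr_mono2') (auto intro: add_pos_nonneg)
      then have "1 / 2 \<le> y" using two by linarith
      then have "K * (1 / 2) \<le> K * y"
        using M by (intro mult_left_mono) (auto simp: K_def)
      then show ?thesis
        using bdd[of t] by (simp add: K_def y_def)
    next
      case False
      then have t: "t \<noteq> 0" "0 < \<bar>t\<bar>" and "1 \<le> t\<^sup>2"
        using one_le_power[of "\<bar>t\<bar>" 2] by auto
      then have "(2 * t\<^sup>2) powr (- 1 / 4) \<le> y"
        unfolding y by (intro powr_mono2') (auto intro: add_pos_nonneg)
      moreover have "(2 * t\<^sup>2) powr (- 1 / 4) = 2 powr (- 1 / 4) * (1 / sqrt \<bar>t\<bar>)"
      proof -
        have "(t\<^sup>2) powr (- 1 / 4) = \<bar>t\<bar> powr (- (1 / 2))"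
          using powr_powr[of "\<bar>t\<bar>" 2 "- 1 / 4"] t by simp
        also have "\<dots> = 1 / sqrt \<bar>t\<bar>"
          using t by (simp add: powr_minus_divide powr_half_sqrt)
        finally show ?thesis
          by (simp add: powr_mult)
      qed
      moreover have "1 / 2 * (1 / sqrt \<bar>t\<bar>) \<le> 2 powr (- 1 / 4) * (1 / sqrt \<bar>t\<bar>)"
        by (intro mult_right_mono two) simp
      ultimately have "K * (1 / 2 * (1 / sqrt \<bar>t\<bar>)) \<le> K * y"
        using M by (intro mult_left_mono) (auto simp: K_def)
      moreover have "norm (h t) \<le> max C M / sqrt \<bar>t\<bar>"
        by (rule order_trans[OF decay[OF t(1)]]) (simp add: divide_right_mono)
      ultimately show ?thesis
        by (simp add: K_def y_def)
    qed
  qed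
  then show ?thesis by blast
qed

lemma psi_eq_osc:
  fixes f g :: "real^'n::finite \<Rightarrow> complex"
  assumes m: "m > 0" and f: "(f, F) \<in> fourier_L2" and g: "(g, G) \<in> fourier_L2"
  shows "psi m f g t = (osc m (\<lambda>_. 1) F F t + osc m (\<lambda>_. 1) F F (- t)) / 2
    + (osc m (\<lambda>l. 1 / l) F G t - osc m (\<lambda>l. 1 / l) F G (- t)) / (2 * \<i>)"
proof -
  let ?w = "\<lambda>\<xi>::real^'n. sqrt ((norm \<xi>)\<^sup>2 + m\<^sup>2)"
  note L2 = fourier_L2_D(2)[OF f] fourier_L2_D(2)[OF g]
  have w_ge: "m \<le> ?w \<xi>" for \<xi>
    using dispersion_ge[of m \<xi>] m by (simp add: dispersion_def)
  have int: "integrable lborel (\<lambda>\<xi>. (cnj (F \<xi>) * (complex_of_real (b (?w \<xi>)) * H \<xi>)) * cis (s * ?w \<xi>))"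
    if "H \<in> L2" "b \<in> borel_measurable borel" "\<And>l. l \<ge> m \<Longrightarrow> \<bar>b l\<bar> \<le> B" for H b B s
    unfolding dispersion_def[symmetric] by (intro integrable_mult_cis osc_integrable[OF L2(1) that(1) m that(2,3)]) measurable
  have "L2_inner f (op_app (u1 m t) f) = (LINT \<xi>|lborel. cnj (F \<xi>) * (complex_of_real (cos (t * ?w \<xi>)) * F \<xi>))"
    unfolding u1_def by (rule H_fun_inner[OF f f, where B = 1]) simp_all
  also have "\<dots> = (osc m (\<lambda>_. 1) F F t + osc m (\<lambda>_. 1) F F (- t)) / 2"
    unfolding osc_def dispersion_def
    by (subst Bochner_Integration.integral_add[symmetric], (intro int[where B = 1] L2; simp)+,
        subst integral_divide_zero[symmetric])
       (intro Bochner_Integration.integral_cong refl, simp add: complex_eq_iff cis.ctr algebra_simps)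
  finally have 1: "L2_inner f (op_app (u1 m t) f) = (osc m (\<lambda>_. 1) F F t + osc m (\<lambda>_. 1) F F (- t)) / 2" .
  have sin_cis: "cnj a * (complex_of_real (sin x / c) * b)
      = ((cnj a * (complex_of_real (1 / c) * b)) * cis x - (cnj a * (complex_of_real (1 / c) * b)) * cis (- x)) / (2 * \<i>)"
    for a b :: complex and x c :: real
  proof -
    have "complex_of_real (sin x) = (cis x - cis (- x)) / (2 * \<i>)"
      by (simp add: complex_eq_iff)
    then have "complex_of_real (sin x / c) = complex_of_real (1 / c) * ((cis x - cis (- x)) / (2 * \<i>))"
      by simp
    then show ?thesis
      by (simp only: diff_divide_distrib right_diff_distrib left_diff_distrib times_divide_eq_right mult_ac)
  qed
  have inv_bound: "\<bar>1 / l\<bar> \<le> 1 / m" if "l \<ge> m" for l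
    using that m by (simp add: frac_le)
  have "L2_inner f (op_app (u2 m t) g) = (LINT \<xi>|lborel. cnj (F \<xi>) * (complex_of_real (sin (t * ?w \<xi>) / ?w \<xi>) * G \<xi>))"
    unfolding u2_def
  proof (rule H_fun_inner[OF g f, where B = "1 / m"])
    show "norm (complex_of_real (sin (t * ?w \<xi>) / ?w \<xi>)) \<le> 1 / m" for \<xi>
      unfolding norm_of_real abs_divide using w_ge[of \<xi>] m by (intro frac_le) auto
  qed measurable
  also have "\<dots> = (osc m (\<lambda>l. 1 / l) F G t - osc m (\<lambda>l. 1 / l) F G (- t)) / (2 * \<i>)"
    unfolding osc_def dispersion_def
    by (subst Bochner_Integration.integral_diff[symmetric], (intro int[where B = "1 / m"] L2 inv_bound; simp)+,
        subst integral_divide_zero[symmetric])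
       (simp only: sin_cis mult_minus_left)
  finally show ?thesis
    unfolding psi_def 1 by simp
qed

theorem proposition7p3:
  fixes m :: real and f g :: "real^'n::finite \<Rightarrow> complex"
  assumes "m > 0"
    and "f \<in> Domain dilation_gen \<inter> E_space m"
    and "g \<in> Domain dilation_gen \<inter> E_space m"
    and "op_app dilation_gen f \<in> E_space m"
    and "op_app dilation_gen g \<in> E_space m"
  shows "\<exists>C::real. \<forall>t::real. norm (psi m f g t) \<le> C * japanese_bracket t powr (- 1 / 2)"
proof -
  note m = \<open>m > 0\<close>
  have gen: "(h, op_app dilation_gen h) \<in> dilation_gen" if "h \<in> Domain dilation_gen" for h :: "real^'n \<Rightarrow> complex"
    using that unfolding op_app_def Domain_iff by (rule someI_ex)
  have ex: "\<exists>F. (h, F) \<in> fourier_L2 \<and> osc_L2 m F" if "h \<in> E_space m" for h :: "real^'n \<Rightarrow> complex"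
    using fourier_L2_exists[of h] osc_L2_of_E_space[OF that] that unfolding E_space_def by blast
  obtain F G A E where F: "(f, F) \<in> fourier_L2" "osc_L2 m F" and G: "(g, G) \<in> fourier_L2" "osc_L2 m G"
    and A: "(op_app dilation_gen f, A) \<in> fourier_L2" "osc_L2 m A"
    and E: "(op_app dilation_gen g, E) \<in> fourier_L2" "osc_L2 m E"
    using ex[of f] ex[of g] ex[OF assms(4)] ex[OF assms(5)] assms(2,3) by auto
  have f: "(f, op_app dilation_gen f) \<in> dilation_gen" and g: "(g, op_app dilation_gen g) \<in> dilation_gen"
    using gen assms by auto
  note f_data = f F(1) A(1) F(2) A(2) and g_data = g G(1) E(1) G(2) E(2)
  \<comment> \<open>Both choices of \<open>\<gamma>\<close> below have a derivative of the form
    \<open>c / (l + m)^2\<close>, with \<open>c = m\<close> and \<open>c = -1\<close>. The cancelled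
    form shows that it stays bounded after multiplication by the symbol of
    \<open>i[H, A]\<close>.\<close>
  have factor: "c / (l + m)\<^sup>2 * ((l\<^sup>2 - m\<^sup>2) / l) = (c / l) * ((l - m) / (l + m))" if "l + m > 0" for c l :: real
  proof -
    have "l\<^sup>2 - m\<^sup>2 = (l - m) * (l + m)"
      by (simp add: power2_eq_square algebra_simps)
    then show ?thesis
      using that by (simp add: power2_eq_square)
  qed
  \<comment> \<open>The cosine term needs weight 1, hence
    \<open>\<gamma> = l / (l + m)\<close>.\<close>
  have "\<exists>C. \<forall>t>0. norm (osc m (\<lambda>_. 1) F F t) \<le> C / sqrt t"
  proof (rule osc_decay[OF m f_data f_data, where \<gamma> = "\<lambda>l. l / (l + m)" and \<gamma>' = "\<lambda>l. m / (l + m)\<^sup>2" and B = 1])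
    fix l assume l: "m \<le> l"
    then have pos: "l > 0" "l + m > 0" using m by auto
    show "((\<lambda>l. l / (l + m)) has_real_derivative m / (l + m)\<^sup>2) (at l)"
      using pos by (auto intro!: derivative_eq_intros simp: power2_eq_square)
    show "\<bar>l / (l + m)\<bar> \<le> 1" using pos m by simp
    have "m / (l + m)\<^sup>2 * ((l\<^sup>2 - m\<^sup>2) / l) = (m / l) * ((l - m) / (l + m))"
      by (rule factor[OF pos(2)])
    also have "\<bar>\<dots>\<bar> \<le> 1 * 1"
      unfolding abs_mult using pos m l by (intro mult_mono) auto
    finally show "\<bar>m / (l + m)\<^sup>2 * ((l\<^sup>2 - m\<^sup>2) / l)\<bar> \<le> 1" by simp
    show "1 = l / (l + m) * ((l + m) / l)" using pos by simp
  qed measurable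
  then obtain C1 where C1: "\<And>t. t > 0 \<Longrightarrow> norm (osc m (\<lambda>_. 1) F F t) \<le> C1 / sqrt t" by blast
  \<comment> \<open>The sine term needs weight \<open>1 / l\<close>, hence
    \<open>\<gamma> = 1 / (l + m)\<close>. It is stated for an arbitrary pair because negative times
    exchange \<open>f\<close> and \<open>g\<close>.\<close>
  have inverse_decay: "\<exists>C. \<forall>t>0. norm (osc m (\<lambda>l. 1 / l) F' G' t) \<le> C / sqrt t"
    if f': "(f', a') \<in> dilation_gen" "(f', F') \<in> fourier_L2" "(a', A') \<in> fourier_L2" "osc_L2 m F'" "osc_L2 m A'"
    and g': "(g', b') \<in> dilation_gen" "(g', G') \<in> fourier_L2" "(b', E') \<in> fourier_L2" "osc_L2 m G'" "osc_L2 m E'"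
    for f' g' F' G' a' b' A' E' :: "real^'n \<Rightarrow> complex"
  proof (rule osc_decay[OF m f' g', where \<gamma> = "\<lambda>l. 1 / (l + m)" and \<gamma>' = "\<lambda>l. - 1 / (l + m)\<^sup>2" and B = "1 / m"])
    fix l assume l: "m \<le> l"
    then have pos: "l > 0" "l + m > 0" using m by auto
    show "((\<lambda>l. 1 / (l + m)) has_real_derivative - 1 / (l + m)\<^sup>2) (at l)"
      using pos by (auto intro!: derivative_eq_intros simp: power2_eq_square)
    show "\<bar>1 / (l + m)\<bar> \<le> 1 / m" using pos m by (simp add: frac_le)
    have "- 1 / (l + m)\<^sup>2 * ((l\<^sup>2 - m\<^sup>2) / l) = (- 1 / l) * ((l - m) / (l + m))"
      by (rule factor[OF pos(2)])
    also have "\<bar>\<dots>\<bar> \<le> 1 / m * 1"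
      unfolding abs_mult using pos m l by (intro mult_mono) (auto simp: frac_le)
    finally show "\<bar>- 1 / (l + m)\<^sup>2 * ((l\<^sup>2 - m\<^sup>2) / l)\<bar> \<le> 1 / m" by simp
    show "1 / l = 1 / (l + m) * ((l + m) / l)" using pos by simp
  qed measurable
  obtain C2 where C2: "\<And>t. t > 0 \<Longrightarrow> norm (osc m (\<lambda>l. 1 / l) F G t) \<le> C2 / sqrt t"
    using inverse_decay[OF f_data g_data] by blast
  obtain C3 where C3: "\<And>t. t > 0 \<Longrightarrow> norm (osc m (\<lambda>l. 1 / l) G F t) \<le> C3 / sqrt t"
    using inverse_decay[OF g_data f_data] by blast
  \<comment> \<open>By \<open>osc_uminus\<close>, the two times \<open>t\<close> and
    \<open>- t\<close> in Euler's formulas become \<open>\<bar>t\<bar>\<close> with both orders of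
    \<open>F\<close> and \<open>G\<close>, whatever the sign of \<open>t\<close>.\<close>
  have psi_le: "norm (psi m f g t) \<le> norm (osc m (\<lambda>_. 1) F F \<bar>t\<bar>)
      + norm (osc m (\<lambda>l. 1 / l) F G \<bar>t\<bar>) + norm (osc m (\<lambda>l. 1 / l) G F \<bar>t\<bar>)" for t
  proof -
    let ?a = "osc m (\<lambda>_. 1) F F" and ?b = "osc m (\<lambda>l. 1 / l) F G"
    have "norm (psi m f g t) \<le> norm ((?a t + ?a (- t)) / 2) + norm ((?b t - ?b (- t)) / (2 * \<i>))"
      unfolding psi_eq_osc[OF m F(1) G(1)] by (rule norm_triangle_ineq)
    also have "\<dots> \<le> (norm (?a t) + norm (?a (- t))) / 2 + (norm (?b t) + norm (?b (- t))) / 2"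
      unfolding norm_divide norm_mult
      by (intro add_mono) (simp_all add: divide_right_mono norm_triangle_ineq norm_triangle_ineq4)
    also have "\<dots> \<le> norm (?a \<bar>t\<bar>) + norm (?b \<bar>t\<bar>) + norm (osc m (\<lambda>l. 1 / l) G F \<bar>t\<bar>)"
      using osc_uminus[of m "\<lambda>_. 1" F F "\<bar>t\<bar>"] osc_uminus[of m "\<lambda>l. 1 / l" F G "\<bar>t\<bar>"]
      by (cases "t \<ge> 0") (simp_all add: field_simps)
    finally show ?thesis .
  qed
  show ?thesis
  proof (rule japanese_bracket_bound)
    fix t :: real
    show "norm (psi m f g t) \<le> (C1 + C2 + C3) / sqrt \<bar>t\<bar>" if "t \<noteq> 0"
      using psi_le[of t] C1[of "\<bar>t\<bar>"] C2[of "\<bar>t\<bar>"] C3[of "\<bar>t\<bar>"] that by (simp add: add_divide_distrib)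
    \<comment> \<open>A bound uniform in time, which takes care of small \<open>t\<close>, where
      \<open>1 / sqrt \<bar>t\<bar>\<close> blows up.\<close>
    show "norm (psi m f g t)
        \<le> (LINT \<xi>|lborel. norm (cnj (F \<xi>) * (complex_of_real 1 * F \<xi>)))
          + (LINT \<xi>|lborel. norm (cnj (F \<xi>) * (complex_of_real (1 / dispersion m \<xi>) * G \<xi>)))
          + (LINT \<xi>|lborel. norm (cnj (G \<xi>) * (complex_of_real (1 / dispersion m \<xi>) * F \<xi>)))"
      by (intro order_trans[OF psi_le] add_mono norm_osc_le)
  qed
qed

end
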